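(* Let $p$ be a prime. The closure of the group $\mathrm{GL}^0(\mathbb V_p)$ in $\operatorname{Polh}(\mathbb V_p,\mathbb V_p)$ coincides with the semigroup $\operatorname{Polh}_\Lambda(\mathbb V_p,\mathbb V_p)$, i.e. with the set consisting of $0$ and of all nonzero $R^\circ\in \operatorname{Polh}(\mathbb V_p,\mathbb V_p)$ such that $\alpha(R^\circ)^{-1}$ and $\beta(R^\circ)^{-1}$ belong to $\Lambda=\{p^j: j\ge 0\}$.
   Context: The space $\mathbb V_p$: let $\mathbb F_p$ be the field with $p$ elements. $\mathbb V_p$ is the $\mathbb F_p$-linear space of two-sided sequences $v=(\dots,v_{-1},v_0,v_1,\dots)$, $v_k\in\mathbb F_p$, with $v_j=0$ for all sufficiently large $j$. For $m\in\mathbb Z$ let $W^m\subset\mathbb V_p$ be the subspace of vectors $v$ with $v_l=0$ for all $l>-m$. The topology on $\mathbb V_p$ is defined by requiring that the subgroups $W^m$ are open and form a base of neighborhoods of $0$; $\mathbb V_p$ is a locally compact abelian group, and the $W^m$ are compact. The Haar measure $\phi$ on $\mathbb V_p$ is normalized so that $W^0$ has measure $1$. $\mathrm{GL}(\mathbb V_p)$ is the group of all continuous invertible linear operators (with continuous inverse) in $\mathbb V_p$, and $\mathrm{GL}^0(\mathbb V_p)$ is its subgroup of transformations preserving the Haar measure. Polyhomomorphisms: for a unimodular locally compact group $G$ with fixed Haar measure $\gamma$, $\operatorname{Polh}(G,G)$ consists of the zero measure $0$ on $G\times G$ and of all pairs $R^\circ=(R,\rho)$ where $R\subset G\times G$ is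 a closed subgroup and $\rho$ is a Haar measure on $R$ whose images under both projections to $G$ are dominated by $\gamma$ (i.e. $\rho(R\cap(A\times G))\le\gamma(A)$ and $\rho(R\cap (G\times A))\le\gamma(A)$ for all Borel $A$). For nonzero $R^\circ$ the image of $\rho$ under the first projection is $\alpha(R^\circ)\gamma|_{\operatorname{dom}R}$ and under the second one is $\beta(R^\circ)\gamma|_{\operatorname{im}R}$, where $\operatorname{dom}R$, $\operatorname{im}R$ are the first and the second projections of $R$ (open subgroups), and $0<\alpha(R^\circ),\beta(R^\circ)\le1$ are constants. Here $G=\mathbb V_p$, $\gamma=\phi$. An element $g\in\mathrm{GL}^0(\mathbb V_p)$ is regarded as the element of $\operatorname{Polh}(\mathbb V_p,\mathbb V_p)$ given by the graph $\{(v,gv)\}$ equipped with the image of $\phi$ under $v\mapsto(v,gv)$ (so $\alpha=\beta=1$). Topology: a sequence $R_j^\circ=(R_j,\rho_j)$ converges to $R^\circ=(R,\rho)$ if $\int\theta\,d\rho_j\to\int\theta\,d\rho$ for every $\theta\in C_c(G\times G)$ (convergence to $0$ means all these integrals tend to $0$); this convergence is metrizable and $\operatorname{Polh}(G,G)$ is compact. *)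

theory Defs
  imports "HOL-Analysis.Analysis" "HOL-Computational_Algebra.Primes"
begin

section \<open>The space of two-sided sequences\<close>

text \<open>
  The coefficient type \<open>'k\<close> is the finite field; for \<open>CARD('k) = p\<close> prime it is the field with
  \<open>p\<close> elements.
\<close>

typedef (overloaded) 'k vp = "{v :: int \<Rightarrow> 'k::zero. \<exists>N. \<forall>j>N. v j = 0}"
  morphisms coord Abs_vp
  by (rule exI[of _ "\<lambda>_. 0"]) simp

setup_lifting type_definition_vp

lemma vp_eqI: "(\<And>l. coord v l = coord w l) \<Longrightarrow> v = w"
  by (metis coord_inject ext)

instantiation vp :: (ab_group_add) ab_group_add
begin

lift_definition zero_vp :: "'a vp" is "\<lambda>_. 0"
  by simp

lift_definition plus_vp :: "'a vp \<Rightarrow> 'a vp \<Rightarrow> 'a vp" is "\<lambda>v w l. v l + w l"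
proof -
  fix v w :: "int \<Rightarrow> 'a"
  assume "\<exists>N. \<forall>j>N. v j = 0" "\<exists>N. \<forall>j>N. w j = 0"
  then obtain M N where "\<forall>j>M. v j = 0" "\<forall>j>N. w j = 0"
    by blast
  then have "\<forall>j>max M N. v j + w j = 0"
    by simp
  then show "\<exists>N. \<forall>j>N. v j + w j = 0" ..
qed

lift_definition uminus_vp :: "'a vp \<Rightarrow> 'a vp" is "\<lambda>v l. - v l"
  by simp

lift_definition minus_vp :: "'a vp \<Rightarrow> 'a vp \<Rightarrow> 'a vp" is "\<lambda>v w l. v l - w l"
proof -
  fix v w :: "int \<Rightarrow> 'a"
  assume "\<exists>N. \<forall>j>N. v j = 0" "\<exists>N. \<forall>j>N. w j = 0"
  then obtain M N where "\<forall>j>M. v j = 0" "\<forall>j>N. w j = 0"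
    by blast
  then have "\<forall>j>max M N. v j - w j = 0"
    by simp
  then show "\<exists>N. \<forall>j>N. v j - w j = 0" ..
qed

instance
  by standard (rule vp_eqI, transfer, simp add: ac_simps)+

end

lift_definition vp_scale :: "'k::mult_zero \<Rightarrow> 'k vp \<Rightarrow> 'k vp" is "\<lambda>c v l. c * v l"
  by (metis mult_zero_right)

lemma vector_space_vp: "vector_space (vp_scale :: 'k::field \<Rightarrow> 'k vp \<Rightarrow> 'k vp)"
  by unfold_locales (transfer; simp add: algebra_simps)+

definition W :: "int \<Rightarrow> 'k::zero vp set" where
  "W m = {v. \<forall>l. l > - m \<longrightarrow> coord v l = 0}"

lemma W_antimono: "n \<le> m \<Longrightarrow> W m \<subseteq> W n"
  by (auto simp: W_def)

lemma zero_in_W [simp]: "0 \<in> W m"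
  by (simp add: W_def zero_vp.rep_eq)

lemma W_add: "v \<in> W m \<Longrightarrow> w \<in> W m \<Longrightarrow> v + w \<in> W m"
  by (simp add: W_def plus_vp.rep_eq)

lemma W_uminus: "v \<in> W m \<Longrightarrow> - v \<in> W m"
  by (simp add: W_def uminus_vp.rep_eq)

lemma W_diff: "v \<in> W m \<Longrightarrow> w \<in> W m \<Longrightarrow> v - w \<in> W m"
  by (simp add: W_def minus_vp.rep_eq)


instantiation vp :: (ab_group_add) topological_space
begin

definition open_vp :: "'a vp set \<Rightarrow> bool" where
  "open_vp U \<longleftrightarrow> (\<forall>v\<in>U. \<exists>m. \<forall>w\<in>W m. v + w \<in> U)"

instance
proof
  show "open (UNIV :: 'a vp set)"
    by (simp add: open_vp_def)
  show "open (S \<inter> T)" if ST: "open S" "open T" for S T :: "'a vp set"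
    unfolding open_vp_def
  proof
    fix v assume "v \<in> S \<inter> T"
    then obtain m n where "\<forall>w\<in>W m. v + w \<in> S" "\<forall>w\<in>W n. v + w \<in> T"
      using ST unfolding open_vp_def by blast
    then have "\<forall>w\<in>W (max m n). v + w \<in> S \<inter> T"
      using W_antimono[of m "max m n"] W_antimono[of n "max m n"] by auto
    then show "\<exists>m. \<forall>w\<in>W m. v + w \<in> S \<inter> T" ..
  qed
  show "open (\<Union>K)" if "\<forall>S\<in>K. open S" for K :: "'a vp set set"
    using that unfolding open_vp_def by (meson Union_iff)
qed

end

lemma open_coset_W: "open {w :: 'k::ab_group_add vp. w - v \<in> W m}"
  unfolding open_vp_def
proof
  fix u :: "'k vp" assume "u \<in> {w. w - v \<in> W m}"
  then have "\<forall>w\<in>W m. u + w \<in> {w. w - v \<in> W m}"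
    using W_add by (force simp: algebra_simps)
  then show "\<exists>n. \<forall>w\<in>W n. u + w \<in> {w. w - v \<in> W m}" ..
qed

lemma open_W: "open (W m :: 'k::ab_group_add vp set)"
  using open_coset_W[of 0 m] by simp

lemma eventually_nhds_vp:
  fixes v :: "'k::ab_group_add vp"
  shows "eventually P (nhds v) \<longleftrightarrow> (\<exists>m. \<forall>w\<in>W m. P (v + w))"
proof
  assume "eventually P (nhds v)"
  then obtain U where "open U" "v \<in> U" "\<forall>x\<in>U. P x"
    by (auto simp: eventually_nhds)
  then show "\<exists>m. \<forall>w\<in>W m. P (v + w)"
    by (meson open_vp_def)
next
  assume "\<exists>m. \<forall>w\<in>W m. P (v + w)"
  then obtain m where m: "\<forall>w\<in>W m. P (v + w)" ..
  have "P x" if "x - v \<in> W m" for x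
    using m that by (metis add_diff_cancel_left' diff_add_cancel add.commute)
  then show "eventually P (nhds v)"
    unfolding eventually_nhds
    by (intro exI[of _ "{w. w - v \<in> W m}"]) (simp add: open_coset_W)
qed

instance vp :: (ab_group_add) t2_space
proof
  fix x y :: "'a vp" assume "x \<noteq> y"
  then obtain l where l: "coord x l \<noteq> coord y l"
    using vp_eqI by blast
  let ?U = "\<lambda>v. {w. w - v \<in> W (1 - l)}"
  have "?U x \<inter> ?U y = {}"
  proof (rule ccontr)
    assume "?U x \<inter> ?U y \<noteq> {}"
    then obtain w where "w - x \<in> W (1 - l)" "w - y \<in> W (1 - l)"
      by blast
    then have "coord (w - x) l = 0" "coord (w - y) l = 0"
      by (auto simp: W_def)
    with l show False
      by (simp add: minus_vp.rep_eq)
  qed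
  then show "\<exists>U V. open U \<and> open V \<and> x \<in> U \<and> y \<in> V \<and> U \<inter> V = {}"
    using open_coset_W by (intro exI[of _ "?U x"] exI[of _ "?U y"]) auto
qed

instance vp :: (ab_group_add) topological_ab_group_add
proof
  fix a b :: "'a vp"
  show "((\<lambda>x. fst x + snd x) \<longlongrightarrow> a + b) (nhds a \<times>\<^sub>F nhds b)"
    unfolding filterlim_iff
  proof (intro allI impI)
    fix P assume "eventually P (nhds (a + b))"
    then obtain m where m: "\<forall>w\<in>W m. P (a + b + w)"
      by (auto simp: eventually_nhds_vp)
    have a: "eventually (\<lambda>x. x - a \<in> W m) (nhds a)" and b: "eventually (\<lambda>x. x - b \<in> W m) (nhds b)"
      by (auto simp: eventually_nhds_vp intro!: exI[of _ m])
    have "P (x + y)" if "x - a \<in> W m" "y - b \<in> W m" for x y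
      using bspec[OF m W_add[OF that]] by (simp add: algebra_simps)
    then show "eventually (\<lambda>x. P (fst x + snd x)) (nhds a \<times>\<^sub>F nhds b)"
      unfolding eventually_prod_filter using a b by auto
  qed
  show "(uminus \<longlongrightarrow> - a) (nhds a)"
    unfolding filterlim_iff
  proof (intro allI impI)
    fix P assume "eventually P (nhds (- a))"
    then obtain m where m: "\<forall>w\<in>W m. P (- a + w)"
      by (auto simp: eventually_nhds_vp)
    have "P (- (a + w))" if "w \<in> W m" for w
      using bspec[OF m W_uminus[OF that]] by (simp add: algebra_simps)
    then show "eventually (\<lambda>x. P (- x)) (nhds a)"
      by (auto simp: eventually_nhds_vp)
  qed
qed

instance vp :: ("{ab_group_add,finite}") second_countable_topology
proof
  let ?c = "\<lambda>(m, xs) l :: int. if l + m - 1 < int (length xs) then xs ! nat (l + m - 1) else (0 :: 'a)"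
  define U where "U = (\<lambda>q. {w :: 'a vp. \<forall>l > - fst q. coord w l = ?c q l})"
  define B where "B = U ` (UNIV \<times> lists UNIV)"
  have "countable B"
    unfolding B_def by (intro countable_image countable_SIGMA countable_lists) auto
  moreover have "topological_basis B"
  proof (rule topological_basisI)
    fix V assume "V \<in> B"
    then obtain q where V: "V = U q"
      by (auto simp: B_def)
    have "\<forall>w\<in>W (fst q). v + w \<in> U q" if "v \<in> U q" for v
      using that by (auto simp: U_def W_def plus_vp.rep_eq)
    then show "open V"
      unfolding V open_vp_def by blast
  next
    fix O' and v :: "'a vp" assume "open O'" "v \<in> O'"
    then obtain m where m: "\<forall>w\<in>W m. v + w \<in> O'"
      by (auto simp: open_vp_def)
    obtain N where N: "\<forall>j>N. coord v j = 0"
      using coord[of v] by auto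
    define xs where "xs = map (\<lambda>i. coord v (int i + 1 - m)) [0..<nat (N + m)]"
    have c: "?c (m, xs) l = coord v l" if "l > - m" for l
      using that N by (auto simp: xs_def)
    have "v \<in> U (m, xs)"
      using c by (simp add: U_def)
    moreover have "U (m, xs) \<subseteq> O'"
    proof
      fix w assume "w \<in> U (m, xs)"
      then have "w - v \<in> W m"
        using c by (simp add: U_def W_def minus_vp.rep_eq)
      then have "v + (w - v) \<in> O'"
        using m by blast
      then show "w \<in> O'"
        by simp
    qed
    ultimately show "\<exists>B'\<in>B. v \<in> B' \<and> B' \<subseteq> O'"
      unfolding B_def by (intro bexI[of _ "U (m, xs)"]) auto
  qed
  ultimately show "\<exists>B :: 'a vp set set. countable B \<and> open = generate_topology B"
    using topological_basis_imp_subbasis by blast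
qed


section \<open>Haar measures and polyhomomorphisms\<close>

text \<open>
  The measure space of a Haar measure on a closed subgroup \<open>H\<close> is \<open>H\<close> itself with its Borel sets.
  Regularity is not listed: in the second countable locally compact groups
  considered here every Borel measure that is finite on compact sets is regular.
\<close>

definition haar_measure_on ::
    "'g::{ab_group_add,second_countable_topology,t2_space} set \<Rightarrow> 'g measure \<Rightarrow> bool" where
  "haar_measure_on H \<mu> \<longleftrightarrow>
     sets \<mu> = sets (restrict_space borel H) \<and>
     emeasure \<mu> H \<noteq> 0 \<and>
     (\<forall>K. K \<subseteq> H \<and> compact K \<longrightarrow> emeasure \<mu> K < \<infinity>) \<and>
     (\<forall>h\<in>H. \<forall>A\<in>sets \<mu>. emeasure \<mu> ((+) h ` A) = emeasure \<mu> A)"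

definition add_subgroup :: "'g::group_add set \<Rightarrow> bool" where
  "add_subgroup H \<longleftrightarrow> 0 \<in> H \<and> (\<forall>x\<in>H. \<forall>y\<in>H. x + y \<in> H) \<and> (\<forall>x\<in>H. - x \<in> H)"

text \<open>\<open>Zero\<close> is the zero measure on \<open>G \<times> G\<close>; \<open>Pair_polyhom R \<rho>\<close> is a closed subgroup with a Haar measure.\<close>

datatype 'g polyhom = Zero | Pair_polyhom "('g \<times> 'g) set" "('g \<times> 'g) measure"

definition Polh ::
    "'g::{topological_ab_group_add,second_countable_topology,t2_space} measure \<Rightarrow> 'g polyhom set" where
  "Polh \<gamma> = {Zero} \<union>
     {Pair_polyhom R \<rho> | R \<rho>.
        closed R \<and> add_subgroup R \<and> haar_measure_on R \<rho> \<and>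
        (\<forall>A\<in>sets borel. emeasure \<rho> (R \<inter> (A \<times> UNIV)) \<le> emeasure \<gamma> A) \<and>
        (\<forall>A\<in>sets borel. emeasure \<rho> (R \<inter> (UNIV \<times> A)) \<le> emeasure \<gamma> A)}"

text \<open>
  \<open>dom R\<close> and \<open>im R\<close> are \<^const>\<open>Domain\<close> \<open>R\<close> and \<^const>\<open>Range\<close> \<open>R\<close>.
  The equations say that the two images of \<open>\<rho>\<close> are \<open>\<alpha> \<gamma>\<close> restricted to \<open>dom R\<close>
  and \<open>\<beta> \<gamma>\<close> restricted to \<open>im R\<close>.
\<close>

definition alpha :: "'g::topological_space measure \<Rightarrow> ('g \<times> 'g) set \<Rightarrow> ('g \<times> 'g) measure \<Rightarrow> real" where
  "alpha \<gamma> R \<rho> = (THE a. 0 < a \<and> a \<le> 1 \<and>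
     (\<forall>A\<in>sets borel. emeasure (distr \<rho> borel fst) A = ennreal a * emeasure \<gamma> (A \<inter> Domain R)))"

definition beta :: "'g::topological_space measure \<Rightarrow> ('g \<times> 'g) set \<Rightarrow> ('g \<times> 'g) measure \<Rightarrow> real" where
  "beta \<gamma> R \<rho> = (THE b. 0 < b \<and> b \<le> 1 \<and>
     (\<forall>A\<in>sets borel. emeasure (distr \<rho> borel snd) A = ennreal b * emeasure \<gamma> (A \<inter> Range R)))"

definition Polh_restricted ::
    "'g::{topological_ab_group_add,second_countable_topology,t2_space} measure \<Rightarrow> real set \<Rightarrow> 'g polyhom set" where
  "Polh_restricted \<gamma> \<Lambda> = {Zero} \<union>
     {Pair_polyhom R \<rho> | R \<rho>. Pair_polyhom R \<rho> \<in> Polh \<gamma> \<and>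
        inverse (alpha \<gamma> R \<rho>) \<in> \<Lambda> \<and> inverse (beta \<gamma> R \<rho>) \<in> \<Lambda>}"


subsection \<open>Topology\<close>

primrec polyhom_integral :: "'g polyhom \<Rightarrow> ('g \<times> 'g \<Rightarrow> real) \<Rightarrow> real" where
  "polyhom_integral Zero \<theta> = 0"
| "polyhom_integral (Pair_polyhom R \<rho>) \<theta> = (\<integral>x. \<theta> x \<partial>\<rho>)"

definition polyhom_converges ::
    "(nat \<Rightarrow> 'g::topological_space polyhom) \<Rightarrow> 'g polyhom \<Rightarrow> bool" where
  "polyhom_converges X P \<longleftrightarrow>
     (\<forall>\<theta>. continuous_on UNIV \<theta> \<and> compact (closure {x. \<theta> x \<noteq> 0}) \<longrightarrow>
        (\<lambda>j. polyhom_integral (X j) \<theta>) \<longlonglongrightarrow> polyhom_integral P \<theta>)"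

text \<open>
  The topology is given by its convergent sequences. As the convergence is metrizable, its open sets
  are the sequentially open ones.
\<close>

definition Polh_topology ::
    "'g::{topological_ab_group_add,second_countable_topology,t2_space} measure \<Rightarrow> 'g polyhom topology" where
  "Polh_topology \<gamma> = topology (\<lambda>U. U \<subseteq> Polh \<gamma> \<and>
     (\<forall>X P. range X \<subseteq> Polh \<gamma> \<and> P \<in> U \<and> polyhom_converges X P \<longrightarrow> (\<forall>\<^sub>F j in sequentially. X j \<in> U)))"

lemma openin_Polh_topology:
  "openin (Polh_topology \<gamma>) U \<longleftrightarrow> U \<subseteq> Polh \<gamma> \<and>
     (\<forall>X P. range X \<subseteq> Polh \<gamma> \<and> P \<in> U \<and> polyhom_converges X P \<longrightarrow> (\<forall>\<^sub>F j in sequentially. X j \<in> U))"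
proof -
  let ?L = "\<lambda>U. U \<subseteq> Polh \<gamma> \<and>
     (\<forall>X P. range X \<subseteq> Polh \<gamma> \<and> P \<in> U \<and> polyhom_converges X P \<longrightarrow> (\<forall>\<^sub>F j in sequentially. X j \<in> U))"
  have "?L (S \<inter> T)" if "?L S" "?L T" for S T
  proof (intro conjI allI impI)
    show "S \<inter> T \<subseteq> Polh \<gamma>"
      using that by blast
    fix X P assume X: "range X \<subseteq> Polh \<gamma> \<and> P \<in> S \<inter> T \<and> polyhom_converges X P"
    with that have "\<forall>\<^sub>F j in sequentially. X j \<in> S" "\<forall>\<^sub>F j in sequentially. X j \<in> T"
      by blast+
    then show "\<forall>\<^sub>F j in sequentially. X j \<in> S \<inter> T"
      by eventually_elim simp
  qed
  moreover have "?L (\<Union>K)" if K: "\<forall>S\<in>K. ?L S" for K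
  proof (intro conjI allI impI)
    show "\<Union>K \<subseteq> Polh \<gamma>"
      using K by blast
    fix X P assume X: "range X \<subseteq> Polh \<gamma> \<and> P \<in> \<Union>K \<and> polyhom_converges X P"
    then obtain S where S: "S \<in> K" "P \<in> S"
      by blast
    with K X have "\<forall>\<^sub>F j in sequentially. X j \<in> S"
      by blast
    then show "\<forall>\<^sub>F j in sequentially. X j \<in> \<Union>K"
      using S by (auto elim: eventually_mono)
  qed
  ultimately have "istopology ?L"
    unfolding istopology_def by blast
  then show ?thesis
    by (simp add: Polh_topology_def)
qed

lemma topspace_Polh_topology [simp]: "topspace (Polh_topology \<gamma>) = Polh \<gamma>"
proof -
  have "openin (Polh_topology \<gamma>) (Polh \<gamma>)"
    unfolding openin_Polh_topology by (auto intro!: always_eventually)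
  moreover have "topspace (Polh_topology \<gamma>) \<subseteq> Polh \<gamma>"
    using openin_topspace[of "Polh_topology \<gamma>"] by (simp only: openin_Polh_topology)
  ultimately show ?thesis
    using openin_subset by blast
qed


section \<open>Operators and their graphs\<close>

definition GL :: "('k::field vp \<Rightarrow> 'k vp) set" where
  "GL = {g. Vector_Spaces.linear vp_scale vp_scale g \<and> bij g \<and>
            continuous_on UNIV g \<and> continuous_on UNIV (inv g)}"

definition GL0 :: "'k::field vp measure \<Rightarrow> ('k vp \<Rightarrow> 'k vp) set" where
  "GL0 \<phi> = {g \<in> GL. distr \<phi> \<phi> g = \<phi>}"

definition graph :: "('a \<Rightarrow> 'b) \<Rightarrow> ('a \<times> 'b) set" where
  "graph g = range (\<lambda>v. (v, g v))"

definition graph_polyhom ::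
    "'g::topological_space measure \<Rightarrow> ('g \<Rightarrow> 'g) \<Rightarrow> 'g polyhom" where
  "graph_polyhom \<gamma> g =
     Pair_polyhom (graph g) (distr \<gamma> (restrict_space borel (graph g)) (\<lambda>v. (v, g v)))"

end

theory Submission
  imports Defs
begin

text \<open>
  A nonzero \<open>R\<^sup>\<circ> = (R, \<rho>)\<close> is tested on the compact open subgroups \<open>Q n = W n \<times> W n\<close>: convergence
  means convergence of the masses of their cosets, and \<open>\<alpha>\<close> and \<open>\<beta>\<close> are powers of \<open>p\<close> exactly if the
  masses \<open>\<rho>(Q n)\<close> are, because all the indices between these subgroups of \<open>R\<close> are powers of \<open>p\<close>.
  As the powers of \<open>p\<close> have no positive limit other than themselves, the restricted
  polyhomomorphisms form a closed set.
  Conversely, at level \<open>n\<close> the pair \<open>(R, \<rho>)\<close> is seen as a linear relation \<open>S\<close> in the finite quotient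
  \<open>W (-n) / W n\<close> together with the mass \<open>\<rho>(Q n) = p^(-n-s)\<close>. Domination by the Haar measure says
  that kernel and indefiniteness of \<open>S\<close> have dimension at most \<open>s\<close>, which is what is needed to
  find an operator that is the identity on \<open>W (n+s)\<close> and whose graph induces \<open>S\<close> with this mass.
  The operator is built by permuting an algebraic basis; being the identity on an open subgroup
  makes it continuous and measure preserving.
\<close>

section \<open>Linear relations and their dilations\<close>

text \<open>The exponent \<open>s\<close> comes from counting: if \<open>g\<close> fixes
  \<open>W (n + s)\<close> pointwise and sends no other vector of \<open>W n\<close> into
  \<open>W n\<close>, its graph meets a coset of \<open>Q n\<close> either not at all or over a
  translate of \<open>W (n + s)\<close>, that is, with mass \<open>p^(-n-s)\<close>. The masses then
  agree as soon as the right cosets are met. The quotient \<open>W n / W (n + s)\<close> is also the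
  only room in which an injective \<open>g\<close> can realize a relation that is neither injective
  nor single valued: kernel directions are mapped into it and indefinite values come out of it.

  The obstacle is that the space has an uncountable algebraic basis. Only the part of a basis beyond
  an open subgroup is countable, so the operator is fixed as the identity on a basis of
  \<open>W (n + s)\<close> and only the countable remainder is rearranged.

  Primality of \<open>p\<close> makes every additive subgroup a linear relation, which allows bases
  to be used for \<open>R\<close>. The zero measure arises by the same construction from the
  relation \<open>W n \<times> W n\<close> with \<open>s = 0\<close>: the mass escapes to
  infinity.\<close>

lemma bij_betw_interchange:
  assumes fin: "finite X" "finite X'"
    and inf: "infinite Y" "countable Y" "infinite Y'" "countable Y'"
    and disj: "X \<inter> Y = {}" "X' \<inter> Y' = {}"
  shows "\<exists>h. bij_betw h (X \<union> Y) (X' \<union> Y') \<and> h ` X \<subseteq> Y' \<and> X' \<subseteq> h ` Y"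
proof -
  \<comment> \<open>\<open>Z'\<close> is set aside to receive \<open>X\<close>, and \<open>Z\<close>
    to cover \<open>X'\<close>. What is left of \<open>Y\<close> and \<open>Y'\<close> is still
    countably infinite, so the two remainders are in bijection.\<close>
  obtain Z' where Z': "Z' \<subseteq> Y'" "finite Z'" "card Z' = card X"
    using infinite_arbitrarily_large[OF inf(3)] by blast
  obtain Z where Z: "Z \<subseteq> Y" "finite Z" "card Z = card X'"
    using infinite_arbitrarily_large[OF inf(1)] by blast
  obtain f1 where f1: "bij_betw f1 X Z'"
    using Z' fin finite_same_card_bij by metis
  obtain f2 where f2: "bij_betw f2 Z X'"
    using Z fin finite_same_card_bij by metis
  have "infinite (Y - Z)" "infinite (Y' - Z')" "countable (Y - Z)" "countable (Y' - Z')"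
    using inf Z Z' by auto
  then have "bij_betw (from_nat_into (Y' - Z') \<circ> to_nat_on (Y - Z)) (Y - Z) (Y' - Z')"
    using bij_betw_trans to_nat_on_infinite bij_betw_from_nat_into by blast
  then obtain f3 where f3: "bij_betw f3 (Y - Z) (Y' - Z')" by blast
  define h where "h x = (if x \<in> X then f1 x else if x \<in> Z then f2 x else f3 x)" for x
  have h1: "bij_betw h X Z'"
    using f1 by (rule bij_betw_cong[THEN iffD1, rotated]) (simp add: h_def)
  have h2: "bij_betw h Z X'"
    using f2 by (rule bij_betw_cong[THEN iffD1, rotated]) (use disj Z in \<open>auto simp: h_def\<close>)
  have h3: "bij_betw h (Y - Z) (Y' - Z')"
    using f3 by (rule bij_betw_cong[THEN iffD1, rotated]) (use disj in \<open>auto simp: h_def\<close>)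
  have "bij_betw h (X \<union> (Z \<union> (Y - Z))) (Z' \<union> (X' \<union> (Y' - Z')))"
    using disj Z Z' by (intro bij_betw_combine h1 h2 h3) auto
  moreover have "X \<union> (Z \<union> (Y - Z)) = X \<union> Y" "Z' \<union> (X' \<union> (Y' - Z')) = X' \<union> Y'"
    using Z Z' by auto
  moreover have "h ` X \<subseteq> Y'"
    using h1 Z' by (auto simp: bij_betw_def)
  moreover have "X' \<subseteq> h ` Y"
    using h2 Z by (auto simp: bij_betw_def)
  ultimately show ?thesis by metis
qed

lemma bij_betw_glue:
  assumes "bij_betw f A B" "bij_betw g C D" "A \<inter> C = {}" "B \<inter> D = {}"
  shows "\<exists>h. bij_betw h (A \<union> C) (B \<union> D) \<and> (\<forall>x\<in>A. h x = f x) \<and> (\<forall>x\<in>C. h x = g x)"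
proof (intro exI conjI)
  let ?h = "\<lambda>x. if x \<in> A then f x else g x"
  show "bij_betw ?h (A \<union> C) (B \<union> D)"
  proof (rule bij_betw_combine)
    show "bij_betw ?h A B"
      using assms(1) by (rule bij_betw_cong[THEN iffD1, rotated]) simp
    show "bij_betw ?h C D"
      using assms(2) by (rule bij_betw_cong[THEN iffD1, rotated]) (use assms in auto)
  qed (use assms in simp)
qed (use assms in auto)

context vector_space
begin

lemma span_disjoint_independent:
  assumes ind: "independent b" and sub: "P \<subseteq> b" "Q \<subseteq> b" "P \<inter> Q = {}"
    and v: "v \<in> span P" "v \<in> span Q"
  shows "v = 0"
proof -
  have "representation b v = representation P v" "representation b v = representation Q v"
    using representation_extend[OF ind v(1) sub(1)] representation_extend[OF ind v(2) sub(2)] by auto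
  then have "representation P v x = 0" for x
    using representation_ne_zero sub(3) by (metis disjoint_iff)
  moreover have "(\<Sum>x | representation P v x \<noteq> 0. scale (representation P v x) x) = v"
    by (rule sum_nonzero_representation_eq[OF independent_mono[OF ind sub(1)] v(1)])
  ultimately show ?thesis by simp
qed

text \<open>The component of \<open>x\<close> along the vectors that \<open>g\<close> sends outside
  \<open>Q\<close> has its image in the spans of two disjoint parts of the independent set
  \<open>c\<close>, hence vanishes. Whether \<open>g x\<close> falls into a subspace can thus be
  decided on basis vectors.\<close>

lemma span_inter_preimage:
  assumes g: "Vector_Spaces.linear scale scale g" and ind: "independent c" and inj: "inj g"
    and P: "g ` P \<subseteq> c" and Q: "Q \<subseteq> c"
    and x: "x \<in> span P" "g x \<in> span Q"
  shows "x \<in> span {b \<in> P. g b \<in> Q}"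
proof -
  interpret g: Vector_Spaces.linear scale scale g by fact
  let ?P1 = "{b \<in> P. g b \<in> Q}" and ?P2 = "{b \<in> P. g b \<notin> Q}"
  have "?P1 \<union> ?P2 = P" by auto
  with x obtain x1 x2 where x12: "x = x1 + x2" "x1 \<in> span ?P1" "x2 \<in> span ?P2"
    using span_Un[of ?P1 ?P2] by auto
  have gx: "g x = g x1 + g x2" by (simp add: x12 g.add)
  have "g x1 \<in> span (g ` ?P1)" "g x2 \<in> span (g ` ?P2)"
    using x12 g.span_image by blast+
  moreover have "span (g ` ?P1) \<subseteq> span Q"
    by (rule span_mono) auto
  ultimately have "g x2 \<in> span Q"
    using x(2) gx span_diff by (metis add_diff_cancel_left' in_mono)
  then have "g x2 = 0"
    using P Q \<open>g x2 \<in> span (g ` ?P2)\<close>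
    by (intro span_disjoint_independent[OF ind, of "g ` ?P2" Q]) auto
  then have "x2 = 0" using inj g.inj_iff_eq_0 by blast
  then show ?thesis using x12 by simp
qed

text \<open>
  A linear relation \<open>S\<close> between finite-dimensional quotients \<open>E / B\<close> is dilated to the graph of an
  invertible operator \<open>g\<close>: the directions in \<open>E\<close> on which \<open>S\<close> is undefined are sent out of \<open>E\<close>,
  those in \<open>E\<close> not reached by \<open>S\<close> are reached from outside, and the kernel and the indefiniteness
  of \<open>S\<close> are paired with directions of \<open>B / A\<close>; the latter is possible because \<open>B / A\<close> has
  dimension at least that of either of them.
\<close>

lemma linear_relation_dilation:
  assumes S: "S \<subseteq> E \<times> E" "B \<times> B \<subseteq> S"
      "\<And>x y x' y'. (x, y) \<in> S \<Longrightarrow> (x', y') \<in> S \<Longrightarrow> (x + x', y + y') \<in> S"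
      "\<And>c x y. (x, y) \<in> S \<Longrightarrow> (scale c x, scale c y) \<in> S"
    and subE: "subspace E"
    and bA: "span bA = A" "bA \<subseteq> bB" and bB: "span bB = B" "finite (bB - bA)"
    and bK: "independent bK" "bB \<subseteq> bK" "span bK = {x. (x, 0) \<in> S}" "finite (bK - bB)"
      "card (bK - bB) \<le> card (bB - bA)"
    and cI: "independent cI" "bB \<subseteq> cI" "span cI = {y. (0, y) \<in> S}" "finite (cI - bB)"
      "card (cI - bB) \<le> card (bB - bA)"
    and finE: "\<And>b. independent b \<Longrightarrow> bB \<subseteq> b \<Longrightarrow> span b = E \<Longrightarrow> finite (b - bB)"
    and infV: "\<And>b b'. independent b' \<Longrightarrow> b \<subseteq> b' \<Longrightarrow> span b = E \<Longrightarrow> span b' = UNIV \<Longrightarrow>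
      infinite (b' - b) \<and> countable (b' - b)"
  shows "\<exists>g. Vector_Spaces.linear scale scale g \<and> bij g \<and> (\<forall>x\<in>A. g x = x) \<and> (\<forall>x\<in>B. g x \<in> B \<longrightarrow> x \<in> A) \<and>
    (\<forall>x\<in>E. g x \<in> E \<longrightarrow> (x, g x) \<in> S) \<and> (\<forall>(x, y)\<in>S. \<exists>v. x - v \<in> B \<and> y - g v \<in> B)"
proof -
  interpret vector_space_pair scale scale ..
  have B0: "subspace B" and "0 \<in> B" using bB subspace_span span_zero by auto
  then have S0: "(0, 0) \<in> S" using S by auto
  have Sdiff: "(x - x', y - y') \<in> S" if "(x, y) \<in> S" "(x', y') \<in> S" for x y x' y'
    using S(3)[OF that(1) S(4)[OF that(2), of "-1"]] by simp

  \<comment> \<open>Bases adapted to the domain and the image of the relation\<close>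
  define D where "D = {x. \<exists>y. (x, y) \<in> S}"
  define J where "J = {y. \<exists>x. (x, y) \<in> S}"
  have subD: "subspace D" and subJ: "subspace J"
    unfolding D_def J_def subspace_def using S S0 by blast+
  obtain bD where bD: "bK \<subseteq> bD" "bD \<subseteq> D" "independent bD" "D \<subseteq> span bD"
  proof -
    have "bK \<subseteq> D" using bK(3) span_superset[of bK] by (auto simp: D_def)
    then show ?thesis using maximal_independent_subset_extend[OF _ bK(1)] that by metis
  qed
  then have spD: "span bD = D" using subD span_subspace by blast
  have DE: "D \<subseteq> E" and JE: "J \<subseteq> E" using S by (auto simp: D_def J_def)
  obtain bE where bE: "bD \<subseteq> bE" "bE \<subseteq> E" "independent bE" "E \<subseteq> span bE"
    using maximal_independent_subset_extend[OF subset_trans[OF bD(2) DE] bD(3)] by metis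
  then have spE: "span bE = E" using subE span_subspace by blast
  obtain bV where bV: "bE \<subseteq> bV" "independent bV" "UNIV = span bV"
    by (rule maximal_independent_subset_extend[OF subset_UNIV bE(3)]) auto
  \<comment> \<open>\<open>\<sigma>\<close> picks one value of the relation over each basis vector
    complementary to the kernel. Its linear extension \<open>\<tau>\<close>, zero on
    \<open>bK\<close>, is a linear selection of \<open>S\<close> on all of \<open>D\<close>.\<close>
  have "\<forall>m\<in>bD - bK. \<exists>y. (m, y) \<in> S" using bD by (auto simp: D_def)
  then obtain \<sigma> where \<sigma>: "\<And>m. m \<in> bD - bK \<Longrightarrow> (m, \<sigma> m) \<in> S" by metis
  define M where "M = bD - bK"
  obtain \<tau> where \<tau>: "Vector_Spaces.linear scale scale \<tau>" "\<And>m. m \<in> bD \<Longrightarrow> \<tau> m = (if m \<in> bK then 0 else \<sigma> m)"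
    using linear_independent_extend[OF bD(3), of "\<lambda>m. if m \<in> bK then 0 else \<sigma> m"] by auto
  interpret \<tau>: Vector_Spaces.linear scale scale \<tau> by fact
  have \<tau>S: "(x, \<tau> x) \<in> S" if "x \<in> span bD" for x
    using that
  proof (induction rule: span_induct)
    case base
    show ?case unfolding mem_Collect_eq subspace_def
      using S S0 by (auto simp: \<tau>.add \<tau>.scale)
  next
    case (step x)
    show ?case
      using step bK(3) span_base[of x bK] \<sigma>[of x] \<tau>(2)[of x] by auto
  qed
  \<comment> \<open>This is injectivity of the isomorphism from domain modulo kernel to image modulo
    indefiniteness: an indefinite value \<open>\<tau> x\<close> can be subtracted, which puts
    \<open>x\<close> into the kernel, and the kernel meets \<open>span M\<close> only in
    zero.\<close>
  have \<tau>M: "x = 0" if x: "x \<in> span M" "\<tau> x \<in> span cI" for x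
  proof -
    have "(x, \<tau> x) \<in> S" using x \<tau>S span_mono[of M bD] by (auto simp: M_def)
    moreover have "(0, \<tau> x) \<in> S" using x cI by auto
    ultimately have "(x, 0) \<in> S" using Sdiff by fastforce
    then have "x \<in> span bK" using bK by auto
    then show "x = 0"
      using x bD by (intro span_disjoint_independent[OF bD(3), of M bK]) (auto simp: M_def)
  qed
  have inj\<tau>: "inj_on \<tau> (span M)"
    using \<tau>M span_zero by (auto simp: \<tau>.inj_on_iff_eq_0)
  have ind\<tau>M: "independent (\<tau> ` M)"
    using inj\<tau> independent_mono[OF bD(3), of M]
    by (intro \<tau>.independent_injective_image) (auto simp: M_def)
  define cJ where "cJ = cI \<union> \<tau> ` M"
  have disjJ: "cI \<inter> \<tau> ` M = {}"
  proof (rule ccontr)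
    assume "cI \<inter> \<tau> ` M \<noteq> {}"
    then obtain m where m: "m \<in> M" "\<tau> m \<in> cI" by auto
    then have "m = 0" using \<tau>M span_base by auto
    with m bD(3) dependent_zero show False by (auto simp: M_def)
  qed
  have indJ: "independent cJ"
  proof -
    have z: "v = 0" if "v \<in> span cI" "v \<in> span (\<tau> ` M)" for v
      using that \<tau>M by (auto simp: \<tau>.span_image dest: \<tau>M)
    show ?thesis
    proof
      assume "dependent cJ"
      then obtain t u where t: "finite t" "t \<subseteq> cJ" "(\<Sum>v\<in>t. scale (u v) v) = 0" "\<exists>v\<in>t. u v \<noteq> 0"
        unfolding dependent_explicit by blast
      let ?a = "\<Sum>v\<in>t \<inter> cI. scale (u v) v" and ?b = "\<Sum>v\<in>t - cI. scale (u v) v"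
      have ab: "?a + ?b = 0" using t(3) sum.Int_Diff[OF t(1), of "\<lambda>v. scale (u v) v" cI] by simp
      have a: "?a \<in> span cI" by (intro span_sum span_scale span_base) auto
      have b: "?b \<in> span (\<tau> ` M)"
        by (intro span_sum span_scale span_base) (use t in \<open>auto simp: cJ_def\<close>)
      have "?b = - ?a" using ab by (simp add: eq_neg_iff_add_eq_0 add.commute)
      then have "?b \<in> span cI" using a span_neg by auto
      then have "?b = 0" using z b by blast
      then have "?a = 0" using ab by simp
      have "u v = 0" if "v \<in> t" for v
      proof (cases "v \<in> cI")
        case True
        then show ?thesis using independentD[OF cI(1), of "t \<inter> cI" u v] \<open>?a = 0\<close> t that by auto
      next
        case False
        then show ?thesis using independentD[OF ind\<tau>M, of "t - cI" u v] \<open>?b = 0\<close> t that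
          by (auto simp: cJ_def)
      qed
      with t show False by auto
    qed
  qed
  have split: "\<exists>k\<in>span bK. \<exists>m\<in>span M. x = k + m" if "x \<in> D" for x
  proof -
    have "bD = bK \<union> M" using bD by (auto simp: M_def)
    then show ?thesis using that spD span_Un[of bK M] by auto
  qed
  have cIJ: "cJ \<subseteq> J"
  proof
    fix y assume "y \<in> cJ"
    then show "y \<in> J"
      using cI(3) span_base[of y cI] \<tau>S[OF span_base] by (fastforce simp: cJ_def J_def M_def)
  qed
  \<comment> \<open>Surjectivity of the same isomorphism: every value of the relation differs from
    some \<open>\<tau> m\<close> by an indefinite one.\<close>
  have spJ: "span cJ = J"
  proof (rule span_subspace[OF cIJ _ subJ], rule subsetI)
    fix y assume "y \<in> J"
    then obtain x where xy: "(x, y) \<in> S" by (auto simp: J_def)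
    then obtain k m where km: "k \<in> span bK" "m \<in> span M" "x = k + m"
      using split[of x] by (auto simp: D_def)
    have "(k, 0) \<in> S" using km bK by auto
    moreover have "(m, \<tau> m) \<in> S" using km \<tau>S span_mono[of M bD] by (auto simp: M_def)
    ultimately have "(k + m, \<tau> m) \<in> S" using S(3) by fastforce
    then have "(0, y - \<tau> m) \<in> S" using Sdiff[OF xy, of "k + m"] km by simp
    then have "y - \<tau> m \<in> span cI" using cI by auto
    moreover have "\<tau> m \<in> span (\<tau> ` M)" using km \<tau>.span_image by auto
    ultimately have "y - \<tau> m + \<tau> m \<in> span cJ"
      unfolding cJ_def using span_mono[of cI "cI \<union> \<tau> ` M"] span_mono[of "\<tau> ` M" "cI \<union> \<tau> ` M"]
      by (intro span_add) auto
    then show "y \<in> span cJ" by simp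
  qed
  obtain cE where cE: "cJ \<subseteq> cE" "cE \<subseteq> E" "independent cE" "E \<subseteq> span cE"
    using maximal_independent_subset_extend[OF subset_trans[OF cIJ JE] indJ] by metis
  then have spcE: "span cE = E" using subE span_subspace by blast
  obtain cV where cV: "cE \<subseteq> cV" "independent cV" "UNIV = span cV"
    by (rule maximal_independent_subset_extend[OF subset_UNIV cE(3)]) auto

  \<comment> \<open>The permutation of basis vectors\<close>
  define F where "F = bB - bA"
  note sub = bA(2) bK(2) bD(1) bE(1) bV(1) cI(2) cE(1) cV(1) disjJ
  have bBE: "bB \<subseteq> bE" and cBE: "bB \<subseteq> cE" using bK bD bE cI cE by (auto simp: cJ_def)
  have finE1: "finite (bE - bB)" using finE bE bBE spE by auto
  have finE2: "finite (cE - bB)" using finE cE cBE spcE by auto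
  \<comment> \<open>\<open>F\<close> represents a basis of \<open>B / A\<close>. \<open>F1\<close>
    is the target of the kernel directions and \<open>G1\<close> the source of the indefinite ones.
    They may overlap, being used on opposite sides of the bijection; so each dimension is compared
    with \<open>card F\<close> separately, not their sum.\<close>
  obtain F1 where F1: "F1 \<subseteq> F" "card F1 = card (bK - bB)"
    using bK obtain_subset_with_card_n by (metis F_def)
  obtain G1 where G1: "G1 \<subseteq> F" "card G1 = card (cI - bB)"
    using cI obtain_subset_with_card_n by (metis F_def)
  have finF: "finite F" "finite F1" "finite G1"
    using bB F1 G1 by (auto simp: F_def intro: finite_subset)
  obtain f1 where f1: "bij_betw f1 (bK - bB) F1"
    using F1 finF bK finite_same_card_bij by metis
  obtain f2 where f2: "bij_betw f2 G1 (cI - bB)"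
    using G1 finF cI finite_same_card_bij by metis
  \<comment> \<open>A vector of \<open>F - G1\<close> returning to \<open>B\<close> would enlarge
    the graph over \<open>B\<close>, and one of \<open>bE - bD\<close> staying in \<open>E\<close>
    would violate \<open>S\<close>. Both are therefore sent out of \<open>E\<close>, and the targets
    of \<open>E\<close> still free are reached from outside \<open>E\<close>.\<close>
  obtain f3 where f3: "bij_betw f3 ((F - G1) \<union> (bE - bD) \<union> (bV - bE)) ((F - F1) \<union> (cE - cJ) \<union> (cV - cE))"
    "f3 ` ((F - G1) \<union> (bE - bD)) \<subseteq> cV - cE"
    "(F - F1) \<union> (cE - cJ) \<subseteq> f3 ` (bV - bE)"
  proof -
    have "finite ((F - G1) \<union> (bE - bD))" "finite ((F - F1) \<union> (cE - cJ))"
    proof -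
      have "bE - bD \<subseteq> bE - bB" "cE - cJ \<subseteq> cE - bB" using sub unfolding cJ_def by blast+
      then show "finite ((F - G1) \<union> (bE - bD))" "finite ((F - F1) \<union> (cE - cJ))"
        using finF finite_subset[OF _ finE1] finite_subset[OF _ finE2] by blast+
    qed
    moreover have "infinite (bV - bE)" "countable (bV - bE)" "infinite (cV - cE)" "countable (cV - cE)"
      using infV[of bV bE] infV[of cV cE] bV cV spE spcE by auto
    moreover have "((F - G1) \<union> (bE - bD)) \<inter> (bV - bE) = {}" "((F - F1) \<union> (cE - cJ)) \<inter> (cV - cE) = {}"
      using bBE cBE unfolding F_def by blast+
    ultimately show ?thesis using bij_betw_interchange that by metis
  qed
  have \<tau>M': "bij_betw \<tau> M (\<tau> ` M)"
    using inj_on_subset[OF inj\<tau> span_superset] by (simp add: bij_betw_def)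
  have idA: "bij_betw (\<lambda>x. x) bA bA" by (simp add: bij_betw_def)
  obtain h1 where h1: "bij_betw h1 (bA \<union> (bK - bB)) (bA \<union> F1)" "\<forall>x\<in>bA. h1 x = x" "\<forall>x\<in>bK - bB. h1 x = f1 x"
  proof -
    have "bA \<inter> (bK - bB) = {}" "bA \<inter> F1 = {}" using bA F1 by (auto simp: F_def)
    then show ?thesis using bij_betw_glue[OF idA f1] that by metis
  qed
  obtain h2 where h2: "bij_betw h2 (G1 \<union> M) ((cI - bB) \<union> \<tau> ` M)" "\<forall>x\<in>G1. h2 x = f2 x" "\<forall>x\<in>M. h2 x = \<tau> x"
  proof -
    have "G1 \<inter> M = {}" "(cI - bB) \<inter> \<tau> ` M = {}" using sub G1(1) unfolding F_def M_def by blast+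
    then show ?thesis using bij_betw_glue[OF f2 \<tau>M'] that by metis
  qed
  obtain h3 where h3: "bij_betw h3 ((bA \<union> (bK - bB)) \<union> (G1 \<union> M)) ((bA \<union> F1) \<union> ((cI - bB) \<union> \<tau> ` M))"
    "\<forall>x\<in>bA \<union> (bK - bB). h3 x = h1 x" "\<forall>x\<in>G1 \<union> M. h3 x = h2 x"
  proof -
    have "(bA \<union> (bK - bB)) \<inter> (G1 \<union> M) = {}" "(bA \<union> F1) \<inter> ((cI - bB) \<union> \<tau> ` M) = {}"
      using sub G1(1) F1(1) unfolding F_def M_def by blast+
    then show ?thesis using bij_betw_glue[OF h1(1) h2(1)] that by metis
  qed
  let ?X = "(F - G1) \<union> (bE - bD) \<union> (bV - bE)"
  let ?Y = "(F - F1) \<union> (cE - cJ) \<union> (cV - cE)"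
  have "((bA \<union> (bK - bB)) \<union> (G1 \<union> M)) \<inter> ?X = {}"
    using sub G1(1) F1(1) unfolding F_def M_def cJ_def by blast
  moreover have "((bA \<union> F1) \<union> ((cI - bB) \<union> \<tau> ` M)) \<inter> ?Y = {}"
    using sub G1(1) F1(1) unfolding F_def M_def cJ_def by blast
  ultimately obtain \<pi> where \<pi>: "bij_betw \<pi> (((bA \<union> (bK - bB)) \<union> (G1 \<union> M)) \<union> ?X) (((bA \<union> F1) \<union> ((cI - bB) \<union> \<tau> ` M)) \<union> ?Y)"
    "\<forall>x\<in>(bA \<union> (bK - bB)) \<union> (G1 \<union> M). \<pi> x = h3 x" "\<forall>x\<in>?X. \<pi> x = f3 x"
    using bij_betw_glue[OF h3(1) f3(1)] by metis
  have "((bA \<union> (bK - bB)) \<union> (G1 \<union> M)) \<union> ?X = bV"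
    using sub G1(1) F1(1) unfolding F_def M_def cJ_def by blast
  moreover have "((bA \<union> F1) \<union> ((cI - bB) \<union> \<tau> ` M)) \<union> ?Y = cV"
    using sub G1(1) F1(1) unfolding F_def M_def cJ_def by blast
  ultimately have \<pi>bij: "bij_betw \<pi> bV cV" using \<pi>(1) by simp
  have \<pi>1: "\<pi> b = b" if "b \<in> bA" for b using that \<pi> h3 h1 by auto
  have \<pi>2: "\<pi> b \<in> F" if "b \<in> bK - bB" for b
    using that \<pi>(2) h3(2) h1(3) f1 F1 by (auto simp: bij_betw_def)
  have \<pi>3: "\<pi> b = \<tau> b" if "b \<in> M" for b using that \<pi>(2) h3(3) h2(3) by auto
  have \<pi>4: "\<pi> b \<in> (cI - bB) \<union> (cV - cE)" if "b \<in> F" for b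
  proof (cases "b \<in> G1")
    case True
    then have "\<pi> b = f2 b" using \<pi>(2) h3(3) h2(2) by auto
    then show ?thesis using True f2 by (auto simp: bij_betw_def)
  next
    case False
    then have "\<pi> b = f3 b" using \<pi>(3) that by auto
    then show ?thesis using False f3(2) that by auto
  qed
  have \<pi>5: "\<pi> b \<in> cV - cE" if "b \<in> bE - bD" for b
    using that \<pi>(3) f3(2) by auto
  have \<pi>6: "\<exists>b\<in>F. \<pi> b = c" if "c \<in> cI - bB" for c
  proof -
    have "c \<in> f2 ` G1" using f2 that by (simp add: bij_betw_def)
    then obtain b where b: "b \<in> G1" "f2 b = c" by blast
    then have "\<pi> b = c" using \<pi>(2) h3(3) h2(2) by auto
    then show ?thesis using b G1 by blast
  qed

  \<comment> \<open>The operator and the verification of its properties\<close>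
  obtain g where g: "Vector_Spaces.linear scale scale g" "\<And>b. b \<in> bV \<Longrightarrow> g b = \<pi> b"
    using linear_independent_extend[OF bV(2), of \<pi>] by auto
  interpret g: Vector_Spaces.linear scale scale g by fact
  have gb: "bij_betw g bV cV"
    using \<pi>bij by (rule bij_betw_cong[THEN iffD1, rotated]) (simp add: g)
  have injg: "inj g"
  proof -
    have "inj_on g (span bV)"
      using gb cV by (intro g.inj_on_span_independent_image) (auto simp: bij_betw_def)
    then show ?thesis using bV by simp
  qed
  have "surj g"
    using g.span_image[of bV] gb bV cV by (simp add: bij_betw_def)
  with injg have "bij g" by (simp add: bij_def)
  have gF: "g b \<in> (cI - bB) \<union> (cV - cE)" if "b \<in> F" for b
  proof -
    have "b \<in> bV" using that bBE bV(1) unfolding F_def by blast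
    then show ?thesis using g(2) \<pi>4[OF that] by simp
  qed
  have gA: "g x = x" if "x \<in> A" for x
  proof -
    have "x \<in> span bA" using that bA by simp
    then show ?thesis
    proof (induction rule: span_induct)
      case base
      show ?case by (auto simp: subspace_def g.add g.scale)
    next
      case (step x)
      then have "x \<in> bV" using bA bBE bV by auto
      with step show ?case using g \<pi>1 by simp
    qed
  qed
  \<comment> \<open>No vector of \<open>F\<close> comes back to \<open>bB\<close>: its image is in
    \<open>cI - bB\<close> or outside \<open>cE\<close>. Of the basis of \<open>B\<close>, only
    \<open>bA\<close> stays.\<close>
  have gB: "x \<in> A" if "x \<in> B" "g x \<in> B" for x
  proof -
    have "x \<in> span {b \<in> bB. g b \<in> bB}"
      using that bB gb bBE bV cBE cV
      by (intro span_inter_preimage[OF g(1) cV(2) injg]) (auto simp: bij_betw_def)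
    moreover have "{b \<in> bB. g b \<in> bB} \<subseteq> bA"
      using gF cBE by (auto simp: F_def)
    ultimately show ?thesis using span_mono bA by blast
  qed
  have gK: "g b \<in> B" if "b \<in> bK - bB" for b
  proof -
    have "b \<in> bV" using that sub by blast
    then have "g b \<in> bB" using g(2) \<pi>2[OF that] by (simp add: F_def)
    then show ?thesis using bB(1) span_base by blast
  qed
  have gE: "(x, g x) \<in> S" if "x \<in> E" "g x \<in> E" for x
  proof -
    have "x \<in> span {b \<in> bE. g b \<in> cE}"
      using that spE spcE gb bV cV
      by (intro span_inter_preimage[OF g(1) cV(2) injg]) (auto simp: bij_betw_def)
    then show ?thesis
    proof (induction rule: span_induct)
      case base
      show ?case unfolding mem_Collect_eq subspace_def
        using S S0 by (auto simp: g.add g.scale)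
    next
      case (step b)
      then have b: "b \<in> bE" "g b \<in> cE" "g b = \<pi> b" using g bV by auto
      then have "b \<in> bD" using \<pi>5 by auto
      \<comment> \<open>For \<open>F\<close> and for \<open>bK - bB\<close> the pair
        \<open>(b, g b)\<close> is the sum of \<open>(b, 0)\<close> and \<open>(0, g b)\<close>: in
        the first case \<open>b\<close> is in \<open>B\<close> and \<open>g b\<close> is an
        indefinite value, in the second \<open>b\<close> is in the kernel and \<open>g b\<close> in
        \<open>B\<close>.\<close>
      consider "b \<in> bA" | "b \<in> F" | "b \<in> bK - bB" | "b \<in> M"
        using \<open>b \<in> bD\<close> by (auto simp: F_def M_def)
      then show ?case
      proof cases
        case 1
        then have "b \<in> B" "g b = b" using bA bB span_base gA by auto
        then show ?thesis using S(2) by auto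
      next
        case 2
        then have "g b \<in> cI" using gF[OF 2] b(2) by blast
        then have "(0, g b) \<in> S" using span_base cI(3) by blast
        moreover have "b \<in> B" using 2 bB span_base by (auto simp: F_def)
        then have "(b, 0) \<in> S" using S(2) \<open>0 \<in> B\<close> by auto
        ultimately show ?thesis using S(3) by fastforce
      next
        case 3
        then have "(b, 0) \<in> S" using span_base[of b bK] bK(3) by auto
        moreover have "(0, g b) \<in> S" using gK[OF 3] S(2) \<open>0 \<in> B\<close> by auto
        ultimately show ?thesis using S(3) by fastforce
      next
        case 4
        then have "g b = \<tau> b" using \<pi>3 b by simp
        then show ?thesis using \<tau>S 4 span_base by (auto simp: M_def)
      qed
    qed
  qed
  have gS: "\<exists>v. x - v \<in> B \<and> y - g v \<in> B" if "(x, y) \<in> S" for x y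
  proof -
    have "x \<in> D" using that by (auto simp: D_def)
    then obtain k m where km: "k \<in> span bK" "m \<in> span M" "x = k + m"
      using split[of x] by blast
    have gm: "g m = \<tau> m"
      using km(2)
    proof (induction rule: span_induct)
      case base
      show ?case by (auto simp: subspace_def g.add g.scale \<tau>.add \<tau>.scale)
    next
      case (step b)
      then have "b \<in> bV" using bE bV by (auto simp: M_def)
      with step show ?case using g \<pi>3 by simp
    qed
    have kS: "(k, 0) \<in> S" using km bK by auto
    have mS: "(m, \<tau> m) \<in> S" using km \<tau>S span_mono[of M bD] by (auto simp: M_def)
    have "(k + m, \<tau> m) \<in> S" using S(3)[OF kS mS] by simp
    then have "(0, y - \<tau> m) \<in> S" using Sdiff[OF that, of "k + m"] km by simp
    then have yI: "y - \<tau> m \<in> span cI" using cI by auto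
    have "bK = bB \<union> (bK - bB)" using bK by auto
    then obtain k1 k2 where k: "k = k1 + k2" "k1 \<in> B" "k2 \<in> span (bK - bB)"
      using km(1) span_Un[of bB "bK - bB"] bB by auto
    have "cI = bB \<union> (cI - bB)" using cI by auto
    then obtain i1 i2 where i: "y - \<tau> m = i1 + i2" "i1 \<in> B" "i2 \<in> span (cI - bB)"
      using yI span_Un[of bB "cI - bB"] bB by auto
    have gk2: "g k2 \<in> B"
    proof -
      have "g k2 \<in> span (g ` (bK - bB))" using k g.span_image by blast
      then show ?thesis
        using span_minimal[of "g ` (bK - bB)" B] gK B0 by blast
    qed
    have "cI - bB \<subseteq> g ` F"
    proof
      fix c assume "c \<in> cI - bB"
      then obtain b where "b \<in> F" "\<pi> b = c" using \<pi>6 by blast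
      moreover have "b \<in> bV" using \<open>b \<in> F\<close> bBE bV by (auto simp: F_def)
      ultimately show "c \<in> g ` F" using g(2) by (metis imageI)
    qed
    then have "i2 \<in> g ` span F" using i span_mono g.span_image by blast
    then obtain b where b: "i2 = g b" "b \<in> span F" by auto
    have bBm: "b \<in> B" using b span_mono[of F bB] bB by (auto simp: F_def)
    \<comment> \<open>In the witness \<open>m + k2 + b\<close>, the operator follows the selection
      \<open>\<tau>\<close> on \<open>m\<close>; \<open>k2\<close> is the kernel part of
      \<open>x\<close> modulo \<open>B\<close> and has its image in \<open>B\<close>;
      \<open>b\<close> lies in \<open>B\<close> itself but its image is the indefinite part
      \<open>i2\<close> of \<open>y\<close>.\<close>
    show ?thesis
    proof (intro exI conjI)
      have "x - (m + k2 + b) = k1 - b" using km k by simp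
      then show "x - (m + k2 + b) \<in> B" using subspace_diff[OF B0 k(2) bBm] by (simp only:)
      have "y - g (m + k2 + b) = (y - \<tau> m) - g k2 - g b" by (simp add: g.add gm)
      also have "\<dots> = i1 - g k2" by (simp add: i b)
      finally show "y - g (m + k2 + b) \<in> B" using subspace_diff[OF B0 i(2) gk2] by simp
    qed
  qed
  show ?thesis
    using g(1) \<open>bij g\<close> gA gB gE gS by blast
qed

end

section \<open>Cosets of the standard subgroups\<close>

text \<open>Tychonoff's theorem for finite discrete coordinate spaces, with the coordinates above
  \<open>- m\<close> restricted to \<open>{0}\<close>. \<open>Abs_vp\<close> is continuous on the
  product because, inside \<open>W m\<close>, a coset of \<open>W n\<close> constrains only the
  finitely many coordinates in \<open>{- n<..- m}\<close>.\<close>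

lemma compact_W: "compact (W m :: 'k::{ab_group_add,finite} vp set)"
proof -
  define X where "X i = (if i \<le> - m then discrete_topology UNIV else discrete_topology {0 :: 'k})" for i
  have X: "topspace (X i) = (if i \<le> - m then UNIV else {0})" for i
    by (simp add: X_def)
  let ?X = "product_topology X UNIV"
  have "compact_space (X i)" for i
    by (simp add: X_def compact_space_discrete_topology)
  then have cpt: "compactin ?X (topspace ?X)"
    using compact_space_product_topology[of X UNIV] by (simp add: compact_space_def)
  have tops: "f \<in> topspace ?X \<longleftrightarrow> (\<forall>i > - m. f i = 0)" for f
    by (auto simp: X PiE_iff split: if_splits)
  then have cA: "coord (Abs_vp f) = f" if "f \<in> topspace ?X" for f
    using that by (subst Abs_vp_inverse) auto
  have "continuous_map ?X euclidean Abs_vp"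
    unfolding continuous_map_def
  proof (intro conjI allI impI)
    fix U :: "'k vp set" assume "openin euclidean U"
    then have U: "open U" by simp
    show "openin ?X {f \<in> topspace ?X. Abs_vp f \<in> U}"
      unfolding openin_product_topology_alt
    proof
      fix f assume f: "f \<in> {f \<in> topspace ?X. Abs_vp f \<in> U}"
      then obtain n where n: "\<forall>w\<in>W n. Abs_vp f + w \<in> U"
        using U by (auto simp: open_vp_def)
      define V where "V i = (if - n < i \<and> i \<le> - m then {f i} else topspace (X i))" for i
      have "{i \<in> UNIV. V i \<noteq> topspace (X i)} \<subseteq> {- n<..- m}"
        by (auto simp: V_def)
      then have "finite {i \<in> UNIV. V i \<noteq> topspace (X i)}"
        using finite_subset by blast
      moreover have "\<forall>i\<in>UNIV. openin (X i) (V i)"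
        by (auto simp: V_def X_def)
      moreover have fV: "f \<in> Pi\<^sub>E UNIV V"
        using f by (auto simp: V_def PiE_iff)
      moreover have "Pi\<^sub>E UNIV V \<subseteq> {f \<in> topspace ?X. Abs_vp f \<in> U}"
      proof
        fix h assume h: "h \<in> Pi\<^sub>E UNIV V"
        have hX: "h \<in> topspace ?X"
        proof -
          have "V i \<subseteq> topspace (X i)" for i
            using f by (auto simp: V_def PiE_iff)
          then show ?thesis
            using h unfolding topspace_product_topology PiE_iff by blast
        qed
        have eq: "h i = f i" if "i > - n" for i
        proof (cases "i \<le> - m")
          case True
          then have "V i = {f i}" using that by (simp add: V_def)
          then show ?thesis using h by (auto simp: PiE_iff)
        next
          case False
          then show ?thesis using hX f tops by auto
        qed
        have "Abs_vp h - Abs_vp f \<in> W n"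
          using eq f hX by (auto simp: W_def minus_vp.rep_eq cA)
        then have "Abs_vp f + (Abs_vp h - Abs_vp f) \<in> U" using n by blast
        then show "h \<in> {f \<in> topspace ?X. Abs_vp f \<in> U}" using hX by simp
      qed
      ultimately show "\<exists>V. finite {i \<in> UNIV. V i \<noteq> topspace (X i)} \<and>
          (\<forall>i\<in>UNIV. openin (X i) (V i)) \<and> f \<in> Pi\<^sub>E UNIV V \<and>
          Pi\<^sub>E UNIV V \<subseteq> {f \<in> topspace ?X. Abs_vp f \<in> U}"
        by blast
    qed
  qed simp
  then have "compactin euclidean (Abs_vp ` topspace ?X)"
    using cpt image_compactin by blast
  moreover have "Abs_vp ` topspace ?X = W m"
  proof
    show "Abs_vp ` topspace ?X \<subseteq> W m"
    proof
      fix v :: "'k vp" assume "v \<in> Abs_vp ` topspace ?X"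
      then obtain f where f: "f \<in> topspace ?X" "v = Abs_vp f" by blast
      then have "coord v = f" using cA by simp
      with f tops show "v \<in> W m" by (simp add: W_def)
    qed
    show "W m \<subseteq> Abs_vp ` topspace ?X"
    proof
      fix v :: "'k vp" assume "v \<in> W m"
      then have "coord v \<in> topspace ?X" unfolding tops by (simp add: W_def)
      then show "v \<in> Abs_vp ` topspace ?X" by (metis coord_inverse imageI)
    qed
  qed
  ultimately show ?thesis by simp
qed

lemma in_some_W: "\<exists>n :: nat. v \<in> W (- int n)"
proof -
  obtain N where "\<forall>j>N. coord v j = 0" using coord[of v] by auto
  then have "v \<in> W (- int (nat N))" by (auto simp: W_def)
  then show ?thesis ..
qed

lemma coset_W_eq: "(+) v ` W m = {w :: 'k::ab_group_add vp. w - v \<in> W m}"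
  by (force simp: image_iff algebra_simps)

lemma closed_coset_W: "closed {w :: 'k::ab_group_add vp. w - v \<in> W m}"
proof -
  have "open (- {w. w - v \<in> W m})"
    unfolding open_vp_def
  proof (intro ballI exI)
    fix u w :: "'k vp" assume u: "u \<in> - {w. w - v \<in> W m}" and w: "w \<in> W m"
    have "u + w - v - w = u - v" by simp
    then show "u + w \<in> - {w. w - v \<in> W m}" using u w W_diff by fastforce
  qed
  then show ?thesis by (simp add: closed_def)
qed

lemma closed_W: "closed (W m :: 'k::ab_group_add vp set)"
  using closed_coset_W[of 0 m] by simp

lemma borel_open_coset_W [measurable, simp]:
  "{w :: 'k::ab_group_add vp. w - v \<in> W m} \<in> sets borel" "(W m :: 'k vp set) \<in> sets borel"
  "(+) v ` W m \<in> sets borel"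
  by (simp_all add: coset_W_eq open_coset_W open_W)

lemma open_UN_cosets_W:
  fixes U :: "'k::ab_group_add vp set"
  assumes "\<And>v w. v \<in> U \<Longrightarrow> w \<in> W m \<Longrightarrow> v + w \<in> U"
  shows "open U"
  using assms unfolding open_vp_def by blast

lemma borel_UN_cosets_W:
  fixes U :: "'k::ab_group_add vp set"
  assumes "\<And>v w. v \<in> U \<Longrightarrow> w \<in> W m \<Longrightarrow> v + w \<in> U"
  shows "U \<in> sets borel"
  using open_UN_cosets_W[OF assms] by simp

lemma disjoint_cosets_W:
  fixes u v :: "'k::ab_group_add vp"
  shows "{w. w - u \<in> W m} = {w. w - v \<in> W m} \<or> {w. w - u \<in> W m} \<inter> {w. w - v \<in> W m} = {}"
proof -
  have "{w. w - u \<in> W m} = {w. w - v \<in> W m}" if x: "x - u \<in> W m" "x - v \<in> W m" for x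
  proof -
    have uv: "u - v \<in> W m" using W_diff[OF x(2) x(1)] by simp
    have "w - u \<in> W m \<longleftrightarrow> w - v \<in> W m" for w
      using W_add[OF _ uv, of "w - u"] W_diff[OF _ uv, of "w - v"] by auto
    then show ?thesis by simp
  qed
  then show ?thesis by blast
qed

lemma countable_cosets_W: "countable (range (\<lambda>v :: 'k::{ab_group_add,finite} vp. {w. w - v \<in> W m}))"
proof (rule countable_disjoint_open_subsets)
  show "disjoint (range (\<lambda>v :: 'k vp. {w. w - v \<in> W m}))"
    using disjoint_cosets_W by (auto simp: disjoint_def)
qed (use open_coset_W in auto)

definition Q :: "int \<Rightarrow> ('k::zero vp \<times> 'k vp) set" where
  "Q n = W n \<times> W n"

lemma open_Q: "open (Q n :: ('k::ab_group_add vp \<times> 'k vp) set)"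
  by (simp add: Q_def open_W open_Times)

lemma closed_Q: "closed (Q n :: ('k::ab_group_add vp \<times> 'k vp) set)"
  by (simp add: Q_def closed_W closed_Times)

lemma compact_Q: "compact (Q n :: ('k::{ab_group_add,finite} vp \<times> 'k vp) set)"
  by (simp add: Q_def compact_W compact_Times)

lemma coset_Q: "{z. z - q \<in> Q n} = {w. w - fst q \<in> W n} \<times> {w. w - snd q \<in> W n}"
  by (auto simp: Q_def mem_Times_iff)

lemma coset_Q_eq: "(+) q ` Q n = {z :: 'k::ab_group_add vp \<times> 'k vp. z - q \<in> Q n}"
  by (force simp: image_iff algebra_simps)

lemma open_coset_Q: "open {z :: 'k::ab_group_add vp \<times> 'k vp. z - q \<in> Q n}"
  by (simp add: coset_Q open_coset_W open_Times)

lemma borel_Q [measurable, simp]: "Q n \<in> sets (borel :: ('k::{ab_group_add,finite} vp \<times> 'k vp) measure)"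
   "{z :: 'k vp \<times> 'k vp. z - q \<in> Q n} \<in> sets borel"
  by (auto intro!: borel_open open_Q open_coset_Q)

lemma zero_in_Q [simp]: "0 \<in> Q n"
  by (simp add: Q_def zero_prod_def)

lemma Q_add: "v \<in> Q m \<Longrightarrow> w \<in> Q m \<Longrightarrow> v + w \<in> Q m"
  and Q_diff: "v \<in> Q m \<Longrightarrow> w \<in> Q m \<Longrightarrow> v - w \<in> Q m"
  and Q_uminus: "v \<in> Q m \<Longrightarrow> - v \<in> Q m"
  by (auto simp: Q_def mem_Times_iff W_add W_diff W_uminus)

lemma Q_antimono: "n \<le> m \<Longrightarrow> Q m \<subseteq> Q n"
  unfolding Q_def by (intro Sigma_mono W_antimono)

lemma in_some_Q: "\<exists>n :: nat. z \<in> Q (- int n)"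
proof -
  obtain a b :: nat where ab: "fst z \<in> W (- int a)" "snd z \<in> W (- int b)"
    using in_some_W[of "fst z"] in_some_W[of "snd z"] by blast
  have "W (- int a) \<subseteq> W (- int (max a b))" "W (- int b) \<subseteq> W (- int (max a b))"
    by (rule W_antimono; simp)+
  then have "z \<in> Q (- int (max a b))"
    using ab by (auto simp: Q_def mem_Times_iff simp del: of_nat_max)
  then show ?thesis ..
qed

lemma Q_nhds:
  assumes "open U" "z \<in> U"
  shows "\<exists>n. \<forall>w :: 'k::ab_group_add vp \<times> 'k vp. w - z \<in> Q n \<longrightarrow> w \<in> U"
proof -
  obtain A B where AB: "open A" "open B" "z \<in> A \<times> B" "A \<times> B \<subseteq> U"
    by (rule open_prod_elim[OF assms])
  then have "fst z \<in> A" "snd z \<in> B" by auto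
  with AB obtain a where a: "\<forall>w\<in>W a. fst z + w \<in> A"
    unfolding open_vp_def by blast
  obtain b where b: "\<forall>w\<in>W b. snd z + w \<in> B"
    using AB(2) \<open>snd z \<in> B\<close> unfolding open_vp_def by blast
  have "w \<in> U" if "w - z \<in> Q (max a b)" for w
  proof -
    have "fst w - fst z \<in> W a" "snd w - snd z \<in> W b"
      using that subsetD[OF W_antimono[of a "max a b"]] subsetD[OF W_antimono[of b "max a b"]]
      by (auto simp: Q_def mem_Times_iff)
    then have "fst z + (fst w - fst z) \<in> A" "snd z + (snd w - snd z) \<in> B"
      using a b by blast+
    then have "w \<in> A \<times> B" by (simp add: mem_Times_iff)
    then show ?thesis using AB(4) by blast
  qed
  then show ?thesis by blast
qed

lemma countable_cover_cosets_Q: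
  "\<exists>T. countable T \<and> (\<forall>z :: 'k::{ab_group_add,finite} vp \<times> 'k vp. \<exists>q\<in>T. z - q \<in> Q n)"
proof -
  let ?C = "\<lambda>q :: 'k vp \<times> 'k vp. {z. z - q \<in> Q n}"
  obtain F where F: "F \<subseteq> range ?C" "countable F" "\<Union>F = \<Union>(range ?C)"
    by (rule Lindelof[of "range ?C"]) (use open_coset_Q in auto)
  obtain T where T: "countable T" "F = ?C ` T"
    using countable_subset_image[of F ?C UNIV] F(1,2) by blast
  have "\<exists>q\<in>T. z - q \<in> Q n" for z
  proof -
    have "z \<in> ?C z" by simp
    then have "z \<in> \<Union>F" unfolding F(3) by blast
    then show ?thesis unfolding T(2) by blast
  qed
  with T(1) show ?thesis by blast
qed

text \<open>Cosets of the subgroups \<open>W n\<close> with \<open>n \<ge> m\<close> form an intersection-stable base of the topology.\<close>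

lemma measure_eqI_cosets:
  fixes \<mu> \<nu> :: "'k::{ab_group_add,finite} vp measure"
  assumes sets: "sets \<mu> = sets borel" "sets \<nu> = sets borel"
    and eq: "\<And>v n. n \<ge> m \<Longrightarrow> emeasure \<mu> {w. w - v \<in> W n} = emeasure \<nu> {w. w - v \<in> W n}"
    and fin: "\<And>v. emeasure \<mu> {w. w - v \<in> W m} \<noteq> \<infinity>"
  shows "\<mu> = \<nu>"
proof -
  define E where "E = insert {} {{w :: 'k vp. w - v \<in> W n} | v n. n \<ge> m}"
  have Es: "E \<subseteq> sets borel" by (auto simp: E_def)
  have borel: "sets borel = sigma_sets UNIV E"
  proof -
    have "borel = sigma UNIV E"
    proof (rule borel_eq_countable_basis)
      have "E = insert {} (\<Union>n\<in>{m..}. range (\<lambda>v :: 'k vp. {w. w - v \<in> W n}))"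
        unfolding E_def by auto
      then show "countable E"
        using countable_cosets_W by auto
      show "topological_basis E"
      proof (rule topological_basisI)
        fix B' assume "B' \<in> E" then show "open B'" using open_coset_W by (auto simp: E_def)
      next
        fix U and x :: "'k vp" assume U: "open U" "x \<in> U"
        then obtain n where n: "\<forall>w\<in>W n. x + w \<in> U" by (auto simp: open_vp_def)
        have "{w. w - x \<in> W (max m n)} \<subseteq> U"
        proof
          fix w assume "w \<in> {w. w - x \<in> W (max m n)}"
          then have "w - x \<in> W n" using W_antimono[of n "max m n"] by auto
          then have "x + (w - x) \<in> U" using n by blast
          then show "w \<in> U" by simp
        qed
        moreover have "{w. w - x \<in> W (max m n)} \<in> E" unfolding E_def using max.cobounded1 by blast
        ultimately show "\<exists>B'\<in>E. x \<in> B' \<and> B' \<subseteq> U"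
          by (intro bexI[of _ "{w. w - x \<in> W (max m n)}"]) auto
      qed
    qed
    then have "sets borel = sets (sigma UNIV E)" by (rule arg_cong)
    then show ?thesis by (simp add: sets_measure_of)
  qed
  \<comment> \<open>Cosets behave like balls of an ultrametric: two of them are nested or disjoint.
    Together with the empty set they are therefore stable under intersection.\<close>
  have nested: "{w. w - u \<in> W a} \<inter> {w. w - v \<in> W b} \<in> E" if "a \<ge> b" "a \<ge> m" for u v :: "'k vp" and a b
  proof (cases "{w. w - u \<in> W b} \<inter> {w. w - v \<in> W b} = {}")
    case True
    then have "{w. w - u \<in> W a} \<inter> {w. w - v \<in> W b} = {}"
      using W_antimono[OF that(1)] by blast
    then show ?thesis by (simp add: E_def)
  next
    case False
    then have "{w. w - u \<in> W b} = {w. w - v \<in> W b}" using disjoint_cosets_W by blast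
    then have "{w. w - u \<in> W a} \<inter> {w. w - v \<in> W b} = {w. w - u \<in> W a}"
      using W_antimono[OF that(1)] by blast
    then show ?thesis using that(2) by (auto simp: E_def)
  qed
  show ?thesis
  proof (rule measure_eqI_generator_eq_countable[of E UNIV])
    show "Int_stable E"
    proof (rule Int_stableI)
      fix X Y assume XY: "X \<in> E" "Y \<in> E"
      show "X \<inter> Y \<in> E"
      proof (cases "X = {} \<or> Y = {}")
        case True
        then show ?thesis by (auto simp: E_def)
      next
        case False
        with XY obtain u a v b where X: "X = {w. w - u \<in> W a}" "a \<ge> m" and Y: "Y = {w. w - v \<in> W b}" "b \<ge> m"
          unfolding E_def by blast
        show ?thesis
        proof (cases "a \<ge> b")
          case True then show ?thesis using nested X Y by simp
        next
          case False then show ?thesis using nested[of a b v u] X Y by (simp add: Int_commute)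
        qed
      qed
    qed
    show "emeasure \<mu> X = emeasure \<nu> X" if "X \<in> E" for X
      using that eq by (auto simp: E_def)
    let ?A = "range (\<lambda>v :: 'k vp. {w. w - v \<in> W m})"
    show "?A \<subseteq> E" by (auto simp: E_def)
    show "\<Union>?A = UNIV" by auto
    show "countable ?A" by (rule countable_cosets_W)
    show "emeasure \<mu> a \<noteq> \<infinity>" if "a \<in> ?A" for a using that fin by auto
  qed (use sets borel in auto)
qed

section \<open>Additive subgroups as linear subspaces\<close>

lemma of_nat_surj_prime:
  assumes "prime (CARD('k::{field,finite}))"
  shows "\<exists>n. c = (of_nat n :: 'k)"
proof -
  let ?p = "CARD('k)"
  have p0: "of_nat ?p = (0 :: 'k)"
  proof -
    \<comment> \<open>The shift by one permutes the field, so both sums agree and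
      \<open>CARD('k)\<close> copies of one add up to zero.\<close>
    have "(\<Sum>x\<in>UNIV. x + 1 :: 'k) = (\<Sum>x\<in>UNIV. x)"
      by (rule sum.reindex_bij_witness[of _ "\<lambda>x. x - 1" "\<lambda>x. x + 1"]) auto
    then show ?thesis by (simp add: sum.distrib)
  qed
  have "inj_on (of_nat :: nat \<Rightarrow> 'k) {0..<?p}"
  proof (rule linorder_inj_onI)
    fix x y assume xy: "x < y" "x \<in> {0..<?p}" "y \<in> {0..<?p}"
    let ?d = "y - x"
    show "of_nat x \<noteq> (of_nat y :: 'k)"
    proof
      assume "of_nat x = (of_nat y :: 'k)"
      then have d0: "of_nat ?d = (0 :: 'k)" using xy by (simp add: of_nat_diff)
      have d: "0 < ?d" "?d < ?p" using xy by auto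
      then have "\<not> ?p dvd ?d" by (rule nat_dvd_not_less)
      then have "gcd ?d ?p = 1"
        using prime_imp_coprime[OF assms] by (metis coprime_imp_gcd_eq_1 gcd.commute)
      then obtain a b where ab: "?d * a = ?p * b + 1"
        using bezout_nat[of ?d ?p] d by auto
      have "of_nat (?d * a) = (of_nat (?p * b + 1) :: 'k)" by (simp only: ab)
      then show False by (simp only: of_nat_mult of_nat_add d0 p0) simp
    qed
  qed auto
  then have "card ((of_nat :: nat \<Rightarrow> 'k) ` {0..<?p}) = card (UNIV :: 'k set)"
    by (simp add: card_image)
  then have "(of_nat :: nat \<Rightarrow> 'k) ` {0..<?p} = UNIV"
    by (intro card_subset_eq) auto
  then show ?thesis by (metis UNIV_I imageE)
qed

text \<open>The scalars are repeated sums of one, so closure under addition already gives closure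
  under scaling. A closed subgroup \<open>R\<close> is therefore a linear relation.\<close>

lemma add_subgroup_scale:
  assumes "prime (CARD('k::{field,finite}))" and R: "add_subgroup (R :: ('k vp \<times> 'k vp) set)"
    and xy: "(x, y) \<in> R"
  shows "(vp_scale c x, vp_scale c y) \<in> R"
proof -
  interpret vector_space "vp_scale :: 'k \<Rightarrow> 'k vp \<Rightarrow> 'k vp" by (rule vector_space_vp)
  obtain n where n: "c = of_nat n" using of_nat_surj_prime[OF assms(1)] by blast
  have "(vp_scale (of_nat n) x, vp_scale (of_nat n) y) \<in> R"
  proof (induction n)
    case 0
    then show ?case using R by (simp add: add_subgroup_def zero_prod_def)
  next
    case (Suc n)
    then have "(x, y) + (vp_scale (of_nat n) x, vp_scale (of_nat n) y) \<in> R"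
      using R xy unfolding add_subgroup_def by blast
    then show ?case by (simp add: scale_left_distrib)
  qed
  with n show ?thesis by simp
qed

lemma subspace_W: "module.subspace (vp_scale :: 'k::field \<Rightarrow> _) (W m)"
proof -
  interpret vector_space "vp_scale :: 'k \<Rightarrow> 'k vp \<Rightarrow> 'k vp" by (rule vector_space_vp)
  show ?thesis by (auto simp: subspace_def W_add) (auto simp: W_def vp_scale.rep_eq)
qed

section \<open>Haar measure and indices\<close>

global_interpretation vp: vector_space vp_scale
  by (rule vector_space_vp)

text \<open>Adjoining one basis vector \<open>x\<close> multiplies the number of cosets by the size
  of the field: the new representatives are the \<open>c x + t\<close>, and congruent ones have the
  same \<open>c\<close> because \<open>x\<close> is outside the old span.\<close>

lemma coset_representatives:
  fixes b F :: "'k::{field,finite} vp set"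
  assumes "finite F" "vp.independent (b \<union> F)" "b \<inter> F = {}"
  shows "\<exists>T. finite T \<and> card T = CARD('k) ^ card F \<and> (\<forall>s\<in>T. \<forall>t\<in>T. s - t \<in> vp.span b \<longrightarrow> s = t) \<and>
    vp.span (b \<union> F) = (\<Union>t\<in>T. {v. v - t \<in> vp.span b})"
  using assms
proof (induction F)
  case empty
  show ?case by (rule exI[of _ "{0}"]) auto
next
  case (insert x F)
  have ins: "b \<union> insert x F = insert x (b \<union> F)" "x \<notin> b \<union> F" using insert by auto
  then have ind: "vp.independent (b \<union> F)" and xn: "x \<notin> vp.span (b \<union> F)"
    using insert.prems(1) vp.independent_insert[of x "b \<union> F"] by metis+
  obtain T where T: "finite T" "card T = CARD('k) ^ card F"
    "\<And>s t. s \<in> T \<Longrightarrow> t \<in> T \<Longrightarrow> s - t \<in> vp.span b \<Longrightarrow> s = t"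
    "vp.span (b \<union> F) = (\<Union>t\<in>T. {v. v - t \<in> vp.span b})"
    using insert.IH[OF ind] insert.prems(2) by auto
  have memT: "s \<in> vp.span (b \<union> F)" if "s \<in> T" for s
    unfolding T(4) by (rule UN_I[OF that]) (simp add: vp.span_zero)
  define f where "f = (\<lambda>(c :: 'k, t). vp_scale c x + t)"
  have key: "c = c' \<and> t = t'" if "t \<in> T" "t' \<in> T" "f (c, t) - f (c', t') \<in> vp.span b" for c c' t t'
  proof -
    have tt: "t \<in> vp.span (b \<union> F)" "t' \<in> vp.span (b \<union> F)"
      using memT that by auto
    have "f (c, t) - f (c', t') \<in> vp.span (b \<union> F)"
      using that(3) vp.span_mono[of b "b \<union> F"] by auto
    then have "f (c, t) - f (c', t') - t + t' \<in> vp.span (b \<union> F)"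
      using vp.span_add[OF vp.span_diff[OF _ tt(1)] tt(2)] by blast
    then have "vp_scale (c - c') x \<in> vp.span (b \<union> F)"
      by (simp add: f_def vp.scale_left_diff_distrib algebra_simps)
    then have "vp_scale (inverse (c - c')) (vp_scale (c - c') x) \<in> vp.span (b \<union> F)"
      by (rule vp.span_scale)
    with xn have "c = c'" by (cases "c = c'") auto
    with that T(3) show ?thesis by (auto simp: f_def)
  qed
  have inj: "inj_on f (UNIV \<times> T)"
  proof (rule inj_onI)
    fix z z' assume z: "z \<in> UNIV \<times> T" "z' \<in> UNIV \<times> T" "f z = f z'"
    then have "f (fst z, snd z) - f (fst z', snd z') \<in> vp.span b" by (simp add: vp.span_zero)
    then show "z = z'" using key[of "snd z" "snd z'" "fst z" "fst z'"] z by (simp add: mem_Times_iff prod_eq_iff)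
  qed
  show ?case
  proof (intro exI conjI)
    show "finite (f ` (UNIV \<times> T))" using T by auto
    show "card (f ` (UNIV \<times> T)) = CARD('k) ^ card (insert x F)"
      using card_image[OF inj] T insert by (simp add: card_cartesian_product)
    show "\<forall>s\<in>f ` (UNIV \<times> T). \<forall>t\<in>f ` (UNIV \<times> T). s - t \<in> vp.span b \<longrightarrow> s = t"
    proof (intro ballI impI)
      fix s s' assume s: "s \<in> f ` (UNIV \<times> T)" "s' \<in> f ` (UNIV \<times> T)" "s - s' \<in> vp.span b"
      then obtain c t c' t' where "t \<in> T" "t' \<in> T" "s = f (c, t)" "s' = f (c', t')" by blast
      with key s(3) show "s = s'" by blast
    qed
    show "vp.span (b \<union> insert x F) = (\<Union>t\<in>f ` (UNIV \<times> T). {v. v - t \<in> vp.span b})" (is "_ = ?R")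
    proof -
      have "v \<in> ?R \<longleftrightarrow> (\<exists>c. v - vp_scale c x \<in> vp.span (b \<union> F))" for v
        unfolding T(4) by (simp add: f_def diff_diff_eq)
      then show ?thesis
        unfolding ins(1) by (intro set_eqI) (simp only: vp.span_breakdown_eq)
    qed
  qed
qed

text \<open>The Archimedean property, for the situation of infinitely many disjoint translates of
  equal mass inside a set of finite mass.\<close>

lemma ennreal_eq_0I_multiples:
  fixes a b :: ennreal
  assumes "\<And>n. of_nat n * a \<le> b" "b < \<infinity>"
  shows "a = 0"
proof -
  have "a < \<infinity>" using assms(1)[of 1] assms(2) by (simp add: less_top)
  then obtain r where r: "a = ennreal r" "r \<ge> 0" by (cases a) auto
  obtain s where s: "b = ennreal s" "s \<ge> 0" using assms(2) by (cases b) auto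
  have le: "real n * r \<le> s" for n
    using assms(1)[of n] r s by (simp add: ennreal_of_nat_eq_real_of_nat flip: ennreal_mult)
  have "\<not> r > 0"
  proof
    assume "r > 0"
    then obtain n where "s < real n * r" using reals_Archimedean3 by blast
    with le[of n] show False by simp
  qed
  with r show ?thesis by simp
qed

text \<open>An index is read off from a basis, since the cosets all have the same mass. Invariance
  is required only along \<open>span bL\<close> because marginals of a measure on a relation are not
  invariant under arbitrary translations. The subgroup \<open>W m\<close> inside makes the spans
  open, hence measurable.\<close>

lemma emeasure_span_cosets:
  fixes \<mu> :: "'k::{field,finite} vp measure"
  assumes sets: "sets \<mu> = sets borel"
    and W: "W m \<subseteq> vp.span bH"
    and bL: "bH \<subseteq> bL" "vp.independent bL"
    and inv: "\<And>x. x \<in> vp.span bL \<Longrightarrow> emeasure \<mu> {v. v - x \<in> vp.span bH} = emeasure \<mu> (vp.span bH)"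
    and fin: "emeasure \<mu> (vp.span bL) < \<infinity>" and pos: "emeasure \<mu> (vp.span bH) \<noteq> 0"
  shows "finite (bL - bH)"
    "emeasure \<mu> (vp.span bL) = of_nat (CARD('k) ^ card (bL - bH)) * emeasure \<mu> (vp.span bH)"
proof -
  have meas: "{v. v - x \<in> vp.span bH} \<in> sets \<mu>" for x
    unfolding sets
  proof (rule borel_UN_cosets_W[of _ m])
    fix v w :: "'k vp" assume "v \<in> {v. v - x \<in> vp.span bH}" "w \<in> W m"
    then have "(v - x) + w \<in> vp.span bH" using W vp.span_add by blast
    then show "v + w \<in> {v. v - x \<in> vp.span bH}" by (simp add: algebra_simps)
  qed
  have measL: "vp.span bL \<in> sets \<mu>"
    unfolding sets using W vp.span_mono[OF bL(1)] vp.span_add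
    by (intro borel_UN_cosets_W[of _ m]) blast
  have eq: "emeasure \<mu> (vp.span (bH \<union> F)) = of_nat (CARD('k) ^ card F) * emeasure \<mu> (vp.span bH)"
    if F: "finite F" "F \<subseteq> bL - bH" for F
  proof -
    have "bH \<union> F \<subseteq> bL" using F bL by auto
    then have "vp.independent (bH \<union> F)" by (rule vp.independent_mono[OF bL(2)])
    then obtain T where T: "finite T" "card T = CARD('k) ^ card F"
      "\<And>s t. s \<in> T \<Longrightarrow> t \<in> T \<Longrightarrow> s - t \<in> vp.span bH \<Longrightarrow> s = t"
      "vp.span (bH \<union> F) = (\<Union>t\<in>T. {v. v - t \<in> vp.span bH})"
    proof -
      have "bH \<inter> F = {}" using F by blast
      with coset_representatives[OF F(1) \<open>vp.independent (bH \<union> F)\<close>] that show ?thesis by metis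
    qed
    have "disjoint_family_on (\<lambda>t. {v. v - t \<in> vp.span bH}) T"
      unfolding disjoint_family_on_def
    proof (intro ballI impI)
      fix s t assume st: "s \<in> T" "t \<in> T" "s \<noteq> t"
      show "{v. v - s \<in> vp.span bH} \<inter> {v. v - t \<in> vp.span bH} = {}"
      proof (rule ccontr)
        assume "{v. v - s \<in> vp.span bH} \<inter> {v. v - t \<in> vp.span bH} \<noteq> {}"
        then obtain v where "v - s \<in> vp.span bH" "v - t \<in> vp.span bH" by blast
        then have "(v - t) - (v - s) \<in> vp.span bH" using vp.span_diff by blast
        then have "s - t \<in> vp.span bH" by simp
        with T st show False by blast
      qed
    qed
    then have "emeasure \<mu> (vp.span (bH \<union> F)) = (\<Sum>t\<in>T. emeasure \<mu> {v. v - t \<in> vp.span bH})"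
      unfolding T(4) using meas T(1) by (intro sum_emeasure[symmetric]) auto
    also have "\<dots> = (\<Sum>t\<in>T. emeasure \<mu> (vp.span bH))"
    proof (rule sum.cong[OF refl])
      fix t assume "t \<in> T"
      then have "t \<in> vp.span (bH \<union> F)"
        unfolding T(4) by (rule UN_I) (simp add: vp.span_zero)
      then have "t \<in> vp.span bL" using vp.span_mono[of "bH \<union> F" bL] F bL by auto
      then show "emeasure \<mu> {v. v - t \<in> vp.span bH} = emeasure \<mu> (vp.span bH)" by (rule inv)
    qed
    finally show ?thesis using T(2) by simp
  qed
  show f: "finite (bL - bH)"
  proof (rule ccontr)
    assume inf: "infinite (bL - bH)"
    have "of_nat n * emeasure \<mu> (vp.span bH) \<le> emeasure \<mu> (vp.span bL)" for n
    proof -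
      obtain F where F: "F \<subseteq> bL - bH" "finite F" "card F = n"
        using infinite_arbitrarily_large[OF inf] by blast
      have "n \<le> CARD('k) ^ n"
      proof -
        have "card {0, 1 :: 'k} \<le> CARD('k)" by (intro card_mono) auto
        then have "2 ^ n \<le> CARD('k) ^ n" by (intro power_mono) auto
        with less_exp[of n] show ?thesis by linarith
      qed
      then have "of_nat n * emeasure \<mu> (vp.span bH) \<le> of_nat (CARD('k) ^ n) * emeasure \<mu> (vp.span bH)"
        by (intro mult_right_mono) (simp_all only: of_nat_le_iff zero_le)
      also have "\<dots> = emeasure \<mu> (vp.span (bH \<union> F))" using eq[OF F(2,1)] F by simp
      also have "\<dots> \<le> emeasure \<mu> (vp.span bL)"
        using F bL measL by (intro emeasure_mono vp.span_mono) auto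
      finally show ?thesis .
    qed
    then show False using ennreal_eq_0I_multiples fin pos by blast
  qed
  show "emeasure \<mu> (vp.span bL) = of_nat (CARD('k) ^ card (bL - bH)) * emeasure \<mu> (vp.span bH)"
    using eq[OF f subset_refl] bL(1) by (simp add: Un_absorb1)
qed

lemma emeasure_W_Suc:
  fixes \<mu> :: "'k::{field,finite} vp measure"
  assumes sets: "sets \<mu> = sets borel"
    and inv: "\<And>x. x \<in> W n \<Longrightarrow> emeasure \<mu> {w. w - x \<in> W (n + 1)} = emeasure \<mu> (W (n + 1))"
  shows "emeasure \<mu> (W n) = of_nat CARD('k) * emeasure \<mu> (W (n + 1))"
proof -
  \<comment> \<open>\<open>W n\<close> and \<open>W (n + 1)\<close> differ only by the condition on
    the coordinate \<open>- n\<close>, so vectors supported there represent the cosets.\<close>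
  define e where "e c = Abs_vp (\<lambda>j. if j = - n then c else 0 :: 'k)" for c
  have e: "coord (e c) = (\<lambda>j. if j = - n then c else 0)" for c
    unfolding e_def by (rule Abs_vp_inverse) (auto intro!: exI[of _ "- n"])
  have coset: "w - e c \<in> W (n + 1) \<longleftrightarrow> w \<in> W n \<and> coord w (- n) = c" for w c
  proof -
    have "l > - (n + 1) \<longleftrightarrow> l = - n \<or> l > - n" for l by auto
    then show ?thesis by (auto simp: W_def minus_vp.rep_eq e)
  qed
  have eW: "e c \<in> W n" for c by (simp add: W_def e)
  have "W n = (\<Union>c\<in>UNIV. {w. w - e c \<in> W (n + 1)})"
    by (auto simp: coset)
  moreover have "emeasure \<mu> (\<Union>c\<in>UNIV. {w. w - e c \<in> W (n + 1)}) = (\<Sum>c\<in>UNIV. emeasure \<mu> {w. w - e c \<in> W (n + 1)})"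
  proof (rule sum_emeasure[symmetric])
    show "disjoint_family_on (\<lambda>c. {w. w - e c \<in> W (n + 1)}) UNIV"
      unfolding disjoint_family_on_def coset by blast
  qed (auto simp: sets)
  ultimately have "emeasure \<mu> (W n) = (\<Sum>c\<in>UNIV. emeasure \<mu> {w. w - e c \<in> W (n + 1)})"
    by (simp only:)
  then show ?thesis by (simp add: inv[OF eW])
qed

locale vp_haar =
  fixes \<phi> :: "'k::{field,finite} vp measure" and p :: nat
  assumes prime: "prime p" and card_k: "CARD('k) = p"
    and haar: "haar_measure_on UNIV \<phi>"
    and W0: "emeasure \<phi> (W 0) = 1"
begin

lemma p_gt_1: "real p > 1"
  using prime prime_gt_1_nat by auto

lemma sets_phi [measurable_cong, simp]: "sets \<phi> = sets borel"
  using haar by (simp add: haar_measure_on_def)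

lemma space_phi [simp]: "space \<phi> = UNIV"
  using sets_eq_imp_space_eq[OF sets_phi] by simp

lemma phi_translate: "A \<in> sets borel \<Longrightarrow> emeasure \<phi> ((+) v ` A) = emeasure \<phi> A"
  using haar by (simp add: haar_measure_on_def)

lemma phi_coset: "emeasure \<phi> {w. w - v \<in> W n} = emeasure \<phi> (W n)"
  by (metis phi_translate coset_W_eq borel_open_coset_W(2))

lemma phi_W_Suc: "emeasure \<phi> (W n) = ennreal (real p) * emeasure \<phi> (W (n + 1))"
  using emeasure_W_Suc[OF sets_phi, of n] phi_coset[of _ "n + 1"]
  by (simp add: card_k ennreal_of_nat_eq_real_of_nat)

lemma p_powi_Suc: "real p * real p powi n = real p powi (n + 1)"
  using p_gt_1 by (simp add: power_int_add)

lemma phi_W: "emeasure \<phi> (W n) = ennreal (real p powi (- n))"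
proof (induction n rule: int_induct[of _ 0])
  case base
  then show ?case using W0 by simp
next
  case (step1 i)
  have "ennreal (real p) * emeasure \<phi> (W (i + 1)) = ennreal (real p) * ennreal (real p powi (- (i + 1)))"
    using step1 phi_W_Suc[of i] p_powi_Suc[of "- (i + 1)"] p_gt_1
    by (simp flip: ennreal_mult)
  then show ?case
    using p_gt_1 by (subst (asm) ennreal_mult_cancel_left) auto
next
  case (step2 i)
  have "emeasure \<phi> (W (i - 1)) = ennreal (real p) * ennreal (real p powi (- i))"
    using phi_W_Suc[of "i - 1"] step2 by simp
  also have "\<dots> = ennreal (real p powi (- (i - 1)))"
    using p_gt_1 p_powi_Suc[of "- i"] by (simp flip: ennreal_mult)
  finally show ?case .
qed

lemma phi_W_finite: "emeasure \<phi> (W n) < \<infinity>"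
  by (simp add: phi_W)

lemma phi_W_pos: "emeasure \<phi> (W n) > 0"
  using p_gt_1 by (simp add: phi_W)

text \<open>A compact subgroup of positive measure has finitely many cosets in \<open>W 0\<close>, so its complement there is closed.\<close>

lemma open_compact_subgroup:
  assumes K: "compact K" "K \<subseteq> W 0" "add_subgroup K" and pos: "emeasure \<phi> K \<noteq> 0"
  shows "open K"
proof -
  define C where "C = (\<lambda>x. (+) x ` K) ` W 0"
  have Kb: "K \<in> sets borel" using K(1) by (rule borel_compact)
  have cont: "compact ((+) x ` K)" for x
    using K(1) by (intro compact_continuous_image continuous_intros)
  then have Cb: "c \<in> sets borel" "closed c" if "c \<in> C" for c
    using that cont by (auto simp: C_def intro: compact_imp_closed borel_compact)
  have Cm: "emeasure \<phi> c = emeasure \<phi> K" if "c \<in> C" for c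
    using that phi_translate[OF Kb] by (auto simp: C_def)
  have disj: "disjoint C"
  proof -
    have "(+) x ` K = (+) y ` K" if z: "z \<in> (+) x ` K" "z \<in> (+) y ` K" for x y z
    proof -
      obtain a b where ab: "a \<in> K" "b \<in> K" "z = x + a" "z = y + b" using z by blast
      have xy: "x = y + (b + - a)" "y = x + (a + - b)" using ab(3,4) by (simp_all add: algebra_simps)
      have "b + - a \<in> K" "a + - b \<in> K" using K(3) ab unfolding add_subgroup_def by blast+
      then have "x + k \<in> (+) y ` K" "y + k \<in> (+) x ` K" if "k \<in> K" for k
      proof -
        have "(b + - a) + k \<in> K" "(a + - b) + k \<in> K"
          using that \<open>b + - a \<in> K\<close> \<open>a + - b \<in> K\<close> K(3) unfolding add_subgroup_def by blast+
        moreover have "x + k = y + ((b + - a) + k)" "y + k = x + ((a + - b) + k)"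
          using xy by (simp_all add: algebra_simps)
        ultimately show "x + k \<in> (+) y ` K" "y + k \<in> (+) x ` K" by blast+
      qed
      then show ?thesis by blast
    qed
    then show ?thesis unfolding disjoint_def C_def by blast
  qed
  have "finite C"
  proof (rule ccontr)
    assume inf: "infinite C"
    have "of_nat n * emeasure \<phi> K \<le> emeasure \<phi> (W 0)" for n
    proof -
      obtain F where F: "F \<subseteq> C" "finite F" "card F = n"
        using infinite_arbitrarily_large[OF inf] by blast
      have "of_nat n * emeasure \<phi> K = (\<Sum>c\<in>F. emeasure \<phi> c)"
        using F Cm by (subst sum.cong[OF refl, of _ _ "\<lambda>_. emeasure \<phi> K"]) auto
      also have "\<dots> = emeasure \<phi> (\<Union>c\<in>F. c)"
      proof (rule sum_emeasure)
        show "disjoint_family_on (\<lambda>c. c) F"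
          using F(1) disj unfolding disjoint_family_on_def disjoint_def by blast
      qed (use F Cb in auto)
      also have "\<dots> \<le> emeasure \<phi> (W 0)"
        using F K(2) W_add by (intro emeasure_mono) (fastforce simp: C_def)+
      finally show ?thesis .
    qed
    then show False using ennreal_eq_0I_multiples phi_W_finite pos by blast
  qed
  then have "closed (\<Union>(C - {K}))" using Cb by (intro closed_Union) auto
  moreover have "K = W 0 - \<Union>(C - {K})"
  proof
    have "0 \<in> K" using K(3) by (simp add: add_subgroup_def)
    then have "K = (+) 0 ` K" by auto
    then have "K \<in> C" unfolding C_def by (metis imageI zero_in_W)
    then show "K \<subseteq> W 0 - \<Union>(C - {K})"
      using K(2) disj by (auto simp: disjoint_def)
    show "W 0 - \<Union>(C - {K}) \<subseteq> K"
    proof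
      fix x assume x: "x \<in> W 0 - \<Union>(C - {K})"
      have "x \<in> (+) x ` K" using \<open>0 \<in> K\<close> by force
      moreover have "(+) x ` K \<in> C" using x by (auto simp: C_def)
      ultimately show "x \<in> K" using x by blast
    qed
  qed
  ultimately show "open K" using open_W by (metis open_Diff)
qed

end

section \<open>Haar measures on closed subgroups of the square\<close>

lemma borel_translate:
  assumes "A \<in> sets borel"
  shows "(+) h ` A \<in> sets (borel :: ('k::{ab_group_add,finite} vp \<times> 'k vp) measure)"
proof -
  have "continuous_on UNIV (\<lambda>x :: 'k vp \<times> 'k vp. (fst x - fst h, snd x - snd h))"
    by (intro continuous_intros)
  then have "(\<lambda>x. (fst x - fst h, snd x - snd h)) -` A \<inter> space borel \<in> sets borel"
    by (intro measurable_sets[OF borel_measurable_continuous_onI assms])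
  moreover have "(\<lambda>x. (fst x - fst h, snd x - snd h)) -` A = (+) h ` A"
  proof -
    have "(fst x - fst h, snd x - snd h) = x - h" for x by (simp add: prod_eq_iff)
    moreover have "x \<in> (+) h ` A" if "x - h \<in> A" for x
      using that by (rule rev_image_eqI) simp
    ultimately show ?thesis by auto
  qed
  ultimately show ?thesis by simp
qed

text \<open>\<open>m\<close> is the extension by zero of a Haar measure on \<open>R\<close> to all Borel sets.\<close>

locale vp_relation = vp_haar \<phi> p
  for \<phi> :: "'k::{field,finite} vp measure" and p +
  fixes R :: "('k vp \<times> 'k vp) set" and m :: "('k vp \<times> 'k vp) measure"
  assumes closed_R: "closed R" and subgroup_R: "add_subgroup R"
    and sets_m [measurable_cong, simp]: "sets m = sets borel"
    and null: "\<And>A. A \<in> sets borel \<Longrightarrow> A \<inter> R = {} \<Longrightarrow> emeasure m A = 0"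
    and inv: "\<And>h A. h \<in> R \<Longrightarrow> A \<in> sets borel \<Longrightarrow> emeasure m ((+) h ` A) = emeasure m A"
    and fst_le: "\<And>A. A \<in> sets borel \<Longrightarrow> emeasure m (A \<times> UNIV) \<le> emeasure \<phi> A"
    and snd_le: "\<And>A. A \<in> sets borel \<Longrightarrow> emeasure m (UNIV \<times> A) \<le> emeasure \<phi> A"
    and nontriv: "emeasure m UNIV \<noteq> 0"
begin

lemma space_m [simp]: "space m = UNIV"
  using sets_eq_imp_space_eq[OF sets_m] by simp

declare borel_Times [simp]

lemma R_zero: "0 \<in> R" and R_add: "x \<in> R \<Longrightarrow> y \<in> R \<Longrightarrow> x + y \<in> R"
  and R_uminus: "x \<in> R \<Longrightarrow> - x \<in> R"
  using subgroup_R by (auto simp: add_subgroup_def)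

lemma R_scale: "(x, y) \<in> R \<Longrightarrow> (vp_scale c x, vp_scale c y) \<in> R"
  using add_subgroup_scale[OF _ subgroup_R] prime card_k by simp

lemma continuous_swap: "continuous_on UNIV (prod.swap :: 'k vp \<times> 'k vp \<Rightarrow> _)"
  unfolding prod.swap_def by (intro continuous_intros)

lemma swap_borel:
  assumes "A \<in> sets borel" shows "prod.swap -` A \<in> sets (borel :: ('k vp \<times> 'k vp) measure)"
  using measurable_sets[OF borel_measurable_continuous_onI[OF continuous_swap] assms] by simp

lemma swap_measurable: "prod.swap \<in> measurable m borel"
  using borel_measurable_continuous_onI[OF continuous_swap]
  by (subst measurable_cong_sets[OF sets_m refl])

lemma emeasure_swap: "A \<in> sets borel \<Longrightarrow> emeasure (distr m borel prod.swap) A = emeasure m (prod.swap -` A)"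
  using emeasure_distr[OF swap_measurable] by simp

text \<open>Passing to the converse exchanges domain and range, kernel and indefiniteness, \<alpha>
  and \<beta>. One-sided results are proved once and transferred by interpreting the locale a second
  time.\<close>

lemma swap: "vp_relation \<phi> p (R\<inverse>) (distr m borel prod.swap)"
proof
  have eq: "R\<inverse> = prod.swap -` R" by auto
  show "closed (R\<inverse>)"
    unfolding eq by (rule closed_vimage[OF closed_R continuous_swap])
  show "add_subgroup (R\<inverse>)"
    using R_zero R_add R_uminus by (fastforce simp: add_subgroup_def zero_prod_def)
  show "emeasure (distr m borel prod.swap) A = 0" if "A \<in> sets borel" "A \<inter> R\<inverse> = {}" for A
    using that by (subst emeasure_swap) (auto intro!: null simp: swap_borel)
  show "emeasure (distr m borel prod.swap) ((+) h ` A) = emeasure (distr m borel prod.swap) A"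
    if h: "h \<in> R\<inverse>" and A: "A \<in> sets borel" for h A
  proof -
    have hA: "(+) h ` A \<in> sets borel" using A by (rule borel_translate)
    have "prod.swap -` ((+) h ` A) = (+) (prod.swap h) ` (prod.swap -` A)"
    proof
      show "prod.swap -` ((+) h ` A) \<subseteq> (+) (prod.swap h) ` (prod.swap -` A)"
      proof
        fix z assume "z \<in> prod.swap -` ((+) h ` A)"
        then obtain a where a: "a \<in> A" "prod.swap z = h + a" by auto
        then have "z = prod.swap h + prod.swap a" by (simp add: prod_eq_iff)
        then show "z \<in> (+) (prod.swap h) ` (prod.swap -` A)" using a by (intro image_eqI[of _ _ "prod.swap a"]) auto
      qed
      show "(+) (prod.swap h) ` (prod.swap -` A) \<subseteq> prod.swap -` ((+) h ` A)"
      proof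
        fix z assume "z \<in> (+) (prod.swap h) ` (prod.swap -` A)"
        then obtain a where a: "prod.swap a \<in> A" "z = prod.swap h + a" by auto
        then have "prod.swap z = h + prod.swap a" by (simp add: prod_eq_iff)
        then show "z \<in> prod.swap -` ((+) h ` A)" using a by simp
      qed
    qed
    moreover have "prod.swap h \<in> R" using h by auto
    ultimately show ?thesis
      using A hA by (simp add: emeasure_swap inv swap_borel)
  qed
  have v: "prod.swap -` (A \<times> B) = B \<times> A" for A B :: "'k vp set" by auto
  show "emeasure (distr m borel prod.swap) (A \<times> UNIV) \<le> emeasure \<phi> A" if "A \<in> sets borel" for A
    using that by (simp add: emeasure_swap v snd_le)
  show "emeasure (distr m borel prod.swap) (UNIV \<times> A) \<le> emeasure \<phi> A" if "A \<in> sets borel" for A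
    using that by (simp add: emeasure_swap v fst_le)
  show "emeasure (distr m borel prod.swap) UNIV \<noteq> 0"
    using nontriv by (simp add: emeasure_swap)
qed simp

text \<open>A coset that meets \<open>R\<close> is a translate of \<open>Q n\<close> by an element
  of \<open>R\<close>. At level \<open>n\<close> the measure is thus described by a single mass and
  by the set of cosets met by \<open>R\<close>.\<close>

lemma emeasure_coset_Q:
  "emeasure m {z. z - q \<in> Q n} = (if \<exists>z\<in>R. z - q \<in> Q n then emeasure m (Q n) else 0)"
proof (cases "\<exists>z\<in>R. z - q \<in> Q n")
  case True
  then obtain z where z: "z \<in> R" "z - q \<in> Q n" by blast
  have "w - q \<in> Q n \<longleftrightarrow> w - z \<in> Q n" for w
    using Q_diff[OF _ z(2), of "w - q"] Q_add[OF _ z(2), of "w - z"] by auto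
  then have "{w. w - q \<in> Q n} = (+) z ` Q n" by (simp add: coset_Q_eq)
  then show ?thesis using True inv[OF z(1), of "Q n"] by simp
next
  case False
  then show ?thesis by (auto intro!: null)
qed

text \<open>Countably many cosets of \<open>Q n\<close> cover the space and none has more mass than
  \<open>Q n\<close>, so a null \<open>Q n\<close> would make \<open>m\<close> the zero
  measure.\<close>

lemma emeasure_Q_pos: "emeasure m (Q n) > 0"
proof (rule ccontr)
  assume "\<not> emeasure m (Q n) > 0"
  then have 0: "emeasure m {z. z - q \<in> Q n} = 0" for q
    by (auto simp: emeasure_coset_Q)
  obtain T where T: "countable T" "\<And>z :: 'k vp \<times> 'k vp. \<exists>q\<in>T. z - q \<in> Q n"
    using countable_cover_cosets_Q by blast
  have "(\<Union>q\<in>T. {z. z - q \<in> Q n}) \<in> null_sets m"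
    using T(1) 0 by (intro null_sets_UN') (auto simp: null_sets_def)
  moreover have "(\<Union>q\<in>T. {z. z - q \<in> Q n}) = UNIV" using T(2) by auto
  ultimately show False using nontriv by (simp add: null_sets_def)
qed

lemma emeasure_Q_le: "emeasure m (Q n) \<le> emeasure \<phi> (W n)"
proof -
  have "emeasure m (Q n) \<le> emeasure m (W n \<times> UNIV)"
    unfolding Q_def by (intro emeasure_mono) auto
  also have "\<dots> \<le> emeasure \<phi> (W n)" by (rule fst_le) simp
  finally show ?thesis .
qed

text \<open>
  The index is computed in the group \<open>L\<close> of second coordinates rather than in \<open>R\<close>: cosets of \<open>W n\<close>
  in \<open>L\<close> correspond to cosets of \<open>R \<inter> (B \<times> W n)\<close> in \<open>R \<inter> (B \<times> E)\<close>.
\<close>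

lemma index_snd:
  assumes B: "B \<in> sets borel" "\<And>x y. x \<in> B \<Longrightarrow> y \<in> B \<Longrightarrow> x + y \<in> B" "\<And>x. x \<in> B \<Longrightarrow> - x \<in> B"
    and E: "vp.subspace E" "W n \<subseteq> E"
    and L: "L = {y \<in> E. \<exists>z\<in>R. fst z \<in> B \<and> y - snd z \<in> W n}"
    and bH: "vp.span bH = W n" "bH \<subseteq> bL" "vp.independent bL" "vp.span bL = L"
    and fin: "emeasure m (B \<times> E) < \<infinity>" and pos: "emeasure m (B \<times> W n) \<noteq> 0"
  shows "finite (bL - bH) \<and> emeasure m (B \<times> E) = of_nat (p ^ card (bL - bH)) * emeasure m (B \<times> W n)"
proof -
  define \<nu> where "\<nu> = distr (density m (indicator (B \<times> UNIV))) borel snd"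
  have sets_nu: "sets \<nu> = sets borel" by (simp add: \<nu>_def)
  have "(snd :: 'k vp \<times> 'k vp \<Rightarrow> _) \<in> borel_measurable borel"
    by (intro borel_measurable_continuous_onI continuous_intros)
  then have snd_m: "snd \<in> measurable (density m (indicator (B \<times> UNIV))) borel"
    by (subst measurable_cong_sets[of _ borel _ borel]) auto
  have nu: "emeasure \<nu> A = emeasure m (B \<times> A)" if "A \<in> sets borel" for A
  proof -
    have "emeasure \<nu> A = emeasure (density m (indicator (B \<times> UNIV))) (snd -` A \<inter> space (density m (indicator (B \<times> UNIV))))"
      unfolding \<nu>_def using that snd_m by (rule emeasure_distr[rotated])
    also have "snd -` A \<inter> space (density m (indicator (B \<times> UNIV))) = UNIV \<times> A" by auto
    also have "emeasure (density m (indicator (B \<times> UNIV))) (UNIV \<times> A) = emeasure m (B \<times> UNIV \<inter> UNIV \<times> A)"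
      using that B by (intro emeasure_restricted) auto
    also have "B \<times> UNIV \<inter> UNIV \<times> A = B \<times> A" by auto
    finally show ?thesis .
  qed
  have subL: "W n \<subseteq> L" using bH vp.span_mono[of bH bL] by simp
  have Lb: "L \<in> sets borel"
    using subL bH vp.span_add by (intro borel_UN_cosets_W[of _ n]) blast
  have Eb: "E \<in> sets borel"
    using E vp.subspace_add by (intro borel_UN_cosets_W[of _ n]) blast
  \<comment> \<open>\<open>m\<close> is carried by \<open>R\<close>, and a point of \<open>R\<close>
    in \<open>B \<times> E\<close> has its second coordinate in \<open>L\<close>.\<close>
  have BE: "emeasure m (B \<times> E) = emeasure m (B \<times> L)"
  proof -
    have "emeasure m (B \<times> E) = emeasure m (B \<times> L \<union> B \<times> (E - L))"
      by (rule arg_cong[of _ _ "emeasure m"]) (auto simp: L)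
    also have "\<dots> = emeasure m (B \<times> L) + emeasure m (B \<times> (E - L))"
      using B Lb Eb by (intro plus_emeasure[symmetric]) auto
    also have "emeasure m (B \<times> (E - L)) = 0"
    proof (rule null)
      show "B \<times> (E - L) \<inter> R = {}" by (force simp: L)
    qed (use B Lb Eb in auto)
    finally show ?thesis by simp
  qed
  \<comment> \<open>A vector \<open>y\<close> of \<open>L\<close> agrees modulo \<open>W n\<close>
    with the second coordinate of some \<open>z \<in> R\<close> whose first coordinate is in
    \<open>B\<close>. Translation by \<open>z\<close> preserves \<open>m\<close> and leaves the
    factor \<open>B\<close> in place.\<close>
  have inv_nu: "emeasure \<nu> {v. v - y \<in> vp.span bH} = emeasure \<nu> (vp.span bH)" if y: "y \<in> vp.span bL" for y
  proof -
    from y obtain z where z: "z \<in> R" "fst z \<in> B" "y - snd z \<in> W n" using bH L by blast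
    have "B \<times> {v. v - y \<in> W n} = (+) z ` (B \<times> W n)"
    proof
      show "B \<times> {v. v - y \<in> W n} \<subseteq> (+) z ` (B \<times> W n)"
      proof
        fix u assume u: "u \<in> B \<times> {v. v - y \<in> W n}"
        have "(snd u - y) + (y - snd z) \<in> W n" using u z by (intro W_add) auto
        moreover have "fst u + - fst z \<in> B" using B(2)[OF _ B(3)[OF z(2)], of "fst u"] u by auto
        ultimately have "u - z \<in> B \<times> W n" by (simp add: mem_Times_iff)
        then show "u \<in> (+) z ` (B \<times> W n)" by (rule rev_image_eqI) simp
      qed
      show "(+) z ` (B \<times> W n) \<subseteq> B \<times> {v. v - y \<in> W n}"
      proof
        fix u assume "u \<in> (+) z ` (B \<times> W n)"
        then obtain w where w: "w \<in> B \<times> W n" "u = z + w" by blast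
        have "snd w - (y - snd z) \<in> W n" using w(1) W_diff[OF _ z(3), of "snd w"] by auto
        moreover have "fst z + fst w \<in> B" using w z B by auto
        ultimately show "u \<in> B \<times> {v. v - y \<in> W n}"
          using w by (simp add: mem_Times_iff algebra_simps)
      qed
    qed
    then show ?thesis
      using bH(1) B z inv[of z "B \<times> W n"] by (simp add: nu)
  qed
  have "W n \<subseteq> vp.span bH" "emeasure \<nu> (vp.span bL) < \<infinity>" "emeasure \<nu> (vp.span bH) \<noteq> 0"
    using bH fin pos BE Lb by (simp_all add: nu)
  note * = emeasure_span_cosets[OF sets_nu this(1) bH(2,3) inv_nu this(2,3)]
  show ?thesis
    using * bH Lb by (simp add: nu BE card_k)
qed

text \<open>Closure of \<open>B\<close> under scalars makes the group of second coordinates a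
  subspace, which supplies the two bases. \<open>E\<close> may be the whole space; this case links
  \<open>Q M\<close> to the strip \<open>W M \<times> UNIV\<close> that determines \<alpha>.\<close>

lemma index_snd_power:
  assumes B: "B \<in> sets borel" "\<And>x y. x \<in> B \<Longrightarrow> y \<in> B \<Longrightarrow> x + y \<in> B" "\<And>x. x \<in> B \<Longrightarrow> - x \<in> B"
    "\<And>c x. x \<in> B \<Longrightarrow> vp_scale c x \<in> B" "0 \<in> B"
    and E: "vp.subspace E" "W n \<subseteq> E"
    and fin: "emeasure m (B \<times> E) < \<infinity>" and pos: "emeasure m (B \<times> W n) \<noteq> 0"
  shows "\<exists>k. emeasure m (B \<times> E) = ennreal (real p ^ k) * emeasure m (B \<times> W n)"
proof -
  define L where "L = {y \<in> E. \<exists>z\<in>R. fst z \<in> B \<and> y - snd z \<in> W n}"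
  have WL: "W n \<subseteq> L"
    using E(2) R_zero B(5) by (auto simp: L_def intro!: bexI[of _ 0])
  have "vp.subspace L"
  proof (rule vp.subspaceI)
    show "0 \<in> L" using WL by auto
  next
    fix x y assume "x \<in> L" "y \<in> L"
    then obtain z w where zw: "z \<in> R" "w \<in> R" "fst z \<in> B" "fst w \<in> B" "x - snd z \<in> W n" "y - snd w \<in> W n" "x \<in> E" "y \<in> E"
      by (auto simp: L_def)
    have "(x - snd z) + (y - snd w) \<in> W n" using zw by (intro W_add)
    then have "(x + y) - snd (z + w) \<in> W n" by (simp add: algebra_simps)
    moreover have "z + w \<in> R" "fst (z + w) \<in> B" "x + y \<in> E"
      using zw R_add B E vp.subspace_add by auto
    ultimately show "x + y \<in> L" unfolding L_def by blast
  next
    fix c x assume "x \<in> L"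
    then obtain z where z: "z \<in> R" "fst z \<in> B" "x - snd z \<in> W n" "x \<in> E"
      by (auto simp: L_def)
    have "vp_scale c (x - snd z) \<in> W n" using z subspace_W vp.subspace_scale by blast
    then have "vp_scale c x - snd (vp_scale c (fst z), vp_scale c (snd z)) \<in> W n"
      by (simp add: vp.scale_right_diff_distrib)
    moreover have "(vp_scale c (fst z), vp_scale c (snd z)) \<in> R" "vp_scale c (fst z) \<in> B" "vp_scale c x \<in> E"
      using z R_scale B E vp.subspace_scale by auto
    ultimately show "vp_scale c x \<in> L"
      unfolding L_def by (auto intro!: bexI[of _ "(vp_scale c (fst z), vp_scale c (snd z))"])
  qed
  obtain bH :: "'k vp set" where bH: "bH \<subseteq> W n" "vp.independent bH" "W n \<subseteq> vp.span bH"
    using vp.maximal_independent_subset[of "W n"] by blast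
  then have sH: "vp.span bH = W n" using subspace_W vp.span_subspace by blast
  obtain bL where bL: "bH \<subseteq> bL" "bL \<subseteq> L" "vp.independent bL" "L \<subseteq> vp.span bL"
    using vp.maximal_independent_subset_extend[OF subset_trans[OF bH(1) WL] bH(2)] by metis
  then have sL: "vp.span bL = L" using \<open>vp.subspace L\<close> vp.span_subspace by blast
  have "emeasure m (B \<times> E) = of_nat (p ^ card (bL - bH)) * emeasure m (B \<times> W n)"
    using index_snd[OF B(1-3) E L_def sH bL(1,3) sL fin pos] by blast
  then show ?thesis by (auto simp: ennreal_of_nat_eq_real_of_nat)
qed

end

context vp_haar begin

definition p_power :: "ennreal \<Rightarrow> bool" where
  "p_power x \<longleftrightarrow> (\<exists>i. x = ennreal (real p powi i))"

lemma p_power_mult: "p_power (ennreal (real p powi i) * x) \<longleftrightarrow> p_power x"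
proof -
  have *: "p_power (ennreal (real p powi j) * x)" if x: "p_power x" for x j
  proof -
    obtain l where "x = ennreal (real p powi l)" using x by (auto simp: p_power_def)
    then have "ennreal (real p powi j) * x = ennreal (real p powi (j + l))"
      using p_gt_1 by (simp add: power_int_add flip: ennreal_mult)
    then show ?thesis by (auto simp: p_power_def)
  qed
  have "ennreal (real p powi (- i)) * (ennreal (real p powi i) * x) = x"
  proof -
    have "ennreal (real p powi (- i)) * ennreal (real p powi i) = 1"
      using p_gt_1 by (simp add: power_int_minus flip: ennreal_mult)
    then show ?thesis by (simp add: mult.assoc[symmetric])
  qed
  with * show ?thesis by metis
qed

end

section \<open>Masses of boxes, the domain, and the constant \<alpha>\<close>

context vp_relation begin

lemma W_scale: "x \<in> W n \<Longrightarrow> vp_scale c x \<in> W n" for x :: "'k vp"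
  by (rule vp.subspace_scale[OF subspace_W])

lemma emeasure_less_infinity:
  "emeasure m (W n \<times> A) < \<infinity>" "emeasure m (A \<times> W n) < \<infinity>"
proof -
  have "emeasure m (W n \<times> A) \<le> emeasure m (W n \<times> UNIV)"
    by (intro emeasure_mono) auto
  also have "\<dots> \<le> emeasure \<phi> (W n)" by (rule fst_le) simp
  finally show "emeasure m (W n \<times> A) < \<infinity>" using phi_W_finite by (rule le_less_trans)
  have "emeasure m (A \<times> W n) \<le> emeasure m (UNIV \<times> W n)"
    by (intro emeasure_mono) auto
  also have "\<dots> \<le> emeasure \<phi> (W n)" by (rule snd_le) simp
  finally show "emeasure m (A \<times> W n) < \<infinity>" using phi_W_finite by (rule le_less_trans)
qed

lemma emeasure_W_Times_pos: "emeasure m (W i \<times> W j) \<noteq> 0"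
proof -
  have "emeasure m (Q (max i j)) \<le> emeasure m (W i \<times> W j)"
    unfolding Q_def by (intro emeasure_mono Sigma_mono W_antimono) auto
  then show ?thesis using emeasure_Q_pos[of "max i j"] by auto
qed

lemma power_snd:
  assumes "vp.subspace E" "W n \<subseteq> E"
  shows "\<exists>k. emeasure m (W i \<times> E) = ennreal (real p ^ k) * emeasure m (W i \<times> W n)"
  by (rule index_snd_power[OF _ W_add W_uminus W_scale zero_in_W assms])
    (use emeasure_less_infinity emeasure_W_Times_pos in auto)

lemma power_fst:
  assumes E: "vp.subspace E" "W n \<subseteq> E"
  shows "\<exists>k. emeasure m (E \<times> W i) = ennreal (real p ^ k) * emeasure m (W n \<times> W i)"
proof -
  interpret sw: vp_relation \<phi> p "R\<inverse>" "distr m borel prod.swap" by (rule swap)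
  have "E \<in> sets borel"
    using E vp.subspace_add by (intro borel_UN_cosets_W[of _ n]) blast
  then have v: "emeasure (distr m borel prod.swap) (W i \<times> A) = emeasure m (A \<times> W i)" if "A \<in> {E, W n}" for A
  proof -
    have "emeasure (distr m borel prod.swap) (W i \<times> A) = emeasure m (prod.swap -` (W i \<times> A))"
      using that \<open>E \<in> sets borel\<close> by (intro emeasure_swap) auto
    also have "prod.swap -` (W i \<times> A) = A \<times> W i" by auto
    finally show ?thesis .
  qed
  show ?thesis using sw.power_snd[OF E, of i] v by simp
qed

text \<open>The box \<open>W i \<times> W j\<close> lies between the two squares, so only one factor
  is enlarged at a time and each change of mass is an index computed on one side.\<close>

lemma p_power_emeasure_Q: "p_power (emeasure m (Q i)) \<longleftrightarrow> p_power (emeasure m (Q j))"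
proof -
  have *: "p_power (emeasure m (Q i)) \<longleftrightarrow> p_power (emeasure m (Q j))" if "i \<le> j" for i j
  proof -
    have sub: "W j \<subseteq> W i" using that by (rule W_antimono)
    obtain k where k: "emeasure m (W i \<times> W i) = ennreal (real p ^ k) * emeasure m (W i \<times> W j)"
      using power_snd[OF subspace_W sub] by blast
    obtain l where l: "emeasure m (W i \<times> W j) = ennreal (real p ^ l) * emeasure m (W j \<times> W j)"
      using power_fst[OF subspace_W sub] by blast
    show ?thesis
      unfolding Q_def k l using p_power_mult[of "int k"] p_power_mult[of "int l"] by simp
  qed
  show ?thesis using *[of i j] *[of j i] by linarith
qed

text \<open>Domination forces the domain to be open: the first projection \<open>K\<close> of
  \<open>R \<inter> Q 0\<close> is a subgroup with \<open>emeasure \<phi> K\<close> at least the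
  positive mass of \<open>Q 0\<close>. Cutting with \<open>Q 0\<close> makes \<open>K\<close>
  compact, so that it is measurable and the criterion for openness applies.\<close>

lemma W_subset_Domain: "\<exists>M\<ge>0. W M \<subseteq> Domain R"
proof -
  define K where "K = fst ` (R \<inter> Q 0)"
  have cK: "compact K"
    unfolding K_def
    by (intro compact_continuous_image continuous_intros closed_Int_compact closed_R compact_Q)
  then have Kb: "K \<in> sets borel" by (rule borel_compact)
  then have KU: "K \<times> UNIV \<in> sets (borel :: ('k vp \<times> 'k vp) measure)" by simp
  have "emeasure m (Q 0) \<le> emeasure m (K \<times> UNIV \<union> (Q 0 - K \<times> UNIV))"
    using KU by (intro emeasure_mono) auto
  also have "\<dots> \<le> emeasure m (K \<times> UNIV) + emeasure m (Q 0 - K \<times> UNIV)"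
    using KU by (intro emeasure_subadditive) auto
  also have "emeasure m (Q 0 - K \<times> UNIV) = 0"
    using KU by (intro null) (force simp: K_def)+
  also have "emeasure m (K \<times> UNIV) + 0 \<le> emeasure \<phi> K"
    using fst_le[OF Kb] by simp
  finally have "emeasure \<phi> K \<noteq> 0" using emeasure_Q_pos[of 0] by auto
  moreover have "K \<subseteq> W 0" by (auto simp: K_def Q_def)
  moreover have "add_subgroup K"
    unfolding add_subgroup_def
  proof (intro conjI ballI)
    show "0 \<in> K" unfolding K_def using R_zero by (intro image_eqI[of _ _ 0]) auto
    show "x + y \<in> K" if "x \<in> K" "y \<in> K" for x y
    proof -
      obtain z w where zw: "z \<in> R \<inter> Q 0" "w \<in> R \<inter> Q 0" "x = fst z" "y = fst w"
        using \<open>x \<in> K\<close> \<open>y \<in> K\<close> unfolding K_def by blast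
      then have "z + w \<in> R \<inter> Q 0" using R_add Q_add by blast
      then show ?thesis unfolding K_def using zw by (intro image_eqI[of _ _ "z + w"]) auto
    qed
    show "- x \<in> K" if "x \<in> K" for x
    proof -
      obtain z where z: "z \<in> R \<inter> Q 0" "x = fst z" using \<open>x \<in> K\<close> unfolding K_def by blast
      then have "- z \<in> R \<inter> Q 0" using R_uminus Q_uminus by blast
      then show ?thesis unfolding K_def using z by (intro image_eqI[of _ _ "- z"]) auto
    qed
  qed
  ultimately have "open K" using open_compact_subgroup[OF cK] by blast
  moreover have "0 \<in> K" unfolding K_def using R_zero by (intro image_eqI[of _ _ 0]) auto
  ultimately obtain M where "\<forall>w\<in>W M. 0 + w \<in> K" unfolding open_vp_def by blast
  moreover have "K \<subseteq> Domain R" by (auto simp: K_def)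
  ultimately have "W M \<subseteq> Domain R" by auto
  then have "W (max 0 M) \<subseteq> Domain R" using W_antimono[of M "max 0 M"] by auto
  then show ?thesis by (intro exI[of _ "max 0 M"]) auto
qed

lemma Domain_coset:
  assumes M: "W M \<subseteq> Domain R" and n: "n \<ge> M"
  shows "v \<in> Domain R \<Longrightarrow> {w. w - v \<in> W n} \<subseteq> Domain R"
    "v \<notin> Domain R \<Longrightarrow> {w. w - v \<in> W n} \<inter> Domain R = {}"
proof -
  have W: "\<exists>y. (w, y) \<in> R" if "w \<in> W n" for w
    using that M W_antimono[OF n] by blast
  have *: "v + w \<in> Domain R" if vw: "v \<in> Domain R" "w \<in> W n" for v w
  proof -
    obtain y y' where "(v, y) \<in> R" "(w, y') \<in> R" using W vw by blast
    then have "(v + w, y + y') \<in> R" using R_add by fastforce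
    then show ?thesis by blast
  qed
  show "{w. w - v \<in> W n} \<subseteq> Domain R" if "v \<in> Domain R"
    using *[OF that] by (metis (no_types, lifting) add.commute diff_add_cancel mem_Collect_eq subsetI)
  show "{w. w - v \<in> W n} \<inter> Domain R = {}" if "v \<notin> Domain R"
  proof (rule ccontr)
    assume "{w. w - v \<in> W n} \<inter> Domain R \<noteq> {}"
    then obtain w where w: "w - v \<in> W n" "w \<in> Domain R" by blast
    then have "w + - (w - v) \<in> Domain R" using W_uminus * by blast
    then show False using that by simp
  qed
qed

lemma borel_Domain: "Domain R \<in> sets borel"
proof -
  obtain M where M: "W M \<subseteq> Domain R" using W_subset_Domain by blast
  show ?thesis
  proof (rule borel_UN_cosets_W[of _ M])
    fix v w :: "'k vp" assume "v \<in> Domain R" "w \<in> W M"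
    then show "v + w \<in> Domain R" using Domain_coset(1)[OF M, of M v] by auto
  qed
qed

text \<open>The condition that selects \<open>alpha\<close>, stated for the extended measure
  \<open>m\<close>; its instance for the converse relation then describes
  \<open>beta\<close>.\<close>

definition is_alpha :: "real \<Rightarrow> bool" where
  "is_alpha a \<longleftrightarrow> 0 < a \<and> a \<le> 1 \<and>
    (\<forall>A\<in>sets borel. emeasure m (A \<times> UNIV) = ennreal a * emeasure \<phi> (A \<inter> Domain R))"

text \<open>Testing on a \<open>W M\<close> inside the domain leaves only the ratio of
  \<open>m (W M \<times> UNIV)\<close> to \<open>\<phi> (W M)\<close>. It fits all Borel sets since
  the first marginal is invariant under \<open>Domain R\<close>. The ratio differs from
  \<open>m (Q M)\<close> by a power of \<open>p\<close> only, which gives the second claim.\<close>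

lemma ex1_alpha: "\<exists>!a. is_alpha a"
  and p_power_alpha: "is_alpha b \<Longrightarrow> (\<exists>i. b = real p powi i) \<longleftrightarrow> p_power (emeasure m (Q 0))"
proof -
  obtain M where M: "W M \<subseteq> Domain R" using W_subset_Domain by blast
  have phi_M: "emeasure \<phi> (W M \<inter> Domain R) = ennreal (real p powi (- M))"
    using M phi_W by (simp add: Int_absorb2)
  obtain k where k: "emeasure m (W M \<times> UNIV) = ennreal (real p ^ k) * emeasure m (Q M)"
    unfolding Q_def using power_snd[of UNIV M M] by auto
  obtain c where c: "emeasure m (Q M) = ennreal c" "c > 0"
    using emeasure_Q_pos[of M] emeasure_less_infinity(1)[of M "W M"]
    by (cases "emeasure m (Q M)") (auto simp: Q_def)
  \<comment> \<open>\<open>real p ^ k * c\<close> is the mass of \<open>W M \<times> UNIV\<close>,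
    and the factor \<open>real p powi M\<close> divides by the Haar mass of
    \<open>W M\<close>.\<close>
  define a where "a = real p ^ k * c * real p powi M"
  have eqa: "b = a" if "is_alpha b" for b
  proof -
    have "ennreal (real p ^ k * c) = ennreal (b * real p powi (- M))"
      using that k c phi_M p_gt_1 by (auto simp: is_alpha_def simp flip: ennreal_mult)
    then have "real p ^ k * c = b * real p powi (- M)"
      using that c p_gt_1 by (subst (asm) ennreal_inj) (auto simp: is_alpha_def)
    then show ?thesis using p_gt_1 by (simp add: a_def power_int_minus field_simps)
  qed
  have apos: "a > 0" using c p_gt_1 by (simp add: a_def)
  have WM: "emeasure m (W M \<times> UNIV) = ennreal (a * real p powi (- M))"
    using k c p_gt_1 by (simp add: a_def power_int_minus field_simps flip: ennreal_mult)
  have "ennreal (a * real p powi (- M)) \<le> ennreal (real p powi (- M))"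
    using fst_le[of "W M"] WM phi_W by simp
  then have "a * real p powi (- M) \<le> 1 * real p powi (- M)"
    using p_gt_1 by (subst (asm) ennreal_le_iff) auto
  then have ale: "a \<le> 1"
    using p_gt_1 by (subst (asm) mult_le_cancel_right_pos) auto
  define \<mu> where "\<mu> = distr m borel fst"
  define \<nu> where "\<nu> = scale_measure (ennreal a) (density \<phi> (indicator (Domain R)))"
  have sets_mu: "sets \<mu> = sets borel" and sets_nu: "sets \<nu> = sets borel"
    by (simp_all add: \<mu>_def \<nu>_def)
  have mu: "emeasure \<mu> A = emeasure m (A \<times> UNIV)" if "A \<in> sets borel" for A
  proof -
    have "(fst :: 'k vp \<times> 'k vp \<Rightarrow> _) \<in> borel_measurable borel"
      by (intro borel_measurable_continuous_onI continuous_intros)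
    then have "(fst :: 'k vp \<times> 'k vp \<Rightarrow> _) \<in> borel_measurable m"
      by (subst measurable_cong_sets[OF sets_m refl])
    then have "emeasure \<mu> A = emeasure m (fst -` A \<inter> space m)"
      unfolding \<mu>_def using that by (rule emeasure_distr)
    also have "fst -` A \<inter> space m = A \<times> UNIV" by auto
    finally show ?thesis .
  qed
  have nu: "emeasure \<nu> A = ennreal a * emeasure \<phi> (A \<inter> Domain R)" if "A \<in> sets borel" for A
    using that borel_Domain by (simp add: \<nu>_def emeasure_restricted Int_commute)
  have inv': "emeasure \<mu> {w. w - x \<in> W n} = emeasure \<mu> (W n)" if "x \<in> Domain R" for x n
  proof -
    obtain y where y: "(x, y) \<in> R" using \<open>x \<in> Domain R\<close> by blast
    have "{w. w - x \<in> W n} \<times> UNIV = (+) (x, y) ` (W n \<times> UNIV)"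
    proof
      show "{w. w - x \<in> W n} \<times> UNIV \<subseteq> (+) (x, y) ` (W n \<times> UNIV)"
      proof
        fix z assume "z \<in> {w. w - x \<in> W n} \<times> (UNIV :: 'k vp set)"
        then have "z - (x, y) \<in> W n \<times> UNIV" by (simp add: mem_Times_iff)
        then show "z \<in> (+) (x, y) ` (W n \<times> UNIV)" by (rule rev_image_eqI) simp
      qed
    qed auto
    then show ?thesis using inv[OF y, of "W n \<times> UNIV"] by (simp add: mu)
  qed
  have Wn: "emeasure \<mu> (W n) = ennreal (a * real p powi (- n))" if "n \<ge> M" for n
    using that
  proof (induction n rule: int_ge_induct)
    case base
    show ?case using WM by (simp add: mu)
  next
    case (step i)
    have "W i \<subseteq> Domain R" using M W_antimono[OF step(1)] by blast
    then have "emeasure \<mu> (W i) = of_nat CARD('k) * emeasure \<mu> (W (i + 1))"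
      using inv' by (intro emeasure_W_Suc[OF sets_mu]) blast
    then have "ennreal (real p) * emeasure \<mu> (W (i + 1)) = ennreal (a * real p powi (- i))"
      using step by (simp add: card_k ennreal_of_nat_eq_real_of_nat)
    also have "\<dots> = ennreal (real p) * ennreal (a * real p powi (- (i + 1)))"
      using p_powi_Suc[of "- (i + 1)"] apos p_gt_1 by (simp add: ac_simps flip: ennreal_mult)
    finally show ?case
      using p_gt_1 by (subst (asm) ennreal_mult_cancel_left) auto
  qed
  \<comment> \<open>From level \<open>M\<close> on, a coset lies inside the domain or misses it.
    Inside, both measures give the same mass; outside, both give zero.\<close>
  have munu: "\<mu> = \<nu>"
  proof (rule measure_eqI_cosets[OF sets_mu sets_nu, of M])
    show eq: "emeasure \<mu> {w. w - v \<in> W n} = emeasure \<nu> {w. w - v \<in> W n}" if n: "n \<ge> M" for v n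
    proof (cases "v \<in> Domain R")
      case True
      then have "{w. w - v \<in> W n} \<inter> Domain R = {w. w - v \<in> W n}"
        using Domain_coset(1)[OF M n] by blast
      then show ?thesis
        using inv'[OF True] Wn[OF n] apos by (simp add: nu phi_coset phi_W ennreal_mult)
    next
      case False
      then have 0: "{w. w - v \<in> W n} \<inter> Domain R = {}"
        using Domain_coset(2)[OF M n] by blast
      then have "emeasure m ({w. w - v \<in> W n} \<times> UNIV) = 0"
        by (intro null) auto
      then show ?thesis using 0 by (simp add: nu mu)
    qed
    show "emeasure \<mu> {w. w - v \<in> W M} \<noteq> \<infinity>" for v
      unfolding eq[OF order_refl] using phi_W_finite[of M]
        emeasure_mono[of "{w. w - v \<in> W M} \<inter> Domain R" "{w. w - v \<in> W M}" \<phi>]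
      by (simp add: nu phi_coset ennreal_mult_eq_top_iff)
  qed
  have Pa: "is_alpha a"
    unfolding is_alpha_def using apos ale mu nu munu by simp
  show "\<exists>!a. is_alpha a" using Pa eqa by (intro ex1I[of _ a]) blast+
  show "(\<exists>i. b = real p powi i) \<longleftrightarrow> p_power (emeasure m (Q 0))" if "is_alpha b" for b
  proof -
    have "(\<exists>i. b = real p powi i) \<longleftrightarrow> p_power (ennreal a)"
      unfolding p_power_def eqa[OF that] using apos p_gt_1 by (auto simp: ennreal_inj)
    also have "ennreal a = ennreal (real p powi int k) * (ennreal (real p powi M) * emeasure m (Q M))"
      using c p_gt_1 by (simp add: a_def ac_simps flip: ennreal_mult)
    also have "p_power \<dots> \<longleftrightarrow> p_power (emeasure m (Q M))"
      by (simp only: p_power_mult)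
    finally show ?thesis using p_power_emeasure_Q by blast
  qed
qed

end

section \<open>Test functions\<close>

lemma compact_subset_Q:
  fixes K :: "('k::{ab_group_add,finite} vp \<times> 'k vp) set"
  assumes "compact K" shows "\<exists>n :: nat. K \<subseteq> Q (- int n)"
proof -
  have "K \<subseteq> (\<Union>n\<in>UNIV. Q (- int n))" using in_some_Q by blast
  then obtain F where F: "finite F" "K \<subseteq> (\<Union>n\<in>F. Q (- int n))"
    by (rule compactE_image[OF assms open_Q])
  have "Q (- int n) \<subseteq> Q (- int (Max F))" if "n \<in> F" for n
    using F(1) that by (intro Q_antimono) simp
  then have "K \<subseteq> Q (- int (Max F))" using F(2) by blast
  then show ?thesis ..
qed

text \<open>Finitely many cosets cover the support, and the finest of their levels works throughout:
  a coset is centred at each of its points, so moving by an element of a smaller \<open>Q\<close>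
  never leaves it.\<close>

lemma uniformly_continuous_compact_support:
  fixes \<theta> :: "'k::{ab_group_add,finite} vp \<times> 'k vp \<Rightarrow> real"
  assumes cont: "continuous_on UNIV \<theta>" and cpt: "compact (closure {x. \<theta> x \<noteq> 0})" and e: "e > 0"
  shows "\<exists>k. \<forall>x y. y - x \<in> Q k \<longrightarrow> \<bar>\<theta> y - \<theta> x\<bar> \<le> e"
proof -
  define K where "K = closure {x. \<theta> x \<noteq> 0}"
  have out: "\<theta> x = 0" if "x \<notin> K" for x
    using that closure_subset[of "{x. \<theta> x \<noteq> 0}"] unfolding K_def by blast
  have "\<exists>k. \<forall>w. w - x \<in> Q k \<longrightarrow> \<bar>\<theta> w - \<theta> x\<bar> < e / 2" for x
  proof -
    have "open {w. \<bar>\<theta> w - \<theta> x\<bar> < e / 2}"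
      by (intro open_Collect_less continuous_intros cont)
    from Q_nhds[OF this, of x] show ?thesis using e by simp
  qed
  then obtain k where k: "\<And>x w. w - x \<in> Q (k x) \<Longrightarrow> \<bar>\<theta> w - \<theta> x\<bar> < e / 2"
    by metis
  have "x \<in> {w. w - x \<in> Q (k x)}" for x by simp
  then have "K \<subseteq> (\<Union>x\<in>UNIV. {w. w - x \<in> Q (k x)})" by blast
  then obtain T where T: "finite T" "K \<subseteq> (\<Union>x\<in>T. {w. w - x \<in> Q (k x)})"
    by (rule compactE_image[OF cpt[folded K_def] open_coset_Q])
  define l where "l = Max (insert 0 (k ` T))"
  have main: "\<bar>\<theta> y - \<theta> x\<bar> \<le> e" if x: "x \<in> K" and yx: "y - x \<in> Q l" for x y
  proof -
    obtain t where t: "t \<in> T" "x - t \<in> Q (k t)" using T(2) x by blast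
    have "k t \<le> l" unfolding l_def using T(1) t(1) by (intro Max_ge) auto
    then have "y - x \<in> Q (k t)" using yx Q_antimono by blast
    then have "y - t \<in> Q (k t)" using Q_add[OF _ t(2), of "y - x"] by simp
    then have "\<bar>\<theta> y - \<theta> t\<bar> < e / 2" "\<bar>\<theta> x - \<theta> t\<bar> < e / 2" using k t(2) by auto
    then show ?thesis by linarith
  qed
  have "\<bar>\<theta> y - \<theta> x\<bar> \<le> e" if "y - x \<in> Q l" for x y
  proof (cases "x \<in> K \<or> y \<in> K")
    case True
    have "x - y \<in> Q l" using Q_uminus[OF that] by simp
    then show ?thesis using main[of x y] main[of y x] that True by (auto simp: abs_minus_commute)
  next
    case False
    then show ?thesis using out e by simp
  qed
  then show ?thesis by blast
qed

lemma disjoint_cosets_Q: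
  fixes u v :: "'k::ab_group_add vp \<times> 'k vp"
  assumes "z - u \<in> Q n" "z - v \<in> Q n"
  shows "{w. w - u \<in> Q n} = {w. w - v \<in> Q n}"
proof -
  have uv: "u - v \<in> Q n" using Q_diff[OF assms(2,1)] by simp
  have "w - u \<in> Q n \<longleftrightarrow> w - v \<in> Q n" for w
    using Q_add[OF _ uv, of "w - u"] Q_diff[OF _ uv, of "w - v"] by auto
  then show ?thesis by simp
qed

text \<open>The approximation is available at every sufficiently fine level \<open>n\<close>,
  because the \<open>n\<close>-th measure of a sequence will be known only on cosets of
  \<open>Q n\<close>. As \<open>n\<close> is nonnegative, these cosets stay inside
  \<open>Q (- N)\<close>, so the error is supported there.\<close>

lemma step_approximation:
  fixes \<theta> :: "'k::{ab_group_add,finite} vp \<times> 'k vp \<Rightarrow> real"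
  assumes cont: "continuous_on UNIV \<theta>" and cpt: "compact (closure {x. \<theta> x \<noteq> 0})" and e: "e > 0"
    and N: "closure {x. \<theta> x \<noteq> 0} \<subseteq> Q (- int N)"
  shows "\<exists>k :: nat. \<forall>n \<ge> k. (\<exists>C r. finite C \<and> C \<subseteq> (\<lambda>z. {w. w - z \<in> Q (int n)}) ` Q (- int N) \<and>
    (\<forall>x. \<bar>\<theta> x - (\<Sum>c\<in>C. r c * indicator c x)\<bar> \<le> e * indicator (Q (- int N)) x))"
proof -
  have out: "\<theta> x = 0" if "x \<notin> Q (- int N)" for x
    using that N closure_subset[of "{x. \<theta> x \<noteq> 0}"] by blast
  obtain k where k: "\<And>x y. y - x \<in> Q k \<Longrightarrow> \<bar>\<theta> y - \<theta> x\<bar> \<le> e"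
    using uniformly_continuous_compact_support[OF cont cpt e] by blast
  have "\<exists>C r. finite C \<and> C \<subseteq> (\<lambda>z. {w. w - z \<in> Q (int n)}) ` Q (- int N) \<and>
    (\<forall>x. \<bar>\<theta> x - (\<Sum>c\<in>C. r c * indicator c x)\<bar> \<le> e * indicator (Q (- int N)) x)"
    if n: "n \<ge> nat k" for n
  proof -
    let ?c = "\<lambda>z :: 'k vp \<times> 'k vp. {w. w - z \<in> Q (int n)}"
    have "z \<in> ?c z" for z by simp
    then have "Q (- int N) \<subseteq> (\<Union>z\<in>Q (- int N). ?c z)" by blast
    then obtain T where T: "T \<subseteq> Q (- int N)" "finite T" "Q (- int N) \<subseteq> (\<Union>z\<in>T. ?c z)"
      by (rule compactE_image[OF compact_Q open_coset_Q])
    define C where "C = ?c ` T"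
    define r where "r c = \<theta> (SOME z. z \<in> c)" for c
    have approx: "\<bar>\<theta> x - (\<Sum>c\<in>C. r c * indicator c x)\<bar> \<le> e * indicator (Q (- int N)) x" for x
    proof (cases "x \<in> Q (- int N)")
      case True
      then obtain t where t: "t \<in> T" "x - t \<in> Q (int n)" using T(3) by blast
      have uniq: "c = ?c t" if "c \<in> C" "x \<in> c" for c
        using that disjoint_cosets_Q[OF _ t(2)] by (auto simp: C_def)
      have tC: "?c t \<in> C" "finite C" using t T by (auto simp: C_def)
      have "(\<Sum>c\<in>C. r c * indicator c x) = (\<Sum>c\<in>{?c t}. r c * indicator c x)"
        using tC uniq by (intro sum.mono_neutral_right) (auto simp: indicator_def)
      also have "\<dots> = r (?c t)" using t by simp
      finally have sm: "(\<Sum>c\<in>C. r c * indicator c x) = r (?c t)" .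
      define z where "z = (SOME z. z \<in> ?c t)"
      have "z \<in> ?c t" unfolding z_def by (rule someI[of _ t]) simp
      then have "x - z \<in> Q (int n)" using Q_diff[OF t(2), of "z - t"] by simp
      moreover have "Q (int n) \<subseteq> (Q k :: ('k vp \<times> 'k vp) set)" using n by (intro Q_antimono) auto
      ultimately have "\<bar>\<theta> x - \<theta> z\<bar> \<le> e" using k by blast
      then show ?thesis using sm True by (simp add: r_def z_def)
    next
      case False
      have "x \<notin> c" if c: "c \<in> C" for c
      proof
        assume "x \<in> c"
        then obtain t where t: "t \<in> T" "x - t \<in> Q (int n)" using c unfolding C_def by blast
        have "Q (int n) \<subseteq> (Q (- int N) :: ('k vp \<times> 'k vp) set)" by (intro Q_antimono) auto
        then have "(x - t) + t \<in> Q (- int N)" using t T(1) by (intro Q_add) auto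
        then show False using False by simp
      qed
      then show ?thesis using False out by simp
    qed
    show ?thesis
    proof (intro exI conjI allI)
      show "finite C" "C \<subseteq> ?c ` Q (- int N)" using T by (auto simp: C_def)
    qed (rule approx)
  qed
  then show ?thesis by blast
qed

text \<open>The mass is replaced by a bound \<open>B\<close> so that the error is uniform along a
  sequence of measures. With empty \<open>C\<close> this is a plain estimate of the integral by
  supremum times mass.\<close>

lemma integral_step_close:
  fixes \<theta> :: "'k::{ab_group_add,finite} vp \<times> 'k vp \<Rightarrow> real"
  assumes sets: "sets \<mu> = sets borel" and Qfin: "emeasure \<mu> (Q (- int N)) \<le> ennreal B" "0 \<le> B" and e: "e \<ge> 0"
    and \<theta>: "\<theta> \<in> borel_measurable borel"
    and C: "finite C" "C \<subseteq> (\<lambda>z. {w. w - z \<in> Q (int n)}) ` Q (- int N)"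
    and close: "\<And>x. \<bar>\<theta> x - (\<Sum>c\<in>C. r c * indicator c x)\<bar> \<le> e * indicator (Q (- int N)) x"
  shows "\<bar>(\<integral>x. \<theta> x \<partial>\<mu>) - (\<Sum>c\<in>C. r c * measure \<mu> c)\<bar> \<le> e * B"
proof -
  have QN: "emeasure \<mu> (Q (- int N)) < \<infinity>"
    using Qfin by (metis ennreal_less_top infinity_ennreal_def le_less_trans)
  have sub: "c \<subseteq> Q (- int N)" if c: "c \<in> C" for c
  proof
    fix x assume "x \<in> c"
    then obtain z where z: "z \<in> Q (- int N)" "x - z \<in> Q (int n)" using c C(2) by blast
    have "Q (int n) \<subseteq> (Q (- int N) :: ('k vp \<times> 'k vp) set)" by (intro Q_antimono) auto
    then have "(x - z) + z \<in> Q (- int N)" using z by (intro Q_add) auto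
    then show "x \<in> Q (- int N)" by simp
  qed
  have meas: "c \<in> sets \<mu>" if "c \<in> C" for c using that C(2) sets by auto
  have fin: "emeasure \<mu> c < \<infinity>" if "c \<in> C" for c
    using emeasure_mono[OF sub[OF that], of \<mu>] QN sets by (auto intro: le_less_trans)
  define s where "s x = (\<Sum>c\<in>C. r c * indicator c x)" for x
  have s: "integrable \<mu> s" and Is: "(\<integral>x. s x \<partial>\<mu>) = (\<Sum>c\<in>C. r c * measure \<mu> c)"
  proof -
    have i: "integrable \<mu> (\<lambda>x. r c * indicator c x)" if "c \<in> C" for c
      using meas[OF that] fin[OF that] by (intro integrable_mult_right) (simp add: integrable_indicator_iff)
    then show "integrable \<mu> s" unfolding s_def by (intro Bochner_Integration.integrable_sum)
    show "(\<integral>x. s x \<partial>\<mu>) = (\<Sum>c\<in>C. r c * measure \<mu> c)"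
      unfolding s_def using i meas sets_eq_imp_space_eq[OF sets]
      by (subst Bochner_Integration.integral_sum) (auto intro!: sum.cong)
  qed
  have ind: "integrable \<mu> (\<lambda>x. e * indicator (Q (- int N)) x :: real)"
    using QN sets by (intro integrable_mult_right) (simp add: integrable_indicator_iff)
  have \<theta>m: "\<theta> \<in> borel_measurable \<mu>" using \<theta> by (simp add: measurable_cong_sets[OF sets refl])
  have d: "integrable \<mu> (\<lambda>x. \<theta> x - s x)"
  proof (rule Bochner_Integration.integrable_bound[OF ind])
    show "(\<lambda>x. \<theta> x - s x) \<in> borel_measurable \<mu>"
      using \<theta>m borel_measurable_integrable[OF s] by simp
    show "AE x in \<mu>. norm (\<theta> x - s x) \<le> norm (e * indicator (Q (- int N)) x :: real)"
    proof (rule AE_I2)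
      fix x show "norm (\<theta> x - s x) \<le> norm (e * indicator (Q (- int N)) x :: real)"
        using close[of x] e by (simp add: s_def abs_mult)
    qed
  qed
  have "integrable \<mu> (\<lambda>x. (\<theta> x - s x) + s x)" using d s by (rule Bochner_Integration.integrable_add)
  then have \<theta>i: "integrable \<mu> \<theta>" by simp
  have "\<bar>(\<integral>x. \<theta> x \<partial>\<mu>) - (\<Sum>c\<in>C. r c * measure \<mu> c)\<bar> = \<bar>\<integral>x. \<theta> x - s x \<partial>\<mu>\<bar>"
    using \<theta>i s Is by simp
  also have "\<dots> \<le> (\<integral>x. \<bar>\<theta> x - s x\<bar> \<partial>\<mu>)" by (rule integral_abs_bound)
  also have "\<dots> \<le> (\<integral>x. e * indicator (Q (- int N)) x \<partial>\<mu>)"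
    using d ind close by (intro integral_mono) (auto simp: s_def)
  also have "\<dots> = e * measure \<mu> (Q (- int N))"
    using sets_eq_imp_space_eq[OF sets] by simp
  also have "\<dots> \<le> e * B"
    using e Qfin QN by (intro mult_left_mono) (auto simp: measure_def enn2real_leI)
  finally show ?thesis .
qed

text \<open>The index \<open>n\<close> is window and resolution at once: \<open>\<mu> n\<close>
  agrees with \<open>m\<close> on the cosets of \<open>Q n\<close> within \<open>Q (- n)\<close>. A
  fixed test function eventually fits into the window and is resolved up to any prescribed
  error.\<close>

lemma integral_converges:
  fixes \<mu> :: "nat \<Rightarrow> ('k::{ab_group_add,finite} vp \<times> 'k vp) measure"
  assumes sets: "\<And>n. sets (\<mu> n) = sets borel" "sets m = sets borel"
    and bound: "\<And>n N. emeasure (\<mu> n) (Q (- int N)) \<le> ennreal (B N)" "\<And>N. emeasure m (Q (- int N)) \<le> ennreal (B N)"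
      "\<And>N. B N > 0"
    and eq: "\<And>n z. z \<in> Q (- int n) \<Longrightarrow> emeasure (\<mu> n) {w. w - z \<in> Q (int n)} = emeasure m {w. w - z \<in> Q (int n)}"
    and cont: "continuous_on UNIV \<theta>" and cpt: "compact (closure {x. \<theta> x \<noteq> (0 :: real)})"
  shows "(\<lambda>n. \<integral>x. \<theta> x \<partial>\<mu> n) \<longlonglongrightarrow> (\<integral>x. \<theta> x \<partial>m)"
proof (rule LIMSEQ_I)
  fix d :: real assume d: "d > 0"
  have \<theta>: "\<theta> \<in> borel_measurable borel" using cont by (rule borel_measurable_continuous_onI)
  obtain N where N: "closure {x. \<theta> x \<noteq> 0} \<subseteq> Q (- int N)"
    using compact_subset_Q[OF cpt] by blast
  \<comment> \<open>Two replacements by the step function cost \<open>e * B N = d / 4\<close> each,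
    leaving a total of \<open>d / 2\<close>, strictly below \<open>d\<close>.\<close>
  define e where "e = d / (4 * B N)"
  have e: "e > 0" using d bound(3) by (simp add: e_def)
  obtain k where k: "\<And>n. n \<ge> k \<Longrightarrow> \<exists>C r. finite C \<and> C \<subseteq> (\<lambda>z. {w. w - z \<in> Q (int n)}) ` Q (- int N) \<and>
    (\<forall>x. \<bar>\<theta> x - (\<Sum>c\<in>C. r c * indicator c x)\<bar> \<le> e * indicator (Q (- int N)) x)"
    using step_approximation[OF cont cpt e N] by blast
  show "\<exists>no. \<forall>n\<ge>no. norm ((\<integral>x. \<theta> x \<partial>\<mu> n) - (\<integral>x. \<theta> x \<partial>m)) < d"
  proof (intro exI allI impI)
    fix n assume n: "n \<ge> max k N"
    then have "k \<le> n" by simp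
    obtain C r where CC: "finite C \<and> C \<subseteq> (\<lambda>z. {w. w - z \<in> Q (int n)}) ` Q (- int N) \<and>
      (\<forall>x. \<bar>\<theta> x - (\<Sum>c\<in>C. r c * indicator c x)\<bar> \<le> e * indicator (Q (- int N)) x)"
      using k[OF \<open>k \<le> n\<close>] by (elim exE) (rule that)
    note C = CC[THEN conjunct1] CC[THEN conjunct2, THEN conjunct1] CC[THEN conjunct2, THEN conjunct2, THEN spec]
    have 1: "\<bar>(\<integral>x. \<theta> x \<partial>\<mu> n) - (\<Sum>c\<in>C. r c * measure (\<mu> n) c)\<bar> \<le> e * B N"
      using bound(3)[of N] e by (intro integral_step_close[OF sets(1) bound(1) _ _ \<theta> C]) auto
    have 2: "\<bar>(\<integral>x. \<theta> x \<partial>m) - (\<Sum>c\<in>C. r c * measure m c)\<bar> \<le> e * B N"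
      using bound(3)[of N] e by (intro integral_step_close[OF sets(2) bound(2) _ _ \<theta> C]) auto
    have "Q (- int N) \<subseteq> (Q (- int n) :: ('k vp \<times> 'k vp) set)" using n by (intro Q_antimono) auto
    then have "measure (\<mu> n) c = measure m c" if c: "c \<in> C" for c
    proof -
      obtain z where "z \<in> Q (- int N)" "c = {w. w - z \<in> Q (int n)}" using C(2) c by blast
      then show ?thesis using eq[of z n] \<open>Q (- int N) \<subseteq> Q (- int n)\<close> by (auto simp: measure_def)
    qed
    then have "(\<Sum>c\<in>C. r c * measure (\<mu> n) c) = (\<Sum>c\<in>C. r c * measure m c)"
      by (intro sum.cong) auto
    then have "\<bar>(\<integral>x. \<theta> x \<partial>\<mu> n) - (\<integral>x. \<theta> x \<partial>m)\<bar> \<le> 2 * (e * B N)"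
      using 1 2 by linarith
    also have "\<dots> = d / 2" using bound(3)[of N] by (simp add: e_def)
    also have "\<dots> < d" using d by simp
    finally show "norm ((\<integral>x. \<theta> x \<partial>\<mu> n) - (\<integral>x. \<theta> x \<partial>m)) < d" by simp
  qed
qed

section \<open>Polyhomomorphisms\<close>

text \<open>The measures \<open>\<rho>\<close> live on different spaces \<open>R\<close>. The image
  under the identity moves all of them, and the zero element, to the Borel sets of the whole square,
  where their masses can be compared.\<close>

definition polyhom_measure :: "('k::{ab_group_add,finite} vp) polyhom \<Rightarrow> ('k vp \<times> 'k vp) measure" where
  "polyhom_measure P = (case P of Zero \<Rightarrow> null_measure borel | Pair_polyhom R \<rho> \<Rightarrow> distr \<rho> borel (\<lambda>z. z))"

lemma sets_polyhom_measure [simp]: "sets (polyhom_measure P) = sets borel"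
  by (cases P) (simp_all add: polyhom_measure_def)

lemma
  fixes \<rho> :: "('k::{ab_group_add,finite} vp \<times> 'k vp) measure"
  assumes R: "closed R" and sets: "sets \<rho> = sets (restrict_space borel R)"
  shows sets_subgroup_measure: "A \<in> sets \<rho> \<longleftrightarrow> A \<subseteq> R \<and> A \<in> sets borel"
    and measurable_subgroup_measure: "f \<in> borel_measurable borel \<Longrightarrow> f \<in> borel_measurable \<rho>"
    and emeasure_subgroup_measure: "A \<in> sets borel \<Longrightarrow> emeasure (distr \<rho> borel (\<lambda>z. z)) A = emeasure \<rho> (A \<inter> R)"
proof -
  have Rb: "R \<in> sets borel" using R by simp
  show "A \<in> sets \<rho> \<longleftrightarrow> A \<subseteq> R \<and> A \<in> sets borel"
    unfolding sets using Rb by (subst sets_restrict_space_iff) auto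
  have m: "f \<in> borel_measurable \<rho>" if "f \<in> borel_measurable borel" for f :: "'k vp \<times> 'k vp \<Rightarrow> 'c::topological_space"
    using measurable_restrict_space1[OF that, of R] by (simp add: measurable_cong_sets[OF sets refl])
  show "f \<in> borel_measurable borel \<Longrightarrow> f \<in> borel_measurable \<rho>" by (rule m)
  have sp: "space \<rho> = R"
    using sets_eq_imp_space_eq[OF sets] by (simp add: space_restrict_space)
  show "emeasure (distr \<rho> borel (\<lambda>z. z)) A = emeasure \<rho> (A \<inter> R)" if "A \<in> sets borel"
    using emeasure_distr[OF m that, of "\<lambda>z. z"] by (simp add: sp)
qed

lemma translate_Int:
  assumes "add_subgroup R" "h \<in> R"
  shows "((+) h ` A) \<inter> R = (+) h ` (A \<inter> R)"
proof
  have m: "- h \<in> R" using assms by (simp add: add_subgroup_def)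
  show "((+) h ` A) \<inter> R \<subseteq> (+) h ` (A \<inter> R)"
  proof
    fix z assume "z \<in> ((+) h ` A) \<inter> R"
    then obtain a where a: "a \<in> A" "z = h + a" "h + a \<in> R" by blast
    then have "- h + (h + a) \<in> R" using assms(1) m unfolding add_subgroup_def by blast
    then have "a \<in> R" by (simp add: add.assoc[symmetric])
    then show "z \<in> (+) h ` (A \<inter> R)" using a by blast
  qed
  show "(+) h ` (A \<inter> R) \<subseteq> ((+) h ` A) \<inter> R"
    using assms unfolding add_subgroup_def by blast
qed

context vp_haar
begin

text \<open>The locale does not list finiteness on compact sets. It follows from domination: a
  compact set lies in some \<open>Q (- n)\<close>, whose mass is bounded by that of
  \<open>W (- n)\<close>.\<close>

lemma Pair_polyhom_in_Polh_iff:
  "Pair_polyhom R \<rho> \<in> Polh \<phi> \<longleftrightarrow>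
    sets \<rho> = sets (restrict_space borel R) \<and> vp_relation \<phi> p R (distr \<rho> borel (\<lambda>z. z))"
proof
  assume "Pair_polyhom R \<rho> \<in> Polh \<phi>"
  then have P: "closed R" "add_subgroup R" "haar_measure_on R \<rho>"
    "\<And>A. A \<in> sets borel \<Longrightarrow> emeasure \<rho> (R \<inter> (A \<times> UNIV)) \<le> emeasure \<phi> A"
    "\<And>A. A \<in> sets borel \<Longrightarrow> emeasure \<rho> (R \<inter> (UNIV \<times> A)) \<le> emeasure \<phi> A"
    by (auto simp: Polh_def)
  have sets: "sets \<rho> = sets (restrict_space borel R)" and nz: "emeasure \<rho> R \<noteq> 0"
    and inv: "\<And>h A. h \<in> R \<Longrightarrow> A \<in> sets \<rho> \<Longrightarrow> emeasure \<rho> ((+) h ` A) = emeasure \<rho> A"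
    using P(3) by (auto simp: haar_measure_on_def)
  note em = emeasure_subgroup_measure[OF P(1) sets]
  have "vp_relation \<phi> p R (distr \<rho> borel (\<lambda>z. z))"
  proof
    show "emeasure (distr \<rho> borel (\<lambda>z. z)) A = 0" if "A \<in> sets borel" "A \<inter> R = {}" for A
      using that by (simp add: em)
    show "emeasure (distr \<rho> borel (\<lambda>z. z)) ((+) h ` A) = emeasure (distr \<rho> borel (\<lambda>z. z)) A"
      if h: "h \<in> R" and A: "A \<in> sets borel" for h A
    proof -
      have "A \<inter> R \<in> sets \<rho>" using A P(1) by (auto simp: sets_subgroup_measure[OF P(1) sets])
      then show ?thesis
        using A inv[OF h] by (simp add: em borel_translate translate_Int[OF P(2) h])
    qed
    show "emeasure (distr \<rho> borel (\<lambda>z. z)) (A \<times> UNIV) \<le> emeasure \<phi> A" if "A \<in> sets borel" for A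
      using that P(4)[OF that] by (simp add: em borel_Times Int_commute)
    show "emeasure (distr \<rho> borel (\<lambda>z. z)) (UNIV \<times> A) \<le> emeasure \<phi> A" if "A \<in> sets borel" for A
      using that P(5)[OF that] by (simp add: em borel_Times Int_commute)
    show "emeasure (distr \<rho> borel (\<lambda>z. z)) UNIV \<noteq> 0" using nz by (simp add: em)
  qed (use P in simp_all)
  with sets show "sets \<rho> = sets (restrict_space borel R) \<and> vp_relation \<phi> p R (distr \<rho> borel (\<lambda>z. z))" by simp
next
  assume "sets \<rho> = sets (restrict_space borel R) \<and> vp_relation \<phi> p R (distr \<rho> borel (\<lambda>z. z))"
  then have sets: "sets \<rho> = sets (restrict_space borel R)" and "vp_relation \<phi> p R (distr \<rho> borel (\<lambda>z. z))"
    by auto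
  then interpret vp_relation \<phi> p R "distr \<rho> borel (\<lambda>z. z)" by simp
  note em = emeasure_subgroup_measure[OF closed_R sets] and st = sets_subgroup_measure[OF closed_R sets]
  have em': "emeasure \<rho> A = emeasure (distr \<rho> borel (\<lambda>z. z)) A" if "A \<in> sets \<rho>" for A
    using that em[of A] by (auto simp: st Int_absorb2)
  have "haar_measure_on R \<rho>"
    unfolding haar_measure_on_def
  proof (intro conjI allI impI ballI)
    show "sets \<rho> = sets (restrict_space borel R)" by (rule sets)
    show "emeasure \<rho> R \<noteq> 0" using nontriv em[of UNIV] by simp
    show "emeasure \<rho> K < \<infinity>" if K: "K \<subseteq> R \<and> compact K" for K
    proof -
      obtain n :: nat where n: "K \<subseteq> Q (- int n)" using compact_subset_Q K by blast
      have Ks: "K \<in> sets \<rho>" using K by (auto simp: st borel_compact)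
      have "emeasure \<rho> K \<le> emeasure (distr \<rho> borel (\<lambda>z. z)) (Q (- int n))"
        unfolding em'[OF Ks] using n by (intro emeasure_mono) auto
      also have "\<dots> < \<infinity>" unfolding Q_def by (rule emeasure_less_infinity)
      finally show ?thesis .
    qed
    show "emeasure \<rho> ((+) h ` A) = emeasure \<rho> A" if h: "h \<in> R" and A: "A \<in> sets \<rho>" for h A
    proof -
      have "(+) h ` A \<in> sets \<rho>"
        using A borel_translate R_add[OF h] unfolding st by blast
      then show ?thesis using A inv[OF h, of A] by (simp add: em' st)
    qed
  qed
  moreover have "emeasure \<rho> (R \<inter> (A \<times> UNIV)) \<le> emeasure \<phi> A" if "A \<in> sets borel" for A
    using fst_le[OF that] em[of "A \<times> UNIV"] that by (simp add: borel_Times Int_commute)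
  moreover have "emeasure \<rho> (R \<inter> (UNIV \<times> A)) \<le> emeasure \<phi> A" if "A \<in> sets borel" for A
    using snd_le[OF that] em[of "UNIV \<times> A"] that by (simp add: borel_Times Int_commute)
  ultimately show "Pair_polyhom R \<rho> \<in> Polh \<phi>"
    using closed_R subgroup_R by (auto simp: Polh_def)
qed

lemma polyhom_integral_eq:
  assumes "P \<in> Polh \<phi>" "continuous_on UNIV \<theta>"
  shows "polyhom_integral P \<theta> = (\<integral>z. \<theta> z \<partial>polyhom_measure P)"
proof (cases P)
  case Zero
  then show ?thesis by (simp add: polyhom_measure_def integral_null_measure)
next
  case (Pair_polyhom R \<rho>)
  then have sets: "sets \<rho> = sets (restrict_space borel R)" and "vp_relation \<phi> p R (distr \<rho> borel (\<lambda>z. z))"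
    using assms(1) Pair_polyhom_in_Polh_iff by auto
  then interpret vp_relation \<phi> p R "distr \<rho> borel (\<lambda>z. z)" by simp
  have "(\<lambda>z. z) \<in> borel_measurable \<rho>"
    by (rule measurable_subgroup_measure[OF closed_R sets]) simp
  then show ?thesis
    using integral_distr[of "\<lambda>z. z" \<rho> borel \<theta>] borel_measurable_continuous_onI[OF assms(2)]
    by (simp add: Pair_polyhom polyhom_measure_def)
qed

text \<open>The bound \<open>a \<le> 1\<close> turns an integer exponent into the negative of a
  natural number, so later arguments can use all integer powers.\<close>

lemma inverse_in_Lambda:
  assumes "0 < a" "a \<le> 1"
  shows "inverse a \<in> {real p ^ j | j :: nat. True} \<longleftrightarrow> (\<exists>i. a = real p powi i)"
proof
  assume "inverse a \<in> {real p ^ j | j :: nat. True}"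
  then obtain j :: nat where "inverse a = real p ^ j" by blast
  then have "a = real p powi (- int j)" using p_gt_1
    by (simp add: power_int_minus) (metis inverse_inverse_eq)
  then show "\<exists>i. a = real p powi i" ..
next
  assume "\<exists>i. a = real p powi i"
  then obtain i where i: "a = real p powi i" ..
  have "i \<le> 0"
  proof (rule ccontr)
    assume "\<not> i \<le> 0"
    then have "real p powi i > 1"
      using one_less_power[OF p_gt_1, of "nat i"] by (simp add: power_int_def)
    then show False using assms i by simp
  qed
  then have "inverse a = real p ^ nat (- i)"
    by (simp add: i power_int_def power_inverse)
  then show "inverse a \<in> {real p ^ j | j :: nat. True}" by blast
qed

end

context vp_relation
begin

lemma alpha_eq_iff:
  assumes "\<And>A. A \<in> sets borel \<Longrightarrow> emeasure (distr \<rho> borel fst) A = emeasure m (A \<times> UNIV)"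
  shows "inverse (alpha \<phi> R \<rho>) \<in> {real p ^ j | j :: nat. True} \<longleftrightarrow> p_power (emeasure m (Q 0))"
proof -
  have "alpha \<phi> R \<rho> = (THE a. is_alpha a)"
    using assms by (auto simp: alpha_def is_alpha_def intro!: arg_cong[of _ _ The])
  then have "is_alpha (alpha \<phi> R \<rho>)"
    using theI'[OF ex1_alpha] by simp
  then show ?thesis
    using p_power_alpha inverse_in_Lambda by (auto simp: is_alpha_def)
qed

end

context vp_haar
begin

text \<open>The condition on \<alpha> and the condition on \<beta> are equivalent: each says that
  the mass of \<open>Q 0\<close> is a power of \<open>p\<close>, and the swap preserves
  \<open>Q 0\<close>.\<close>

lemma Polh_restricted_iff:
  assumes P: "Pair_polyhom R \<rho> \<in> Polh \<phi>"
  shows "Pair_polyhom R \<rho> \<in> Polh_restricted \<phi> {real p ^ j | j :: nat. True} \<longleftrightarrow>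
    p_power (emeasure (distr \<rho> borel (\<lambda>z. z)) (Q 0))"
proof -
  define m where "m = distr \<rho> borel (\<lambda>z. z)"
  have sets: "sets \<rho> = sets (restrict_space borel R)" and rel: "vp_relation \<phi> p R m"
    using P Pair_polyhom_in_Polh_iff by (auto simp: m_def)
  interpret vp_relation \<phi> p R m by (rule rel)
  interpret sw: vp_relation \<phi> p "R\<inverse>" "distr m borel prod.swap" by (rule swap)
  have fst: "(fst :: 'k vp \<times> 'k vp \<Rightarrow> _) \<in> borel_measurable borel" and snd: "(snd :: 'k vp \<times> 'k vp \<Rightarrow> _) \<in> borel_measurable borel"
    by (intro borel_measurable_continuous_onI continuous_intros)+
  note meas = measurable_subgroup_measure[OF closed_R sets]
  have sp: "space \<rho> = R"
    using sets_eq_imp_space_eq[OF sets] by (simp add: space_restrict_space)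
  have 1: "emeasure (distr \<rho> borel fst) A = emeasure m (A \<times> UNIV)" if A: "A \<in> sets borel" for A
  proof -
    have "fst -` A \<inter> R = A \<times> UNIV \<inter> R" by auto
    then show ?thesis
      using emeasure_distr[OF meas[OF fst] A] A
      by (simp add: sp m_def emeasure_subgroup_measure[OF closed_R sets] borel_Times)
  qed
  have 2: "emeasure (distr \<rho> borel snd) A = emeasure m (UNIV \<times> A)" if A: "A \<in> sets borel" for A
  proof -
    have "snd -` A \<inter> R = UNIV \<times> A \<inter> R" by auto
    then show ?thesis
      using emeasure_distr[OF meas[OF snd] A] A
      by (simp add: sp m_def emeasure_subgroup_measure[OF closed_R sets] borel_Times)
  qed
  have sw: "emeasure (distr m borel prod.swap) (A \<times> B) = emeasure m (B \<times> A)"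
    if "A \<in> sets borel" "B \<in> sets borel" for A B
  proof -
    have "prod.swap -` (A \<times> B) = B \<times> A" by auto
    then show ?thesis using emeasure_swap[of "A \<times> B"] that by (simp add: borel_Times)
  qed
  have "beta \<phi> R \<rho> = (THE b. sw.is_alpha b)"
    using 2 sw by (auto simp: beta_def sw.is_alpha_def intro!: arg_cong[of _ _ The])
  then have "sw.is_alpha (beta \<phi> R \<rho>)"
    using theI'[OF sw.ex1_alpha] by simp
  then have b: "inverse (beta \<phi> R \<rho>) \<in> {real p ^ j | j :: nat. True} \<longleftrightarrow> p_power (emeasure m (Q 0))"
    using sw.p_power_alpha inverse_in_Lambda sw[of "W 0" "W 0"] by (auto simp: sw.is_alpha_def Q_def)
  show ?thesis
    using P alpha_eq_iff[OF 1] b by (auto simp: Polh_restricted_def m_def)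
qed

end

section \<open>Graphs of operators\<close>

lemma continuous_linear_fixing_W:
  fixes g :: "'k::field vp \<Rightarrow> 'k vp"
  assumes add: "\<And>x y. g (x + y) = g x + g y" and id: "\<And>x. x \<in> W n \<Longrightarrow> g x = x"
  shows "continuous_on UNIV g"
proof -
  have "open (g -` B)" if B: "open B" for B
    unfolding open_vp_def
  proof
    fix v assume "v \<in> g -` B"
    then obtain m where m: "\<And>w. w \<in> W m \<Longrightarrow> g v + w \<in> B"
      using B unfolding open_vp_def vimage_def by blast
    have "v + w \<in> g -` B" if w: "w \<in> W (max m n)" for w
    proof -
      have "w \<in> W m" "w \<in> W n" using w W_antimono[of m "max m n"] W_antimono[of n "max m n"] by auto
      then show ?thesis using m id by (simp add: add)
    qed
    then show "\<exists>m. \<forall>w\<in>W m. v + w \<in> g -` B" by blast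
  qed
  then show ?thesis by (simp add: continuous_on_open_vimage)
qed

context vp_haar
begin

lemma GL0_I:
  assumes g: "Vector_Spaces.linear vp_scale vp_scale g" "bij g" and id: "\<And>x. x \<in> W n \<Longrightarrow> g x = x"
  shows "g \<in> GL0 \<phi>"
proof -
  interpret g: Vector_Spaces.linear vp_scale vp_scale g by fact
  have inv_g: "g (inv g x) = x" "inv g (g x) = x" for x
    using g(2) by (simp_all add: bij_is_surj surj_f_inv_f bij_is_inj)
  have add': "inv g (x + y) = inv g x + inv g y" for x y
    by (metis inv_g g.add)
  have id': "inv g x = x" if "x \<in> W n" for x
    using id[OF that] inv_g by metis
  have cont: "continuous_on UNIV g" "continuous_on UNIV (inv g)"
    by (rule continuous_linear_fixing_W[OF g.add id] continuous_linear_fixing_W[OF add' id']; assumption)+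
  have gm: "g \<in> borel_measurable \<phi>"
    using borel_measurable_continuous_onI[OF cont(1)] by (simp add: measurable_cong_sets[OF sets_phi refl])
  then have gm': "g \<in> measurable \<phi> \<phi>" by (simp add: measurable_cong_sets[OF refl sets_phi])
  have "distr \<phi> \<phi> g = \<phi>"
  proof (rule measure_eqI_cosets[of _ _ n])
    show eq: "emeasure (distr \<phi> \<phi> g) {w. w - v \<in> W l} = emeasure \<phi> {w. w - v \<in> W l}" if l: "l \<ge> n" for v l
    proof -
      \<comment> \<open>Both \<open>g\<close> and its inverse are the identity on
        \<open>W n\<close>, which contains \<open>W l\<close>. Hence the preimage of a coset of
        \<open>W l\<close> is again a coset of \<open>W l\<close>.\<close>
      have gW: "g x \<in> W l \<longleftrightarrow> x \<in> W l" for x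
      proof
        assume "g x \<in> W l"
        moreover have "g x \<in> W n" using \<open>g x \<in> W l\<close> W_antimono[OF l] by blast
        then have "inv g (g x) = g x" by (rule id')
        ultimately show "x \<in> W l" using inv_g by simp
      next
        assume x: "x \<in> W l"
        then have "x \<in> W n" using W_antimono[OF l] by blast
        then show "g x \<in> W l" using x id by simp
      qed
      have "g -` {w. w - v \<in> W l} = {w. w - inv g v \<in> W l}"
        using gW[of "_ - inv g v"] by (auto simp: g.diff inv_g)
      then show ?thesis
        using emeasure_distr[OF gm', of "{w. w - v \<in> W l}"] by (simp add: phi_coset)
    qed
    show "emeasure (distr \<phi> \<phi> g) {w. w - v \<in> W n} \<noteq> \<infinity>" for v
      unfolding eq[OF order_refl] using phi_W_finite[of n] by (simp add: phi_coset)
  qed simp_all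
  then show ?thesis using g cont by (simp add: GL0_def GL_def)
qed

definition graph_measure :: "('k vp \<Rightarrow> 'k vp) \<Rightarrow> ('k vp \<times> 'k vp) measure" where
  "graph_measure g = distr \<phi> borel (\<lambda>v. (v, g v))"

lemma
  assumes "g \<in> GL0 \<phi>"
  shows emeasure_graph_measure: "A \<in> sets borel \<Longrightarrow> emeasure (graph_measure g) A = emeasure \<phi> {v. (v, g v) \<in> A}"
    and graph_relation: "vp_relation \<phi> p (graph g) (graph_measure g)"
    and graph_measure_eq: "distr (distr \<phi> (restrict_space borel (graph g)) (\<lambda>v. (v, g v))) borel (\<lambda>z. z) = graph_measure g"
proof -
  have lin: "Vector_Spaces.linear vp_scale vp_scale g" and bij: "bij g" and cont: "continuous_on UNIV g" and pres: "distr \<phi> \<phi> g = \<phi>"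
    using assms by (auto simp: GL0_def GL_def)
  interpret g: Vector_Spaces.linear vp_scale vp_scale g by fact
  have gm: "g \<in> borel_measurable \<phi>"
    using borel_measurable_continuous_onI[OF cont] by (simp add: measurable_cong_sets[OF sets_phi refl])
  then have gm': "g \<in> measurable \<phi> \<phi>" by (simp add: measurable_cong_sets[OF refl sets_phi])
  have "continuous_on UNIV (\<lambda>v. (v, g v))" by (intro continuous_intros cont)
  then have m: "(\<lambda>v. (v, g v)) \<in> borel_measurable \<phi>"
    using borel_measurable_continuous_onI by (simp add: measurable_cong_sets[OF sets_phi refl])
  show em: "emeasure (graph_measure g) A = emeasure \<phi> {v. (v, g v) \<in> A}" if "A \<in> sets borel" for A
    unfolding graph_measure_def using emeasure_distr[OF m that] by (simp add: vimage_def)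
  have in_graph: "z \<in> graph g \<longleftrightarrow> snd z = g (fst z)" for z
    by (cases z) (auto simp: graph_def)
  have closed: "closed (graph g)"
  proof -
    have "continuous_on UNIV (\<lambda>z :: 'k vp \<times> 'k vp. g (fst z))"
      by (rule continuous_on_compose2[OF cont]) (auto intro: continuous_intros)
    then have "closed {z :: 'k vp \<times> 'k vp. snd z = g (fst z)}"
      by (intro closed_Collect_eq continuous_intros)
    then show ?thesis by (simp add: in_graph[symmetric])
  qed
  show "vp_relation \<phi> p (graph g) (graph_measure g)"
  proof
    show "closed (graph g)" by (rule closed)
    show "add_subgroup (graph g)"
      by (auto simp: add_subgroup_def in_graph g.add g.neg)
    show "sets (graph_measure g) = sets borel" by (simp add: graph_measure_def)
    show "emeasure (graph_measure g) A = 0" if A: "A \<in> sets borel" "A \<inter> graph g = {}" for A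
    proof -
      have "{v. (v, g v) \<in> A} = {}" using A(2) by (auto simp: graph_def)
      then show ?thesis using em[OF A(1)] by simp
    qed
    show "emeasure (graph_measure g) ((+) h ` A) = emeasure (graph_measure g) A"
      if h: "h \<in> graph g" and A: "A \<in> sets borel" for h A
    proof -
      have "{v. (v, g v) \<in> (+) h ` A} = (+) (fst h) ` {v. (v, g v) \<in> A}"
      proof (intro set_eqI iffI)
        fix v assume "v \<in> {v. (v, g v) \<in> (+) h ` A}"
        then obtain a where a: "a \<in> A" "(v, g v) = h + a" by auto
        have "v = fst h + fst a" using arg_cong[OF a(2), of fst] by simp
        moreover have "g v = g (fst h) + snd a" using arg_cong[OF a(2), of snd] h by (simp add: in_graph)
        ultimately have "a = (v - fst h, g (v - fst h))"
          by (simp add: prod_eq_iff g.add)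
        then have "v - fst h \<in> {v. (v, g v) \<in> A}" using a by simp
        then show "v \<in> (+) (fst h) ` {v. (v, g v) \<in> A}" by (rule rev_image_eqI) simp
      next
        fix v assume "v \<in> (+) (fst h) ` {v. (v, g v) \<in> A}"
        then obtain a where a: "(a, g a) \<in> A" "v = fst h + a" by auto
        then have "(v, g v) = h + (a, g a)"
          using h by (cases h) (auto simp: in_graph g.add)
        then show "v \<in> {v. (v, g v) \<in> (+) h ` A}" using a by auto
      qed
      moreover have "{v. (v, g v) \<in> A} \<in> sets borel"
        using measurable_sets[OF m A] by (simp add: vimage_def)
      ultimately show ?thesis using A by (simp add: em borel_translate phi_translate)
    qed
    show "emeasure (graph_measure g) (A \<times> UNIV) \<le> emeasure \<phi> A" if "A \<in> sets borel" for A
      using that by (simp add: em borel_Times)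
    \<comment> \<open>Here preservation of the Haar measure enters: the second marginal of the graph
      measure is the image of \<open>\<phi>\<close> under \<open>g\<close>.\<close>
    show "emeasure (graph_measure g) (UNIV \<times> A) \<le> emeasure \<phi> A" if A: "A \<in> sets borel" for A
    proof -
      have "emeasure \<phi> A = emeasure (distr \<phi> \<phi> g) A" using pres by simp
      also have "\<dots> = emeasure \<phi> {v. g v \<in> A}"
        using emeasure_distr[OF gm', of A] A by (simp add: vimage_def)
      finally show ?thesis using A by (simp add: em borel_Times)
    qed
    show "emeasure (graph_measure g) UNIV \<noteq> 0"
    proof -
      have "emeasure \<phi> (W 0) \<le> emeasure \<phi> UNIV" by (intro emeasure_mono) auto
      then show ?thesis using W0 by (auto simp: em)
    qed
  qed
  have "(\<lambda>v. (v, g v)) \<in> measurable \<phi> (restrict_space borel (graph g))"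
    using m by (intro measurable_restrict_space2) (auto simp: in_graph)
  moreover have "(\<lambda>z. z) \<in> measurable (restrict_space borel (graph g)) borel"
    by (intro measurable_restrict_space1) simp
  ultimately show "distr (distr \<phi> (restrict_space borel (graph g)) (\<lambda>v. (v, g v))) borel (\<lambda>z. z) = graph_measure g"
    by (simp add: distr_distr graph_measure_def comp_def)
qed

lemma polyhom_measure_graph: "g \<in> GL0 \<phi> \<Longrightarrow> polyhom_measure (graph_polyhom \<phi> g) = graph_measure g"
  by (simp add: polyhom_measure_def graph_polyhom_def graph_measure_eq)

lemma graph_polyhom_in_Polh: "g \<in> GL0 \<phi> \<Longrightarrow> graph_polyhom \<phi> g \<in> Polh \<phi>"
  by (simp add: graph_polyhom_def Pair_polyhom_in_Polh_iff graph_measure_eq graph_relation)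

lemma graph_polyhom_in_restricted:
  assumes g: "g \<in> GL0 \<phi>"
  shows "graph_polyhom \<phi> g \<in> Polh_restricted \<phi> {real p ^ j | j :: nat. True}"
proof -
  interpret vp_relation \<phi> p "graph g" "graph_measure g" by (rule graph_relation[OF g])
  have "Domain (graph g) = UNIV" by (auto simp: graph_def)
  then have "is_alpha 1"
    using emeasure_graph_measure[OF g] by (simp add: is_alpha_def borel_Times)
  moreover have "1 = real p powi 0" by simp
  ultimately have "p_power (emeasure (graph_measure g) (Q 0))"
    using p_power_alpha by blast
  then show ?thesis
    using graph_polyhom_in_Polh[OF g] Polh_restricted_iff graph_measure_eq[OF g]
    by (simp add: graph_polyhom_def)
qed

lemma emeasure_polyhom_measure_le:
  assumes "P \<in> Polh \<phi>" shows "emeasure (polyhom_measure P) (Q n) \<le> emeasure \<phi> (W n)"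
proof (cases P)
  case Zero
  then show ?thesis by (simp add: polyhom_measure_def)
next
  case (Pair_polyhom R \<rho>)
  then interpret vp_relation \<phi> p R "distr \<rho> borel (\<lambda>z. z)"
    using assms Pair_polyhom_in_Polh_iff by simp
  show ?thesis using emeasure_Q_le Pair_polyhom by (simp add: polyhom_measure_def)
qed

lemma polyhom_convergesI:
  assumes X: "\<And>n. X n \<in> Polh \<phi>" and P: "P \<in> Polh \<phi>"
    and eq: "\<And>n z. z \<in> Q (- int n) \<Longrightarrow>
      emeasure (polyhom_measure (X n)) {w. w - z \<in> Q (int n)} = emeasure (polyhom_measure P) {w. w - z \<in> Q (int n)}"
  shows "polyhom_converges X P"
  unfolding polyhom_converges_def
proof (intro allI impI, elim conjE)
  fix \<theta> :: "'k vp \<times> 'k vp \<Rightarrow> real"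
  assume cont: "continuous_on UNIV \<theta>" and cpt: "compact (closure {x. \<theta> x \<noteq> 0})"
  have "(\<lambda>n. \<integral>x. \<theta> x \<partial>polyhom_measure (X n)) \<longlonglongrightarrow> (\<integral>x. \<theta> x \<partial>polyhom_measure P)"
  proof (rule integral_converges[OF _ _ _ _ _ eq cont cpt])
    \<comment> \<open>Domination bounds the mass of each window by \<open>p^N\<close>, uniformly
      over all polyhomomorphisms.\<close>
    show "emeasure (polyhom_measure (X n)) (Q (- int N)) \<le> ennreal (real p powi int N)"
      "emeasure (polyhom_measure P) (Q (- int N)) \<le> ennreal (real p powi int N)" for n N
      using emeasure_polyhom_measure_le[OF X, of n "- int N"] emeasure_polyhom_measure_le[OF P, of "- int N"]
      by (simp_all add: phi_W)
    show "real p powi int N > 0" for N using p_gt_1 by simp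
  qed simp_all
  then show "(\<lambda>j. polyhom_integral (X j) \<theta>) \<longlonglongrightarrow> polyhom_integral P \<theta>"
    using polyhom_integral_eq[OF X cont] polyhom_integral_eq[OF P cont] by simp
qed

text \<open>The indicator function of \<open>Q 0\<close> is a test function.\<close>

lemma polyhom_converges_emeasure_Q:
  assumes X: "\<And>n. X n \<in> Polh \<phi>" and P: "P \<in> Polh \<phi>" and conv: "polyhom_converges X P"
  shows "(\<lambda>n. measure (polyhom_measure (X n)) (Q 0)) \<longlonglongrightarrow> measure (polyhom_measure P) (Q 0)"
proof -
  let ?\<theta> = "indicator (Q 0) :: 'k vp \<times> 'k vp \<Rightarrow> real"
  have cont: "continuous_on UNIV ?\<theta>"
  proof -
    have "open (?\<theta> -` B)" for B
    proof -
      have "?\<theta> -` B = (if 1 \<in> B then Q 0 else {}) \<union> (if 0 \<in> B then - Q 0 else {})"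
      proof (rule set_eqI)
        show "z \<in> ?\<theta> -` B \<longleftrightarrow> z \<in> (if 1 \<in> B then Q 0 else {}) \<union> (if 0 \<in> B then - Q 0 else {})" for z
          by (cases "z \<in> Q 0") simp_all
      qed
      then show ?thesis by (simp add: open_Q open_Un open_Compl[OF closed_Q])
    qed
    then show ?thesis by (simp add: continuous_on_open_vimage)
  qed
  have "{x. ?\<theta> x \<noteq> 0} = Q 0" by (auto simp: indicator_def)
  then have "compact (closure {x. ?\<theta> x \<noteq> 0})" by (simp add: closure_closed[OF closed_Q] compact_Q)
  with conv cont have "(\<lambda>n. polyhom_integral (X n) ?\<theta>) \<longlonglongrightarrow> polyhom_integral P ?\<theta>"
    unfolding polyhom_converges_def by blast
  moreover have "polyhom_integral P ?\<theta> = measure (polyhom_measure P) (Q 0)" if "P \<in> Polh \<phi>" for P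
    using polyhom_integral_eq[OF that cont] sets_eq_imp_space_eq[OF sets_polyhom_measure[of P]] by simp
  ultimately show ?thesis using X P by simp
qed

end

section \<open>Approximation by graphs and closedness\<close>

context vp_haar
begin

text \<open>The dimension of \<open>W b / W a\<close> is obtained by comparing Haar masses: their
  ratio is the index, which is \<open>p\<close> to the dimension.\<close>

lemma card_basis_W:
  assumes ab: "b \<le> a" and span: "vp.span bA = (W a :: 'k vp set)" "vp.span bB = W b"
    and sub: "bA \<subseteq> bB" and ind: "vp.independent bB"
  shows "finite (bB - bA) \<and> card (bB - bA) = nat (a - b)"
proof -
  note * = emeasure_span_cosets[OF sets_phi _ sub ind, of a, unfolded span, OF order_refl phi_coset phi_W_finite]
  have f: "finite (bB - bA)" and eq: "emeasure \<phi> (W b) = of_nat (CARD('k) ^ card (bB - bA)) * emeasure \<phi> (W a)"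
    using * phi_W_pos[of a] by auto
  have "ennreal (real p powi (- b)) = ennreal (real p ^ card (bB - bA) * real p powi (- a))"
    using eq p_gt_1 by (simp add: phi_W card_k ennreal_of_nat_eq_real_of_nat ennreal_mult)
  then have "real p powi (- b) = real p ^ card (bB - bA) * real p powi (- a)"
    using p_gt_1 by (subst (asm) ennreal_inj) auto
  then have "real p ^ card (bB - bA) = real p powi (a - b)"
    using p_gt_1 by (simp add: power_int_diff power_int_minus field_simps)
  also have "\<dots> = real p ^ nat (a - b)" using ab by (simp add: power_int_def)
  finally have "card (bB - bA) = nat (a - b)" using p_gt_1 by (simp add: power_inject_exp)
  with f show ?thesis by simp
qed

text \<open>Finitely many further vectors would lie in one \<open>W (- N)\<close> and make it the
  whole space, although \<open>W (- N - 1)\<close> has larger mass. Distinct vectors beyond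
  \<open>b\<close> lie in distinct cosets of \<open>W n\<close>, of which there are only countably
  many.\<close>

lemma basis_above_W:
  assumes b': "vp.independent b'" "b \<subseteq> b'" and span: "vp.span b = (W n :: 'k vp set)" "vp.span b' = UNIV"
  shows "infinite (b' - b) \<and> countable (b' - b)"
proof
  show "infinite (b' - b)"
  proof
    assume fin: "finite (b' - b)"
    obtain f :: "'k vp \<Rightarrow> nat" where f: "\<And>v. v \<in> W (- int (f v))" using in_some_W by metis
    define N where "N = Max (insert (nat (- n)) (f ` (b' - b)))"
    have "b' \<subseteq> W (- int N)"
    proof
      fix v assume v: "v \<in> b'"
      show "v \<in> W (- int N)"
      proof (cases "v \<in> b")
        case True
        then have "v \<in> W n" using span(1) vp.span_base by blast
        moreover have "nat (- n) \<le> N" unfolding N_def using fin by (intro Max_ge) auto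
        then have "W n \<subseteq> (W (- int N) :: 'k vp set)" by (intro W_antimono) linarith
        ultimately show ?thesis by blast
      next
        case False
        then have "f v \<le> N" unfolding N_def using fin v by (intro Max_ge) auto
        then have "W (- int (f v)) \<subseteq> (W (- int N) :: 'k vp set)" by (intro W_antimono) simp
        then show ?thesis using f by blast
      qed
    qed
    then have "UNIV \<subseteq> (W (- int N) :: 'k vp set)"
      using vp.span_minimal[OF _ subspace_W] span(2) by metis
    then have "emeasure \<phi> (W (- int N - 1)) \<le> emeasure \<phi> (W (- int N))"
      by (intro emeasure_mono) auto
    then have "real p powi (int N + 1) \<le> real p powi int N"
      using p_gt_1 by (simp add: phi_W) (metis add.commute)
    then show False
      using p_powi_Suc[of "int N"] p_gt_1 by (simp add: power_int_def)
  qed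
  have "inj_on (\<lambda>v. {w. w - v \<in> W n}) (b' - b)"
  proof (rule inj_onI, rule ccontr)
    fix x y assume xy: "x \<in> b' - b" "y \<in> b' - b" "{w. w - x \<in> W n} = {w. w - y \<in> W n}" "x \<noteq> y"
    have "x \<in> {w. w - x \<in> W n}" by simp
    then have "x - y \<in> vp.span b" unfolding span(1) using xy(3) by blast
    moreover have "b \<subseteq> b' - {x}" "y \<in> b' - {x}" using b' xy by auto
    ultimately have "x - y \<in> vp.span (b' - {x})" "y \<in> vp.span (b' - {x})"
      using vp.span_mono[of b "b' - {x}"] vp.span_base[of y "b' - {x}"] by blast+
    then have "(x - y) + y \<in> vp.span (b' - {x})" by (rule vp.span_add)
    then have "x \<in> vp.span (b' - {x})" by simp
    then show False using b'(1) xy(1) unfolding vp.dependent_def by blast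
  qed
  then show "countable (b' - b)"
    by (rule countable_image_inj_on[rotated]) (rule countable_subset[OF _ countable_cosets_W[of n]], auto)
qed

text \<open>The dilation is applied with \<open>A = W (n + s)\<close>, \<open>B = W n\<close> and
  \<open>E = W (- n)\<close>, so \<open>B / A\<close> has dimension \<open>s\<close>. The bounds
  \<open>ker\<close> and \<open>indef\<close> are assumed for all bases because the bases are chosen
  only inside the proof.\<close>

lemma dilation_GL0:
  fixes S :: "('k vp \<times> 'k vp) set" and n s :: nat
  assumes S: "S \<subseteq> W (- int n) \<times> W (- int n)" "W (int n) \<times> W (int n) \<subseteq> S"
      "\<And>x y x' y'. (x, y) \<in> S \<Longrightarrow> (x', y') \<in> S \<Longrightarrow> (x + x', y + y') \<in> S"
      "\<And>c x y. (x, y) \<in> S \<Longrightarrow> (vp_scale c x, vp_scale c y) \<in> S"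
    and ker: "\<And>b b'. vp.span b = W (int n) \<Longrightarrow> b \<subseteq> b' \<Longrightarrow> vp.independent b' \<Longrightarrow> vp.span b' = {x. (x, 0) \<in> S} \<Longrightarrow>
      finite (b' - b) \<and> card (b' - b) \<le> s"
    and indef: "\<And>b b'. vp.span b = W (int n) \<Longrightarrow> b \<subseteq> b' \<Longrightarrow> vp.independent b' \<Longrightarrow> vp.span b' = {y. (0, y) \<in> S} \<Longrightarrow>
      finite (b' - b) \<and> card (b' - b) \<le> s"
  shows "\<exists>g\<in>GL0 \<phi>. Vector_Spaces.linear vp_scale vp_scale g \<and> (\<forall>x\<in>W (int n + int s). g x = x) \<and>
    (\<forall>x\<in>W (int n). g x \<in> W (int n) \<longrightarrow> x \<in> W (int n + int s)) \<and>
    (\<forall>x\<in>W (- int n). g x \<in> W (- int n) \<longrightarrow> (x, g x) \<in> S) \<and>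
    (\<forall>(x, y)\<in>S. \<exists>v. x - v \<in> W (int n) \<and> y - g v \<in> W (int n))"
proof -
  let ?A = "W (int n + int s) :: 'k vp set" and ?B = "W (int n) :: 'k vp set" and ?E = "W (- int n) :: 'k vp set"
  have AB: "?A \<subseteq> ?B" and BE: "?B \<subseteq> ?E" by (rule W_antimono; simp)+
  obtain bA where bA: "bA \<subseteq> ?A" "vp.independent bA" "?A \<subseteq> vp.span bA"
    using vp.maximal_independent_subset[of ?A] by metis
  then have sA: "vp.span bA = ?A" using subspace_W vp.span_subspace by blast
  obtain bB where bB: "bA \<subseteq> bB" "bB \<subseteq> ?B" "vp.independent bB" "?B \<subseteq> vp.span bB"
    using vp.maximal_independent_subset_extend[OF subset_trans[OF bA(1) AB] bA(2)] by metis
  then have sB: "vp.span bB = ?B" using subspace_W vp.span_subspace by blast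
  have cB: "finite (bB - bA) \<and> card (bB - bA) = s"
    using card_basis_W[OF _ sA sB bB(1,3)] by simp
  have 0: "(0, 0) \<in> S" using S(2) zero_in_W by blast
  have K: "vp.subspace {x. (x, 0) \<in> S}" and I: "vp.subspace {y. (0, y) \<in> S}"
    using 0 S(3)[of _ 0 _ 0] S(3)[of 0 _ 0 _] S(4)[of _ 0] S(4)[of 0 _]
    by (auto intro!: vp.subspaceI)
  have BK: "bB \<subseteq> {x. (x, 0) \<in> S}" and BI: "bB \<subseteq> {y. (0, y) \<in> S}"
    using bB(2) S(2) zero_in_W by blast+
  obtain bK where bK: "bB \<subseteq> bK" "bK \<subseteq> {x. (x, 0) \<in> S}" "vp.independent bK" "{x. (x, 0) \<in> S} \<subseteq> vp.span bK"
    using vp.maximal_independent_subset_extend[OF BK bB(3)] by metis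
  then have sK: "vp.span bK = {x. (x, 0) \<in> S}" using K vp.span_subspace by blast
  obtain cI where cI: "bB \<subseteq> cI" "cI \<subseteq> {y. (0, y) \<in> S}" "vp.independent cI" "{y. (0, y) \<in> S} \<subseteq> vp.span cI"
    using vp.maximal_independent_subset_extend[OF BI bB(3)] by metis
  then have sI: "vp.span cI = {y. (0, y) \<in> S}" using I vp.span_subspace by blast
  have finE: "finite (b - bB)" if "vp.independent b" "bB \<subseteq> b" "vp.span b = ?E" for b
    using card_basis_W[OF _ sB that(3,2,1)] by simp
  have infV: "infinite (b' - b) \<and> countable (b' - b)"
    if "vp.independent b'" "b \<subseteq> b'" "vp.span b = ?E" "vp.span b' = UNIV" for b b'
    using basis_above_W[OF that] .
  have kk: "finite (bK - bB)" "card (bK - bB) \<le> card (bB - bA)"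
    using ker[OF sB bK(1,3) sK] cB by auto
  have ii: "finite (cI - bB)" "card (cI - bB) \<le> card (bB - bA)"
    using indef[OF sB cI(1,3) sI] cB by auto
  have "\<exists>g. Vector_Spaces.linear vp_scale vp_scale g \<and> bij g \<and> (\<forall>x\<in>?A. g x = x) \<and> (\<forall>x\<in>?B. g x \<in> ?B \<longrightarrow> x \<in> ?A) \<and>
    (\<forall>x\<in>?E. g x \<in> ?E \<longrightarrow> (x, g x) \<in> S) \<and> (\<forall>(x, y)\<in>S. \<exists>v. x - v \<in> ?B \<and> y - g v \<in> ?B)"
    by (rule vp.linear_relation_dilation[OF S(1,2) _ _ subspace_W sA bB(1) sB conjunct1[OF cB] bK(3,1) sK kk cI(3,1) sI ii])
      ((rule S(3) S(4) finE infV; assumption)+)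
  then obtain g where g: "Vector_Spaces.linear vp_scale vp_scale g" "bij g" "\<forall>x\<in>?A. g x = x"
    and g': "(\<forall>x\<in>?B. g x \<in> ?B \<longrightarrow> x \<in> ?A) \<and>
    (\<forall>x\<in>?E. g x \<in> ?E \<longrightarrow> (x, g x) \<in> S) \<and> (\<forall>(x, y)\<in>S. \<exists>v. x - v \<in> ?B \<and> y - g v \<in> ?B)"
    by (elim exE conjE) (rule that; (assumption | intro conjI; assumption))
  have "g \<in> GL0 \<phi>" by (rule GL0_I[OF g(1,2) bspec[OF g(3)]])
  moreover note g(1,3) g'
  ultimately show ?thesis by (intro bexI[of _ g]) simp_all
qed

text \<open>The relation \<open>W n \<times> W n\<close> has no kernel or indefiniteness modulo
  \<open>W n\<close>, so \<open>s = 0\<close> suffices. Its dilation moves every vector of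
  \<open>W (- n)\<close> outside \<open>W n\<close> out of \<open>W (- n)\<close>, and the graph
  meets the large window only over the small subgroup \<open>W n\<close>.\<close>

lemma graph_to_zero:
  "\<exists>g\<in>GL0 \<phi>. emeasure (graph_measure g) (Q (- int n)) \<le> emeasure \<phi> (W (int n))"
proof -
  let ?B = "W (int n) :: 'k vp set"
  have K: "{x. (x, 0) \<in> ?B \<times> ?B} = ?B" "{y. (0, y) \<in> ?B \<times> ?B} = ?B" by auto
  have c: "finite (b' - b) \<and> card (b' - b) \<le> 0"
    if "vp.span b = ?B" "b \<subseteq> b'" "vp.independent b'" "vp.span b' = ?B" for b b'
    using card_basis_W[OF order_refl that(1,4,2,3)] by simp
  have BE: "?B \<times> ?B \<subseteq> W (- int n) \<times> W (- int n)"
    by (intro Sigma_mono W_antimono) auto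
  have "\<exists>g\<in>GL0 \<phi>. Vector_Spaces.linear vp_scale vp_scale g \<and> (\<forall>x\<in>W (int n + int 0). g x = x) \<and>
    (\<forall>x\<in>?B. g x \<in> ?B \<longrightarrow> x \<in> W (int n + int 0)) \<and>
    (\<forall>x\<in>W (- int n). g x \<in> W (- int n) \<longrightarrow> (x, g x) \<in> ?B \<times> ?B) \<and>
    (\<forall>(x, y)\<in>?B \<times> ?B. \<exists>v. x - v \<in> ?B \<and> y - g v \<in> ?B)"
  proof (rule dilation_GL0[OF BE order_refl])
    show "(x + x', y + y') \<in> ?B \<times> ?B" if "(x, y) \<in> ?B \<times> ?B" "(x', y') \<in> ?B \<times> ?B" for x y x' y'
      using that W_add by blast
    show "(vp_scale k x, vp_scale k y) \<in> ?B \<times> ?B" if "(x, y) \<in> ?B \<times> ?B" for k x y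
      using that vp.subspace_scale[OF subspace_W] by blast
  qed (unfold K, rule c; assumption)+
  then obtain g where g: "g \<in> GL0 \<phi>" "\<And>x. x \<in> W (- int n) \<Longrightarrow> g x \<in> W (- int n) \<Longrightarrow> (x, g x) \<in> ?B \<times> ?B"
    by (elim bexE conjE) (rule that; blast)
  have "emeasure (graph_measure g) (Q (- int n)) = emeasure \<phi> {v. (v, g v) \<in> Q (- int n)}"
    by (rule emeasure_graph_measure[OF g(1)]) simp
  also have "\<dots> \<le> emeasure \<phi> ?B"
    using g(2) by (intro emeasure_mono) (auto simp: Q_def)
  finally show ?thesis using g(1) by blast
qed

end

context vp_relation
begin

text \<open>If the indefiniteness modulo \<open>W n\<close> has dimension \<open>t\<close>, the
  strip \<open>W n \<times> W (- n)\<close> has mass \<open>p^t\<close> times that of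
  \<open>Q n\<close>. Its mass is at most \<open>p^(-n)\<close> by domination of the first marginal,
  and \<open>Q n\<close> has mass \<open>p^(-n-s)\<close>, so \<open>t \<le> s\<close>.\<close>

lemma card_basis_indef:
  assumes span: "vp.span b = W (int n)" "b \<subseteq> b'" "vp.independent b'"
      "vp.span b' = {y \<in> W (- int n). \<exists>z\<in>R. fst z \<in> W (int n) \<and> y - snd z \<in> W (int n)}"
    and s: "emeasure m (Q (int n)) = ennreal (real p powi (- int n - int s))"
  shows "finite (b' - b) \<and> card (b' - b) \<le> s"
proof -
  let ?B = "W (int n) :: 'k vp set" and ?E = "W (- int n) :: 'k vp set"
  have BE: "?B \<subseteq> ?E" by (rule W_antimono) simp
  have *: "finite (b' - b) \<and> emeasure m (?B \<times> ?E) = of_nat (p ^ card (b' - b)) * emeasure m (?B \<times> ?B)"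
    by (rule index_snd[OF _ W_add W_uminus subspace_W BE refl span])
      (use emeasure_less_infinity emeasure_W_Times_pos in auto)
  have "emeasure m (?B \<times> ?E) \<le> emeasure m (?B \<times> UNIV)" by (intro emeasure_mono) auto
  also have "\<dots> \<le> emeasure \<phi> ?B" by (rule fst_le) simp
  finally have "ennreal (real p ^ card (b' - b) * real p powi (- int n - int s)) \<le> ennreal (real p powi (- int n))"
    using * s p_gt_1 by (simp add: phi_W Q_def ennreal_of_nat_eq_real_of_nat ennreal_mult)
  then have "real p ^ card (b' - b) * real p powi (- int n - int s) \<le> real p powi (- int n)"
    using p_gt_1 by (subst (asm) ennreal_le_iff) auto
  then have "real p ^ card (b' - b) \<le> real p ^ s"
    using p_gt_1 by (simp add: power_int_diff field_simps)
  then show ?thesis using * p_gt_1 by (simp add: power_increasing_iff)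
qed

lemma graph_approximation:
  assumes pp: "p_power (emeasure m (Q 0))"
  shows "\<exists>g\<in>GL0 \<phi>. \<forall>z\<in>Q (- int n). emeasure (graph_measure g) {w. w - z \<in> Q (int n)} = emeasure m {w. w - z \<in> Q (int n)}"
proof -
  let ?B = "W (int n) :: 'k vp set" and ?E = "W (- int n) :: 'k vp set"
  have BE: "?B \<subseteq> ?E" by (rule W_antimono) simp
  obtain i where i: "emeasure m (Q (int n)) = ennreal (real p powi i)"
    using pp p_power_emeasure_Q[of 0 "int n"] by (auto simp: p_power_def)
  have "real p powi i \<le> real p powi (- int n)"
    using emeasure_Q_le[of "int n"] i p_gt_1 by (simp add: phi_W ennreal_le_iff)
  then have "i \<le> - int n"
    using p_gt_1 power_int_strict_increasing[of "- int n" i "real p"] by (meson linorder_not_le)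
  \<comment> \<open>\<open>s\<close> measures how far the mass of \<open>Q n\<close> is below its
    maximum \<open>p^(-n)\<close>; by \<open>i \<le> - int n\<close> nothing is lost in passing to a
    natural number.\<close>
  define s where "s = nat (- int n - i)"
  have s: "emeasure m (Q (int n)) = ennreal (real p powi (- int n - int s))"
    using i \<open>i \<le> - int n\<close> by (simp add: s_def)
  \<comment> \<open>\<open>S\<close> is the union of the cosets of \<open>Q n\<close> in
    \<open>Q (- n)\<close> that meet \<open>R\<close>: all that is visible of \<open>R\<close> at
    this window and resolution.\<close>
  define S where "S = {z \<in> Q (- int n). \<exists>r\<in>R. z - r \<in> Q (int n)}"
  have QE: "z - r \<in> Q (int n) \<longleftrightarrow> fst z - fst r \<in> ?B \<and> snd z - snd r \<in> ?B" for z r :: "'k vp \<times> 'k vp"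
    by (auto simp: Q_def mem_Times_iff)
  have QEm: "Q (int n) \<subseteq> (Q (- int n) :: ('k vp \<times> 'k vp) set)" by (rule Q_antimono) simp
  have S1: "S \<subseteq> ?E \<times> ?E" by (auto simp: S_def Q_def)
  have S2: "?B \<times> ?B \<subseteq> S"
  proof
    fix z assume "z \<in> ?B \<times> ?B"
    then have "z \<in> Q (int n)" by (simp add: Q_def)
    then show "z \<in> S" using QEm R_zero by (auto simp: S_def intro!: bexI[of _ 0])
  qed
  have S3: "(x + x', y + y') \<in> S" if xy: "(x, y) \<in> S" "(x', y') \<in> S" for x y x' y'
  proof -
    obtain r r' where r: "r \<in> R" "r' \<in> R" "(x, y) - r \<in> Q (int n)" "(x', y') - r' \<in> Q (int n)"
      using xy by (auto simp: S_def)
    have "((x, y) - r) + ((x', y') - r') \<in> Q (int n)" using r Q_add by blast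
    then have "(x + x', y + y') - (r + r') \<in> Q (int n)" by (simp add: algebra_simps)
    moreover have "(x, y) + (x', y') \<in> Q (- int n)" using xy by (intro Q_add) (auto simp: S_def)
    ultimately show ?thesis using R_add[OF r(1,2)] by (auto simp: S_def)
  qed
  have S4: "(vp_scale c x, vp_scale c y) \<in> S" if xy: "(x, y) \<in> S" for c x y
  proof -
    obtain a b where r: "(a, b) \<in> R" "x - a \<in> ?B" "y - b \<in> ?B" and E: "x \<in> ?E" "y \<in> ?E"
      using xy by (auto simp: S_def Q_def)
    have "vp_scale c x - vp_scale c a \<in> ?B" "vp_scale c y - vp_scale c b \<in> ?B"
      using W_scale[OF r(2), of c] W_scale[OF r(3), of c] by (simp_all add: vp.scale_right_diff_distrib)
    then have "(vp_scale c x, vp_scale c y) - (vp_scale c a, vp_scale c b) \<in> Q (int n)"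
      by (simp add: Q_def)
    moreover have "(vp_scale c x, vp_scale c y) \<in> Q (- int n)"
      using W_scale[OF E(1)] W_scale[OF E(2)] by (simp add: Q_def)
    ultimately show ?thesis
      using R_scale[OF r(1), of c] unfolding S_def by blast
  qed
  have W_neg: "- x \<in> ?B \<longleftrightarrow> x \<in> ?B" for x using W_uminus[of x] W_uminus[of "- x"] by auto
  have I: "{y. (0, y) \<in> S} = {y \<in> ?E. \<exists>z\<in>R. fst z \<in> ?B \<and> y - snd z \<in> ?B}"
    by (auto simp: S_def QE W_neg) (auto simp: Q_def)
  \<comment> \<open>The kernel of \<open>S\<close> is the indefiniteness of the converse relation,
    so its dimension is bounded by applying the same estimate to the swapped measure.\<close>
  have K: "{x. (x, 0) \<in> S} = {y \<in> ?E. \<exists>z\<in>R\<inverse>. fst z \<in> ?B \<and> y - snd z \<in> ?B}"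
  proof -
    have "(\<exists>z\<in>R\<inverse>. fst z \<in> ?B \<and> x - snd z \<in> ?B) \<longleftrightarrow> (\<exists>r\<in>R. x - fst r \<in> ?B \<and> snd r \<in> ?B)" for x
      by force
    then show ?thesis by (auto simp: S_def QE W_neg) (auto simp: Q_def)
  qed
  interpret sw: vp_relation \<phi> p "R\<inverse>" "distr m borel prod.swap" by (rule swap)
  have swQ: "prod.swap -` Q (int n) = Q (int n)" by (auto simp: Q_def)
  have "emeasure (distr m borel prod.swap) (Q (int n)) = emeasure m (prod.swap -` Q (int n))"
    by (rule emeasure_swap) simp
  then have s': "emeasure (distr m borel prod.swap) (Q (int n)) = ennreal (real p powi (- int n - int s))"
    by (simp only: swQ s)
  have "\<exists>g\<in>GL0 \<phi>. Vector_Spaces.linear vp_scale vp_scale g \<and> (\<forall>x\<in>W (int n + int s). g x = x) \<and>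
    (\<forall>x\<in>?B. g x \<in> ?B \<longrightarrow> x \<in> W (int n + int s)) \<and>
    (\<forall>x\<in>?E. g x \<in> ?E \<longrightarrow> (x, g x) \<in> S) \<and>
    (\<forall>(x, y)\<in>S. \<exists>v. x - v \<in> ?B \<and> y - g v \<in> ?B)"
  proof (rule dilation_GL0[OF S1 S2 S3 S4])
    show "finite (b' - b) \<and> card (b' - b) \<le> s"
      if "vp.span b = ?B" "b \<subseteq> b'" "vp.independent b'" "vp.span b' = {x. (x, 0) \<in> S}" for b b'
      using sw.card_basis_indef[OF that[unfolded K] s'] .
    show "finite (b' - b) \<and> card (b' - b) \<le> s"
      if "vp.span b = ?B" "b \<subseteq> b'" "vp.independent b'" "vp.span b' = {y. (0, y) \<in> S}" for b b'
      using card_basis_indef[OF that[unfolded I] s] .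
  qed assumption+
  then obtain g where g: "g \<in> GL0 \<phi>" and lin: "Vector_Spaces.linear vp_scale vp_scale g"
    and gA: "\<And>x. x \<in> W (int n + int s) \<Longrightarrow> g x = x"
    and gB: "\<And>x. x \<in> ?B \<Longrightarrow> g x \<in> ?B \<Longrightarrow> x \<in> W (int n + int s)"
    and gE: "\<And>x. x \<in> ?E \<Longrightarrow> g x \<in> ?E \<Longrightarrow> (x, g x) \<in> S"
    and gS: "\<And>x y. (x, y) \<in> S \<Longrightarrow> \<exists>v. x - v \<in> ?B \<and> y - g v \<in> ?B"
    by blast
  interpret g: Vector_Spaces.linear vp_scale vp_scale g by fact
  have AB: "W (int n + int s) \<subseteq> ?B" by (rule W_antimono) simp
  have "emeasure (graph_measure g) {w. w - z \<in> Q (int n)} = emeasure m {w. w - z \<in> Q (int n)}"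
    if z: "z \<in> Q (- int n)" for z
  proof (cases "z \<in> S")
    case True
    then obtain v where v: "fst z - v \<in> ?B" "snd z - g v \<in> ?B"
      using gS[of "fst z" "snd z"] by auto
    \<comment> \<open>One graph point near \<open>z\<close> determines all of them: two differ by a
      vector of \<open>W n\<close> whose image is in \<open>W n\<close>, hence by a vector of
      \<open>W (n + s)\<close>, and \<open>g\<close> fixes those vectors.\<close>
    have "(w, g w) - z \<in> Q (int n) \<longleftrightarrow> w - v \<in> W (int n + int s)" for w
    proof
      assume "(w, g w) - z \<in> Q (int n)"
      then have "(w - fst z) + (fst z - v) \<in> ?B" "(g w - snd z) + (snd z - g v) \<in> ?B"
        using v by (auto simp only: QE fst_conv snd_conv intro!: W_add)
      then show "w - v \<in> W (int n + int s)" by (intro gB) (simp_all add: g.diff)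
    next
      assume w: "w - v \<in> W (int n + int s)"
      then have wB: "w - v \<in> ?B" using AB by blast
      then have "g w - g v \<in> ?B" using gA[OF w] by (simp add: g.diff)
      then have "(w - v) - (fst z - v) \<in> ?B" "(g w - g v) - (snd z - g v) \<in> ?B"
        using v wB W_diff by blast+
      then show "(w, g w) - z \<in> Q (int n)" by (simp add: QE)
    qed
    then have "emeasure (graph_measure g) {w. w - z \<in> Q (int n)} = emeasure \<phi> (W (int n + int s))"
      using emeasure_graph_measure[OF g, of "{w. w - z \<in> Q (int n)}"] by (simp add: phi_coset)
    also have "\<dots> = emeasure m (Q (int n))" by (simp add: phi_W s)
    also have "\<dots> = emeasure m {w. w - z \<in> Q (int n)}"
    proof -
      obtain r where "r \<in> R" "z - r \<in> Q (int n)" using True by (auto simp: S_def)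
      then have "r \<in> R" "r - z \<in> Q (int n)" using Q_uminus[of "z - r"] by auto
      then show ?thesis by (subst emeasure_coset_Q) auto
    qed
    finally show ?thesis .
  next
    case False
    \<comment> \<open>A graph point in this coset would lie in \<open>Q (- n)\<close>, hence in
      \<open>S\<close>, and an element of \<open>R\<close> near it would also be near
      \<open>z\<close>.\<close>
    have "{v. (v, g v) - z \<in> Q (int n)} = {}"
    proof (rule ccontr)
      assume "{v. (v, g v) - z \<in> Q (int n)} \<noteq> {}"
      then obtain v where v: "(v, g v) - z \<in> Q (int n)" by blast
      then have "((v, g v) - z) + z \<in> Q (- int n)" using z QEm by (intro Q_add) auto
      then have "(v, g v) \<in> S" using gE by (simp add: Q_def)
      then obtain r where r: "r \<in> R" "(v, g v) - r \<in> Q (int n)" by (auto simp: S_def)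
      have "((v, g v) - r) - ((v, g v) - z) \<in> Q (int n)" using r v Q_diff by blast
      then have "z - r \<in> Q (int n)" by (simp add: prod_eq_iff)
      then show False using False z r by (auto simp: S_def)
    qed
    then have "emeasure (graph_measure g) {w. w - z \<in> Q (int n)} = 0"
      using emeasure_graph_measure[OF g, of "{w. w - z \<in> Q (int n)}"] by simp
    also have "0 = emeasure m {w. w - z \<in> Q (int n)}"
    proof -
      have "\<not> (\<exists>r\<in>R. r - z \<in> Q (int n))"
      proof
        assume "\<exists>r\<in>R. r - z \<in> Q (int n)"
        then obtain r where "r \<in> R" "- (r - z) \<in> Q (int n)" using Q_uminus by blast
        then show False using False z by (auto simp: S_def)
      qed
      then show ?thesis by (subst emeasure_coset_Q) auto
    qed
    finally show ?thesis .
  qed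
  with g show ?thesis by blast
qed

end

section \<open>Closedness and limits of graphs\<close>

lemma p_power_limit:
  fixes x :: "nat \<Rightarrow> real"
  assumes p: "p > 1" and x: "\<And>n. x n = 0 \<or> (\<exists>i :: int. x n = p powi i)" and lim: "x \<longlonglongrightarrow> c" and c: "c > 0"
  shows "\<exists>i :: int. c = p powi i"
proof -
  have ev: "eventually (\<lambda>n. c / 2 < x n) sequentially"
    using order_tendstoD(1)[OF lim, of "c / 2"] c by simp
  have "(\<lambda>n. log p (x n)) \<longlonglongrightarrow> log p c"
    using p c by (intro tendsto_intros lim) auto
  then have "eventually (\<lambda>n. dist (log p (x n)) (log p c) < 1 / 2) sequentially"
    by (rule tendstoD) simp
  \<comment> \<open>Within distance less than \<open>1 / 2\<close> of \<open>log p c\<close> there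
    is at most one integer. The exponents are therefore eventually constant, not merely
    convergent.\<close>
  with ev have "eventually (\<lambda>n. \<exists>i :: int. x n = p powi i \<and> \<bar>real_of_int i - log p c\<bar> < 1 / 2) sequentially"
  proof eventually_elim
    case (elim n)
    then obtain i :: int where i: "x n = p powi i" using x[of n] c by auto
    moreover have "p powi i = p powr real_of_int i" using p by (simp add: powr_real_of_int')
    ultimately have "log p (x n) = real_of_int i" using p by simp
    then show ?case using elim i by (auto simp: dist_real_def)
  qed
  moreover have "i = round (log p c)" if "\<bar>real_of_int i - log p c\<bar> < 1 / 2" for i :: int
    using that by (intro round_unique'[symmetric]) (simp add: abs_minus_commute)
  ultimately have "eventually (\<lambda>n. x n = p powi round (log p c)) sequentially"
    by (auto elim!: eventually_mono)
  then have "x \<longlonglongrightarrow> p powi round (log p c)" by (rule tendsto_eventually)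
  then have "c = p powi round (log p c)" using lim LIMSEQ_unique by blast
  then show ?thesis ..
qed

context vp_haar
begin

text \<open>Mass zero on \<open>Q 0\<close> occurs exactly for \<open>Zero\<close>, since a nonzero
  pair charges \<open>Q 0\<close>. Membership is thereby decided by a single real number.\<close>

lemma Polh_restricted_measure:
  assumes P: "P \<in> Polh \<phi>"
  shows "P \<in> Polh_restricted \<phi> {real p ^ j | j :: nat. True} \<longleftrightarrow>
    measure (polyhom_measure P) (Q 0) = 0 \<or> (\<exists>i. measure (polyhom_measure P) (Q 0) = real p powi i)"
proof (cases P)
  case Zero
  then show ?thesis by (simp add: Polh_restricted_def polyhom_measure_def measure_def)
next
  case (Pair_polyhom R \<rho>)
  then interpret vp_relation \<phi> p R "distr \<rho> borel (\<lambda>z. z)"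
    using P Pair_polyhom_in_Polh_iff by simp
  have m: "emeasure (distr \<rho> borel (\<lambda>z. z)) (Q 0) = ennreal (measure (distr \<rho> borel (\<lambda>z. z)) (Q 0))"
    using emeasure_less_infinity(1)[of 0 "W 0"] by (intro emeasure_eq_ennreal_measure) (auto simp: Q_def)
  then have "measure (distr \<rho> borel (\<lambda>z. z)) (Q 0) > 0"
    using emeasure_Q_pos[of 0] by (simp add: zero_less_iff_neq_zero) (metis ennreal_0 measure_nonneg order_le_less)
  then show ?thesis
    using Polh_restricted_iff[of R \<rho>] P m p_gt_1
    by (auto simp: Pair_polyhom polyhom_measure_def p_power_def ennreal_inj)
qed

text \<open>As the mass of \<open>Q 0\<close> decides membership, one test function controls the
  limit. If infinitely many terms were restricted, their masses along a subsequence would converge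
  to zero or to a power of \<open>p\<close>, and the limit would be restricted as well.\<close>

lemma closedin_restricted:
  "closedin (Polh_topology \<phi>) (Polh_restricted \<phi> {real p ^ j | j :: nat. True})" (is "closedin _ ?C")
  unfolding closedin_def topspace_Polh_topology openin_Polh_topology
proof (intro conjI allI impI, goal_cases)
  case 1
  show ?case by (auto simp: Polh_restricted_def Polh_def)
next
  case 2
  show ?case by blast
next
  case (3 X P)
  then have X: "\<And>n. X n \<in> Polh \<phi>" and P: "P \<in> Polh \<phi>" "P \<notin> ?C" and conv: "polyhom_converges X P" by auto
  show ?case
  proof (rule ccontr)
    assume "\<not> (\<forall>\<^sub>F j in sequentially. X j \<in> Polh \<phi> - ?C)"
    then have "\<exists>\<^sub>F j in sequentially. X j \<in> ?C" using X by (simp add: frequently_def)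
    then have inf: "infinite {j. X j \<in> ?C}"
      by (simp add: frequently_cofinite[symmetric] cofinite_eq_sequentially)
    define r where "r = enumerate {j. X j \<in> ?C}"
    have r: "strict_mono r" "\<And>j. X (r j) \<in> ?C"
      using strict_mono_enumerate[OF inf] enumerate_in_set[OF inf] by (auto simp: r_def)
    let ?m = "\<lambda>P. measure (polyhom_measure P) (Q 0)"
    have lim: "(\<lambda>j. ?m (X (r j))) \<longlonglongrightarrow> ?m P"
      using LIMSEQ_subseq_LIMSEQ[OF polyhom_converges_emeasure_Q[OF X P(1) conv] r(1)] by (simp add: comp_def)
    have "?m (X (r j)) = 0 \<or> (\<exists>i. ?m (X (r j)) = real p powi i)" for j
      using Polh_restricted_measure[OF X] r(2) by blast
    then have "?m P = 0 \<or> (\<exists>i. ?m P = real p powi i)"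
      using p_power_limit[OF p_gt_1 _ lim] by (metis measure_nonneg order_le_less)
    then show False using Polh_restricted_measure P by blast
  qed
qed

lemma in_closure_sequence:
  assumes "P \<in> Polh \<phi>" "\<And>n. X n \<in> Polh \<phi>" "\<And>n. X n \<in> A" "polyhom_converges X P"
  shows "P \<in> Polh_topology \<phi> closure_of A"
  unfolding in_closure_of topspace_Polh_topology
proof (intro conjI allI impI)
  fix U assume U: "P \<in> U \<and> openin (Polh_topology \<phi>) U"
  then have "\<forall>\<^sub>F j in sequentially. X j \<in> U"
    unfolding openin_Polh_topology using assms by blast
  then obtain j where "X j \<in> U" by (auto simp: eventually_sequentially)
  then show "\<exists>y. y \<in> A \<and> y \<in> U" using assms by blast
qed (rule assms)

text \<open>Once the support of a test function bounded by \<open>M\<close> lies in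
  \<open>Q (- n)\<close>, its integral over the \<open>n\<close>-th graph is at most
  \<open>\<bar>M\<bar>\<close> times \<open>p^(-n)\<close>: the growing window carries shrinking
  mass.\<close>

lemma Zero_in_closure: "Zero \<in> Polh_topology \<phi> closure_of (graph_polyhom \<phi> ` GL0 \<phi>)"
proof -
  obtain g where g: "\<And>n :: nat. g n \<in> GL0 \<phi>" "\<And>n. emeasure (graph_measure (g n)) (Q (- int n)) \<le> emeasure \<phi> (W (int n))"
    using graph_to_zero by metis
  show ?thesis
  proof (rule in_closure_sequence[of _ "\<lambda>n. graph_polyhom \<phi> (g n)"])
    show "polyhom_converges (\<lambda>n. graph_polyhom \<phi> (g n)) Zero"
      unfolding polyhom_converges_def
    proof (intro allI impI, elim conjE)
      fix \<theta> :: "'k vp \<times> 'k vp \<Rightarrow> real"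
      assume cont: "continuous_on UNIV \<theta>" and cpt: "compact (closure {x. \<theta> x \<noteq> 0})"
      obtain N where N: "closure {x. \<theta> x \<noteq> 0} \<subseteq> Q (- int N)" using compact_subset_Q[OF cpt] by blast
      have "compact (\<theta> ` closure {x. \<theta> x \<noteq> 0})"
        using cont cpt by (intro compact_continuous_image) (auto intro: continuous_on_subset)
      then have "bounded (\<theta> ` closure {x. \<theta> x \<noteq> 0})" by (rule compact_imp_bounded)
      then obtain M where M: "\<And>x. x \<in> closure {x. \<theta> x \<noteq> 0} \<Longrightarrow> \<bar>\<theta> x\<bar> \<le> M"
        unfolding bounded_real by blast
      have close: "\<bar>\<theta> x\<bar> \<le> \<bar>M\<bar> * indicator (Q (- int n)) x" if n: "n \<ge> N" for n x
      proof (cases "\<theta> x = 0")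
        case False
        then have x: "x \<in> closure {x. \<theta> x \<noteq> 0}"
          using subsetD[OF closure_subset, of x "{x. \<theta> x \<noteq> 0}"] by simp
        have "Q (- int N) \<subseteq> (Q (- int n) :: ('k vp \<times> 'k vp) set)" using n by (intro Q_antimono) simp
        then have "x \<in> Q (- int n)" using x N by blast
        then show ?thesis using M[OF x] by simp
      qed simp
      have bound: "\<bar>polyhom_integral (graph_polyhom \<phi> (g n)) \<theta>\<bar> \<le> \<bar>M\<bar> * real p powi (- int n)" if n: "n \<ge> N" for n
      proof -
        \<comment> \<open>The empty family of cosets compares \<theta> with the zero function, which
          turns the approximation estimate into a bound on the integral itself.\<close>
        have "\<bar>(\<integral>x. \<theta> x \<partial>graph_measure (g n)) - (\<Sum>c\<in>{}. 0 * measure (graph_measure (g n)) c)\<bar> \<le> \<bar>M\<bar> * real p powi (- int n)"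
        proof (rule integral_step_close[where n = n])
          show "emeasure (graph_measure (g n)) (Q (- int n)) \<le> ennreal (real p powi (- int n))"
            using g(2)[of n] by (simp add: phi_W)
          show "\<theta> \<in> borel_measurable borel" using cont by (rule borel_measurable_continuous_onI)
          show "\<bar>\<theta> x - (\<Sum>c\<in>{}. 0 * indicator c x)\<bar> \<le> \<bar>M\<bar> * indicator (Q (- int n)) x" for x
            using close[OF n] by simp
        qed (use p_gt_1 in \<open>auto simp: graph_measure_def\<close>)
        then show ?thesis
          using polyhom_integral_eq[OF graph_polyhom_in_Polh[OF g(1)] cont] polyhom_measure_graph[OF g(1)] by simp
      qed
      have "(\<lambda>n. \<bar>M\<bar> * real p powi (- int n)) \<longlonglongrightarrow> \<bar>M\<bar> * 0"
      proof (intro tendsto_mult_left)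
        have "(\<lambda>n. (1 / real p) ^ n) \<longlonglongrightarrow> 0" using p_gt_1 by (intro LIMSEQ_realpow_zero) auto
        moreover have "real p powi (- int n) = (1 / real p) ^ n" for n
          by (simp add: power_int_minus power_one_over inverse_eq_divide)
        ultimately show "(\<lambda>n. real p powi (- int n)) \<longlonglongrightarrow> 0" by (simp only:)
      qed
      then have lim: "(\<lambda>n. \<bar>M\<bar> * real p powi (- int n)) \<longlonglongrightarrow> 0" by (simp only: mult_zero_right)
      have "(\<lambda>n. polyhom_integral (graph_polyhom \<phi> (g n)) \<theta>) \<longlonglongrightarrow> 0"
      proof (rule Lim_null_comparison[OF _ lim])
        show "\<forall>\<^sub>F n in sequentially. norm (polyhom_integral (graph_polyhom \<phi> (g n)) \<theta>) \<le> \<bar>M\<bar> * real p powi (- int n)"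
          unfolding eventually_sequentially real_norm_def using bound by blast
      qed
      then show "(\<lambda>j. polyhom_integral (graph_polyhom \<phi> (g j)) \<theta>) \<longlonglongrightarrow> polyhom_integral Zero \<theta>" by simp
    qed
  qed (use g graph_polyhom_in_Polh in \<open>auto simp: Polh_def\<close>)
qed

lemma restricted_subset_closure:
  assumes "P \<in> Polh_restricted \<phi> {real p ^ j | j :: nat. True}"
  shows "P \<in> Polh_topology \<phi> closure_of (graph_polyhom \<phi> ` GL0 \<phi>)"
proof (cases P)
  case Zero
  then show ?thesis using Zero_in_closure by simp
next
  case (Pair_polyhom R \<rho>)
  then have P: "P \<in> Polh \<phi>" using assms by (auto simp: Polh_restricted_def)
  then interpret vp_relation \<phi> p R "distr \<rho> borel (\<lambda>z. z)"
    using Pair_polyhom_in_Polh_iff Pair_polyhom by simp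
  have "p_power (emeasure (distr \<rho> borel (\<lambda>z. z)) (Q 0))"
    using Polh_restricted_iff P assms Pair_polyhom by simp
  from graph_approximation[OF this] obtain g where g: "\<And>n :: nat. g n \<in> GL0 \<phi>"
    "\<And>n z. z \<in> Q (- int n) \<Longrightarrow> emeasure (graph_measure (g n)) {w. w - z \<in> Q (int n)} = emeasure (distr \<rho> borel (\<lambda>z. z)) {w. w - z \<in> Q (int n)}"
    by metis
  have "polyhom_converges (\<lambda>n. graph_polyhom \<phi> (g n)) P"
  proof (rule polyhom_convergesI[OF graph_polyhom_in_Polh[OF g(1)] P])
    show "emeasure (polyhom_measure (graph_polyhom \<phi> (g n))) {w. w - z \<in> Q (int n)} = emeasure (polyhom_measure P) {w. w - z \<in> Q (int n)}"
      if "z \<in> Q (- int n)" for n z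
      using g(2)[OF that] polyhom_measure_graph[OF g(1)] by (simp add: Pair_polyhom polyhom_measure_def)
  qed
  then show ?thesis
    using P g graph_polyhom_in_Polh by (intro in_closure_sequence[of _ "\<lambda>n. graph_polyhom \<phi> (g n)"]) auto
qed

end

theorem theorem1p9:
  fixes p :: nat and \<phi> :: "'k::{field,finite} vp measure"
  assumes "prime p" and "CARD('k) = p"
    and "haar_measure_on UNIV \<phi>" and "emeasure \<phi> (W 0) = 1"
  shows "Polh_topology \<phi> closure_of (graph_polyhom \<phi> ` GL0 \<phi>)
    = Polh_restricted \<phi> {real p ^ j | j :: nat. True}"
proof -
  interpret vp_haar \<phi> p
    using assms by unfold_locales
  show ?thesis
  proof
    show "Polh_topology \<phi> closure_of (graph_polyhom \<phi> ` GL0 \<phi>) \<subseteq> Polh_restricted \<phi> {real p ^ j | j :: nat. True}"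
      using graph_polyhom_in_restricted by (intro closure_of_minimal closedin_restricted) blast
    show "Polh_restricted \<phi> {real p ^ j | j :: nat. True} \<subseteq> Polh_topology \<phi> closure_of (graph_polyhom \<phi> ` GL0 \<phi>)"
      using restricted_subset_closure by blast
  qed
qed

end
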